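(* Let $A$ be a non-split, non-Lie, nilpotent (left) Leibniz algebra over $\mathbb{C}$ of dimension $7$ with $\dim(A^2)=1$. Then $A$ is isomorphic to a Leibniz algebra with basis $\{x_1,x_2,x_3,x_4,x_5,x_6,x_7\}$ whose nonzero products of basis vectors are given by one of the following: (1) $[x_1,x_6]=x_7,\ [x_2,x_5]=x_7,\ [x_2,x_6]=cx_7,\ [x_3,x_4]=x_7,\ [x_3,x_5]=cx_7,\ [x_4,x_3]=cx_7,\ [x_5,x_2]=cx_7,\ [x_5,x_3]=x_7,\ [x_6,x_1]=cx_7,\ [x_6,x_2]=x_7$, $c\in\mathbb{C}\setminus\{1,-1\}$. (2) $[x_1,x_6]=x_7,\ [x_2,x_5]=x_7,\ [x_2,x_6]=x_7,\ [x_3,x_4]=x_7,\ [x_3,x_5]=x_7,\ [x_4,x_3]=-x_7,\ [x_4,x_4]=x_7,\ [x_5,x_2]=-x_7,\ [x_5,x_3]=x_7,\ [x_6,x_1]=-x_7,\ [x_6,x_2]=x_7$. (3) $[x_1,x_6]=x_7,\ [x_2,x_5]=x_7,\ [x_2,x_6]=x_7,\ [x_3,x_4]=x_7,\ [x_3,x_5]=x_7,\ [x_4,x_3]=-x_7,\ [x_5,x_2]=-x_7,\ [x_5,x_3]=x_7,\ [x_6,x_1]=-x_7,\ [x_6,x_2]=x_7$. (4) $[x_1,x_4]=x_7,\ [x_2,x_5]=x_7,\ [x_4,x_2]=x_7,\ [x_5,x_3]=x_7,\ [x_6,x_6]=x_7$. (5) $[x_1,x_5]=x_7,\ [x_2,x_4]=x_7,\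 [x_2,x_5]=x_7,\ [x_3,x_3]=x_7,\ [x_3,x_4]=x_7,\ [x_4,x_2]=x_7,\ [x_4,x_3]=-x_7,\ [x_5,x_1]=x_7,\ [x_5,x_2]=-x_7,\ [x_6,x_6]=x_7$. (6) $[x_1,x_4]=x_7,\ [x_2,x_3]=x_7,\ [x_2,x_4]=cx_7,\ [x_3,x_2]=cx_7,\ [x_4,x_1]=cx_7,\ [x_4,x_2]=x_7,\ [x_5,x_6]=x_7,\ [x_6,x_5]=-x_7$, $c\in\mathbb{C}\setminus\{1,-1\}$. (7) $[x_1,x_4]=x_7,\ [x_2,x_3]=x_7,\ [x_2,x_4]=cx_7,\ [x_3,x_2]=cx_7,\ [x_4,x_1]=cx_7,\ [x_4,x_2]=x_7,\ [x_5,x_6]=x_7,\ [x_6,x_5]=-x_7,\ [x_6,x_6]=x_7$, $c\in\mathbb{C}\setminus\{1,-1\}$. (8) $[x_1,x_4]=x_7,\ [x_2,x_3]=x_7,\ [x_2,x_4]=c_1x_7,\ [x_3,x_2]=c_1x_7,\ [x_4,x_1]=c_1x_7,\ [x_4,x_2]=x_7,\ [x_5,x_6]=x_7,\ [x_6,x_5]=c_2x_7$, $c_1,c_2\in\mathbb{C}\setminus\{1,-1\}$. (9) $[x_1,x_4]=x_7,\ [x_2,x_3]=x_7,\ [x_2,x_4]=x_7,\ [x_3,x_2]=x_7,\ [x_4,x_1]=x_7,\ [x_4,x_2]=-x_7,\ [x_5,x_6]=x_7,\ [x_6,x_5]=-x_7$. (10) $[x_1,x_4]=x_7,\ [x_2,x_3]=x_7,\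 [x_2,x_4]=x_7,\ [x_3,x_2]=x_7,\ [x_4,x_1]=x_7,\ [x_4,x_2]=-x_7,\ [x_5,x_6]=x_7,\ [x_6,x_5]=-x_7,\ [x_6,x_6]=x_7$. (11) $[x_1,x_4]=x_7,\ [x_2,x_3]=x_7,\ [x_2,x_4]=x_7,\ [x_3,x_2]=x_7,\ [x_4,x_1]=x_7,\ [x_4,x_2]=-x_7,\ [x_5,x_6]=x_7,\ [x_6,x_5]=cx_7$, $c\in\mathbb{C}\setminus\{1,-1\}$. (12) $[x_1,x_4]=x_7,\ [x_2,x_3]=x_7,\ [x_2,x_4]=x_7,\ [x_3,x_2]=-x_7,\ [x_3,x_3]=x_7,\ [x_4,x_1]=-x_7,\ [x_4,x_2]=x_7,\ [x_5,x_6]=x_7,\ [x_6,x_5]=-x_7$. (13) $[x_1,x_4]=x_7,\ [x_2,x_3]=x_7,\ [x_2,x_4]=x_7,\ [x_3,x_2]=-x_7,\ [x_3,x_3]=x_7,\ [x_4,x_1]=-x_7,\ [x_4,x_2]=x_7,\ [x_5,x_6]=x_7,\ [x_6,x_5]=-x_7,\ [x_6,x_6]=x_7$. (14) $[x_1,x_4]=x_7,\ [x_2,x_3]=x_7,\ [x_2,x_4]=x_7,\ [x_3,x_2]=-x_7,\ [x_3,x_3]=x_7,\ [x_4,x_1]=-x_7,\ [x_4,x_2]=x_7,\ [x_5,x_6]=x_7,\ [x_6,x_5]=cx_7$, $c\in\mathbb{C}\setminus\{1,-1\}$. (15) $[x_1,x_4]=x_7,\ [x_2,x_3]=x_7,\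 [x_2,x_4]=cx_7,\ [x_3,x_2]=cx_7,\ [x_4,x_1]=cx_7,\ [x_4,x_2]=x_7,\ [x_5,x_5]=x_7,\ [x_6,x_6]=x_7$, $c\in\mathbb{C}\setminus\{1,-1\}$. (16) $[x_1,x_4]=x_7,\ [x_2,x_3]=x_7,\ [x_2,x_4]=x_7,\ [x_3,x_2]=x_7,\ [x_4,x_1]=x_7,\ [x_4,x_2]=-x_7,\ [x_5,x_5]=x_7,\ [x_6,x_6]=x_7$. (17) $[x_1,x_4]=x_7,\ [x_2,x_3]=x_7,\ [x_2,x_4]=x_7,\ [x_3,x_2]=-x_7,\ [x_3,x_3]=x_7,\ [x_4,x_1]=-x_7,\ [x_4,x_2]=x_7,\ [x_5,x_5]=x_7,\ [x_6,x_6]=x_7$. (18) $[x_1,x_3]=x_7,\ [x_3,x_2]=x_7,\ [x_4,x_6]=x_7,\ [x_6,x_5]=x_7$. (19) $[x_1,x_3]=x_7,\ [x_3,x_2]=x_7,\ [x_4,x_6]=x_7,\ [x_5,x_5]=x_7,\ [x_5,x_6]=x_7,\ [x_6,x_4]=x_7,\ [x_6,x_5]=-x_7$. (20) $[x_1,x_3]=x_7,\ [x_2,x_2]=x_7,\ [x_2,x_3]=x_7,\ [x_3,x_1]=x_7,\ [x_3,x_2]=-x_7,\ [x_4,x_6]=x_7,\ [x_5,x_5]=x_7,\ [x_5,x_6]=x_7,\ [x_6,x_4]=x_7,\ [x_6,x_5]=-x_7$. (21) $[x_1,x_3]=x_7,\ [x_3,x_2]=x_7,\ [x_4,x_5]=x_7,\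 [x_5,x_4]=-x_7,\ [x_6,x_6]=x_7$. (22) $[x_1,x_3]=x_7,\ [x_3,x_2]=x_7,\ [x_4,x_5]=x_7,\ [x_5,x_4]=-x_7,\ [x_5,x_5]=x_7,\ [x_6,x_6]=x_7$. (23) $[x_1,x_3]=x_7,\ [x_3,x_2]=x_7,\ [x_4,x_5]=x_7,\ [x_5,x_4]=cx_7,\ [x_6,x_6]=x_7$, $c\in\mathbb{C}\setminus\{1,-1\}$. (24) $[x_1,x_3]=x_7,\ [x_2,x_2]=x_7,\ [x_2,x_3]=x_7,\ [x_3,x_1]=x_7,\ [x_3,x_2]=-x_7,\ [x_4,x_5]=x_7,\ [x_5,x_4]=-x_7,\ [x_6,x_6]=x_7$. (25) $[x_1,x_3]=x_7,\ [x_2,x_2]=x_7,\ [x_2,x_3]=x_7,\ [x_3,x_1]=x_7,\ [x_3,x_2]=-x_7,\ [x_4,x_5]=x_7,\ [x_5,x_4]=-x_7,\ [x_5,x_5]=x_7,\ [x_6,x_6]=x_7$. (26) $[x_1,x_3]=x_7,\ [x_2,x_2]=x_7,\ [x_2,x_3]=x_7,\ [x_3,x_1]=x_7,\ [x_3,x_2]=-x_7,\ [x_4,x_5]=x_7,\ [x_5,x_4]=cx_7,\ [x_6,x_6]=x_7$, $c\in\mathbb{C}\setminus\{1,-1\}$. (27) $[x_1,x_3]=x_7,\ [x_3,x_2]=x_7,\ [x_4,x_4]=x_7,\ [x_5,x_5]=x_7,\ [x_6,x_6]=x_7$. (28) $[x_1,x_3]=x_7,\ [x_2,x_2]=x_7,\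 [x_2,x_3]=x_7,\ [x_3,x_1]=x_7,\ [x_3,x_2]=-x_7,\ [x_4,x_4]=x_7,\ [x_5,x_5]=x_7,\ [x_6,x_6]=x_7$. (29) $[x_1,x_2]=x_7,\ [x_2,x_1]=-x_7,\ [x_3,x_4]=x_7,\ [x_4,x_3]=-x_7,\ [x_5,x_6]=x_7,\ [x_6,x_5]=-x_7,\ [x_6,x_6]=x_7$. (30) $[x_1,x_2]=x_7,\ [x_2,x_1]=-x_7,\ [x_3,x_4]=x_7,\ [x_4,x_3]=-x_7,\ [x_5,x_6]=x_7,\ [x_6,x_5]=cx_7$, $c\in\mathbb{C}\setminus\{1,-1\}$. (31) $[x_1,x_2]=x_7,\ [x_2,x_1]=-x_7,\ [x_3,x_4]=x_7,\ [x_4,x_3]=-x_7,\ [x_4,x_4]=x_7,\ [x_5,x_6]=x_7,\ [x_6,x_5]=-x_7,\ [x_6,x_6]=x_7$. (32) $[x_1,x_2]=x_7,\ [x_2,x_1]=-x_7,\ [x_3,x_4]=x_7,\ [x_4,x_3]=-x_7,\ [x_4,x_4]=x_7,\ [x_5,x_6]=x_7,\ [x_6,x_5]=cx_7$, $c\in\mathbb{C}\setminus\{1,-1\}$. (33) $[x_1,x_2]=x_7,\ [x_2,x_1]=-x_7,\ [x_3,x_4]=x_7,\ [x_4,x_3]=c_1x_7,\ [x_5,x_6]=x_7,\ [x_6,x_5]=c_2x_7$, $c_1,c_2\in\mathbb{C}\setminus\{1,-1\}$. (34) $[x_1,x_2]=x_7,\ [x_2,x_1]=-x_7,\ [x_2,x_2]=x_7,\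 [x_3,x_4]=x_7,\ [x_4,x_3]=-x_7,\ [x_4,x_4]=x_7,\ [x_5,x_6]=x_7,\ [x_6,x_5]=-x_7,\ [x_6,x_6]=x_7$. (35) $[x_1,x_2]=x_7,\ [x_2,x_1]=-x_7,\ [x_2,x_2]=x_7,\ [x_3,x_4]=x_7,\ [x_4,x_3]=-x_7,\ [x_4,x_4]=x_7,\ [x_5,x_6]=x_7,\ [x_6,x_5]=cx_7$, $c\in\mathbb{C}\setminus\{1,-1\}$. (36) $[x_1,x_2]=x_7,\ [x_2,x_1]=-x_7,\ [x_2,x_2]=x_7,\ [x_3,x_4]=x_7,\ [x_4,x_3]=c_1x_7,\ [x_5,x_6]=x_7,\ [x_6,x_5]=c_2x_7$, $c_1,c_2\in\mathbb{C}\setminus\{1,-1\}$. (37) $[x_1,x_2]=x_7,\ [x_2,x_1]=c_1x_7,\ [x_3,x_4]=x_7,\ [x_4,x_3]=c_2x_7,\ [x_5,x_6]=x_7,\ [x_6,x_5]=c_3x_7$, $c_1,c_2,c_3\in\mathbb{C}\setminus\{1,-1\}$. (38) $[x_1,x_2]=x_7,\ [x_2,x_1]=-x_7,\ [x_3,x_4]=x_7,\ [x_4,x_3]=-x_7,\ [x_5,x_5]=x_7,\ [x_6,x_6]=x_7$. (39) $[x_1,x_2]=x_7,\ [x_2,x_1]=-x_7,\ [x_3,x_4]=x_7,\ [x_4,x_3]=-x_7,\ [x_4,x_4]=x_7,\ [x_5,x_5]=x_7,\ [x_6,x_6]=x_7$. (40) $[x_1,x_2]=x_7,\ [x_2,x_1]=-x_7,\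 [x_3,x_4]=x_7,\ [x_4,x_3]=cx_7,\ [x_5,x_5]=x_7,\ [x_6,x_6]=x_7$, $c\in\mathbb{C}\setminus\{1,-1\}$. (41) $[x_1,x_2]=x_7,\ [x_2,x_1]=-x_7,\ [x_2,x_2]=x_7,\ [x_3,x_4]=x_7,\ [x_4,x_3]=-x_7,\ [x_4,x_4]=x_7,\ [x_5,x_5]=x_7,\ [x_6,x_6]=x_7$. (42) $[x_1,x_2]=x_7,\ [x_2,x_1]=-x_7,\ [x_2,x_2]=x_7,\ [x_3,x_4]=x_7,\ [x_4,x_3]=cx_7,\ [x_5,x_5]=x_7,\ [x_6,x_6]=x_7$, $c\in\mathbb{C}\setminus\{1,-1\}$. (43) $[x_1,x_2]=x_7,\ [x_2,x_1]=c_1x_7,\ [x_3,x_4]=x_7,\ [x_4,x_3]=c_2x_7,\ [x_5,x_5]=x_7,\ [x_6,x_6]=x_7$, $c_1,c_2\in\mathbb{C}\setminus\{1,-1\}$. (44) $[x_1,x_2]=x_7,\ [x_2,x_1]=-x_7,\ [x_3,x_3]=x_7,\ [x_4,x_4]=x_7,\ [x_5,x_5]=x_7,\ [x_6,x_6]=x_7$. (45) $[x_1,x_2]=x_7,\ [x_2,x_1]=-x_7,\ [x_2,x_2]=x_7,\ [x_3,x_3]=x_7,\ [x_4,x_4]=x_7,\ [x_5,x_5]=x_7,\ [x_6,x_6]=x_7$. (46) $[x_1,x_2]=x_7,\ [x_2,x_1]=cx_7,\ [x_3,x_3]=x_7,\ [x_4,x_4]=x_7,\ [x_5,x_5]=x_7,\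 [x_6,x_6]=x_7$, $c\in\mathbb{C}\setminus\{1,-1\}$. (47) $[x_1,x_1]=x_7,\ [x_2,x_2]=x_7,\ [x_3,x_3]=x_7,\ [x_4,x_4]=x_7,\ [x_5,x_5]=x_7,\ [x_6,x_6]=x_7$.
   Context: All algebras are over $\mathbb{C}$. A (left) Leibniz algebra is a $\mathbb{C}$-vector space $A$ with a bilinear product $[\,,\,]:A\times A\to A$ such that $[a,[b,c]]=[[a,b],c]+[b,[a,c]]$ for all $a,b,c\in A$. $A$ is a Lie algebra iff $Leib(A)=\mathrm{span}\{[a,a]\mid a\in A\}$ is zero; non-Lie means $Leib(A)\neq 0$. Put $A^1=A$, $A^i=[A,A^{i-1}]$ (span of products) for $i\ge 2$; $A$ is nilpotent if $A^m=0$ for some positive integer $m$. $A$ is split if it is a direct sum of two nontrivial (nonzero) ideals (two-sided), and non-split otherwise. Products of basis vectors not listed are zero (products listed with a coefficient $c$ or $c_i$ are zero when that coefficient is $0$). *)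

theory Defs
  imports "HOL-Analysis.Cartesian_Space"
begin

locale leibniz_algebra = vector_space scale
  for scale :: "complex \<Rightarrow> 'a::ab_group_add \<Rightarrow> 'a" +
  fixes br :: "'a \<Rightarrow> 'a \<Rightarrow> 'a"
  assumes linear_br_right: "\<And>a. Vector_Spaces.linear scale scale (\<lambda>b. br a b)"
    and linear_br_left: "\<And>b. Vector_Spaces.linear scale scale (\<lambda>a. br a b)"
    and left_leibniz: "\<And>a b c. br a (br b c) = br (br a b) c + br b (br a c)"
begin

definition Leib :: "'a set" where
  "Leib = span {br a a | a. True}"

definition is_Lie :: bool where
  "is_Lie \<longleftrightarrow> Leib = {0}"

definition product_space :: "'a set \<Rightarrow> 'a set \<Rightarrow> 'a set" where
  "product_space S T = span {br a b | a b. a \<in> S \<and> b \<in> T}"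

text \<open>The series is indexed from 1, with \<open>A\<^sup>1 = A\<close>; the value at 0 is junk.\<close>

fun lower_series :: "nat \<Rightarrow> 'a set" where
  "lower_series 0 = UNIV"
| "lower_series (Suc 0) = UNIV"
| "lower_series (Suc (Suc n)) = product_space UNIV (lower_series (Suc n))"

definition nilpotent :: bool where
  "nilpotent \<longleftrightarrow> (\<exists>m\<ge>1. lower_series m = {0})"

definition two_sided_ideal :: "'a set \<Rightarrow> bool" where
  "two_sided_ideal I \<longleftrightarrow> subspace I \<and> (\<forall>a. \<forall>x\<in>I. br a x \<in> I \<and> br x a \<in> I)"

definition is_split :: bool where
  "is_split \<longleftrightarrow> (\<exists>I J. two_sided_ideal I \<and> two_sided_ideal J \<and> I \<noteq> {0} \<and> J \<noteq> {0} \<and>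
     I \<inter> J = {0} \<and> {x + y | x y. x \<in> I \<and> y \<in> J} = UNIV)"

text \<open>A table \<open>t\<close> lists products of basis vectors that are multiples of \<open>x 7\<close>:
  \<open>t (i, j) = Some c\<close> stands for \<open>[x i, x j] = c x 7\<close>, and \<open>t (i, j) = None\<close> for
  \<open>[x i, x j] = 0\<close>.\<close>

definition basis_with_table :: "(nat \<Rightarrow> 'a) \<Rightarrow> (nat \<times> nat \<rightharpoonup> complex) \<Rightarrow> bool" where
  "basis_with_table x t \<longleftrightarrow>
     inj_on x {1..7} \<and> independent (x ` {1..7}) \<and> span (x ` {1..7}) = UNIV \<and>
     (\<forall>i\<in>{1..7}. \<forall>j\<in>{1..7}.
        br (x i) (x j) = (case t (i, j) of None \<Rightarrow> 0 | Some c \<Rightarrow> scale c (x 7)))"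

end

definition leibniz_isomorphic ::
  "(complex \<Rightarrow> 'a::ab_group_add \<Rightarrow> 'a) \<Rightarrow> ('a \<Rightarrow> 'a \<Rightarrow> 'a) \<Rightarrow>
   (complex \<Rightarrow> 'b::ab_group_add \<Rightarrow> 'b) \<Rightarrow> ('b \<Rightarrow> 'b \<Rightarrow> 'b) \<Rightarrow> bool" where
  "leibniz_isomorphic scaleA brA scaleB brB \<longleftrightarrow>
     (\<exists>f. Vector_Spaces.linear scaleA scaleB f \<and> bij f \<and>
          (\<forall>a b. f (brA a b) = brB (f a) (f b)))"

inductive listed_table :: "(nat \<times> nat \<rightharpoonup> complex) \<Rightarrow> bool" where
  table_1: "c \<notin> {1, -1} \<Longrightarrow>
    listed_table
     [(1,6) \<mapsto> 1, (2,5) \<mapsto> 1, (2,6) \<mapsto> c, (3,4) \<mapsto> 1, (3,5) \<mapsto> c, (4,3) \<mapsto> c,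
      (5,2) \<mapsto> c, (5,3) \<mapsto> 1, (6,1) \<mapsto> c, (6,2) \<mapsto> 1]"
| table_2: "listed_table
     [(1,6) \<mapsto> 1, (2,5) \<mapsto> 1, (2,6) \<mapsto> 1, (3,4) \<mapsto> 1, (3,5) \<mapsto> 1, (4,3) \<mapsto> -1,
      (4,4) \<mapsto> 1, (5,2) \<mapsto> -1, (5,3) \<mapsto> 1, (6,1) \<mapsto> -1, (6,2) \<mapsto> 1]"
| table_3: "listed_table
     [(1,6) \<mapsto> 1, (2,5) \<mapsto> 1, (2,6) \<mapsto> 1, (3,4) \<mapsto> 1, (3,5) \<mapsto> 1, (4,3) \<mapsto> -1,
      (5,2) \<mapsto> -1, (5,3) \<mapsto> 1, (6,1) \<mapsto> -1, (6,2) \<mapsto> 1]"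
| table_4: "listed_table
     [(1,4) \<mapsto> 1, (2,5) \<mapsto> 1, (4,2) \<mapsto> 1, (5,3) \<mapsto> 1, (6,6) \<mapsto> 1]"
| table_5: "listed_table
     [(1,5) \<mapsto> 1, (2,4) \<mapsto> 1, (2,5) \<mapsto> 1, (3,3) \<mapsto> 1, (3,4) \<mapsto> 1, (4,2) \<mapsto> 1,
      (4,3) \<mapsto> -1, (5,1) \<mapsto> 1, (5,2) \<mapsto> -1, (6,6) \<mapsto> 1]"
| table_6: "c \<notin> {1, -1} \<Longrightarrow>
    listed_table
     [(1,4) \<mapsto> 1, (2,3) \<mapsto> 1, (2,4) \<mapsto> c, (3,2) \<mapsto> c, (4,1) \<mapsto> c, (4,2) \<mapsto> 1,
      (5,6) \<mapsto> 1, (6,5) \<mapsto> -1]"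
| table_7: "c \<notin> {1, -1} \<Longrightarrow>
    listed_table
     [(1,4) \<mapsto> 1, (2,3) \<mapsto> 1, (2,4) \<mapsto> c, (3,2) \<mapsto> c, (4,1) \<mapsto> c, (4,2) \<mapsto> 1,
      (5,6) \<mapsto> 1, (6,5) \<mapsto> -1, (6,6) \<mapsto> 1]"
| table_8: "c1 \<notin> {1, -1} \<Longrightarrow> c2 \<notin> {1, -1} \<Longrightarrow>
    listed_table
     [(1,4) \<mapsto> 1, (2,3) \<mapsto> 1, (2,4) \<mapsto> c1, (3,2) \<mapsto> c1, (4,1) \<mapsto> c1, (4,2) \<mapsto> 1,
      (5,6) \<mapsto> 1, (6,5) \<mapsto> c2]"
| table_9: "listed_table
     [(1,4) \<mapsto> 1, (2,3) \<mapsto> 1, (2,4) \<mapsto> 1, (3,2) \<mapsto> 1, (4,1) \<mapsto> 1, (4,2) \<mapsto> -1,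
      (5,6) \<mapsto> 1, (6,5) \<mapsto> -1]"
| table_10: "listed_table
     [(1,4) \<mapsto> 1, (2,3) \<mapsto> 1, (2,4) \<mapsto> 1, (3,2) \<mapsto> 1, (4,1) \<mapsto> 1, (4,2) \<mapsto> -1,
      (5,6) \<mapsto> 1, (6,5) \<mapsto> -1, (6,6) \<mapsto> 1]"
| table_11: "c \<notin> {1, -1} \<Longrightarrow>
    listed_table
     [(1,4) \<mapsto> 1, (2,3) \<mapsto> 1, (2,4) \<mapsto> 1, (3,2) \<mapsto> 1, (4,1) \<mapsto> 1, (4,2) \<mapsto> -1,
      (5,6) \<mapsto> 1, (6,5) \<mapsto> c]"
| table_12: "listed_table
     [(1,4) \<mapsto> 1, (2,3) \<mapsto> 1, (2,4) \<mapsto> 1, (3,2) \<mapsto> -1, (3,3) \<mapsto> 1, (4,1) \<mapsto> -1,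
      (4,2) \<mapsto> 1, (5,6) \<mapsto> 1, (6,5) \<mapsto> -1]"
| table_13: "listed_table
     [(1,4) \<mapsto> 1, (2,3) \<mapsto> 1, (2,4) \<mapsto> 1, (3,2) \<mapsto> -1, (3,3) \<mapsto> 1, (4,1) \<mapsto> -1,
      (4,2) \<mapsto> 1, (5,6) \<mapsto> 1, (6,5) \<mapsto> -1, (6,6) \<mapsto> 1]"
| table_14: "c \<notin> {1, -1} \<Longrightarrow>
    listed_table
     [(1,4) \<mapsto> 1, (2,3) \<mapsto> 1, (2,4) \<mapsto> 1, (3,2) \<mapsto> -1, (3,3) \<mapsto> 1, (4,1) \<mapsto> -1,
      (4,2) \<mapsto> 1, (5,6) \<mapsto> 1, (6,5) \<mapsto> c]"
| table_15: "c \<notin> {1, -1} \<Longrightarrow>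
    listed_table
     [(1,4) \<mapsto> 1, (2,3) \<mapsto> 1, (2,4) \<mapsto> c, (3,2) \<mapsto> c, (4,1) \<mapsto> c, (4,2) \<mapsto> 1,
      (5,5) \<mapsto> 1, (6,6) \<mapsto> 1]"
| table_16: "listed_table
     [(1,4) \<mapsto> 1, (2,3) \<mapsto> 1, (2,4) \<mapsto> 1, (3,2) \<mapsto> 1, (4,1) \<mapsto> 1, (4,2) \<mapsto> -1,
      (5,5) \<mapsto> 1, (6,6) \<mapsto> 1]"
| table_17: "listed_table
     [(1,4) \<mapsto> 1, (2,3) \<mapsto> 1, (2,4) \<mapsto> 1, (3,2) \<mapsto> -1, (3,3) \<mapsto> 1, (4,1) \<mapsto> -1,
      (4,2) \<mapsto> 1, (5,5) \<mapsto> 1, (6,6) \<mapsto> 1]"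
| table_18: "listed_table
     [(1,3) \<mapsto> 1, (3,2) \<mapsto> 1, (4,6) \<mapsto> 1, (6,5) \<mapsto> 1]"
| table_19: "listed_table
     [(1,3) \<mapsto> 1, (3,2) \<mapsto> 1, (4,6) \<mapsto> 1, (5,5) \<mapsto> 1, (5,6) \<mapsto> 1, (6,4) \<mapsto> 1,
      (6,5) \<mapsto> -1]"
| table_20: "listed_table
     [(1,3) \<mapsto> 1, (2,2) \<mapsto> 1, (2,3) \<mapsto> 1, (3,1) \<mapsto> 1, (3,2) \<mapsto> -1, (4,6) \<mapsto> 1,
      (5,5) \<mapsto> 1, (5,6) \<mapsto> 1, (6,4) \<mapsto> 1, (6,5) \<mapsto> -1]"
| table_21: "listed_table
     [(1,3) \<mapsto> 1, (3,2) \<mapsto> 1, (4,5) \<mapsto> 1, (5,4) \<mapsto> -1, (6,6) \<mapsto> 1]"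
| table_22: "listed_table
     [(1,3) \<mapsto> 1, (3,2) \<mapsto> 1, (4,5) \<mapsto> 1, (5,4) \<mapsto> -1, (5,5) \<mapsto> 1, (6,6) \<mapsto> 1]"
| table_23: "c \<notin> {1, -1} \<Longrightarrow>
    listed_table
     [(1,3) \<mapsto> 1, (3,2) \<mapsto> 1, (4,5) \<mapsto> 1, (5,4) \<mapsto> c, (6,6) \<mapsto> 1]"
| table_24: "listed_table
     [(1,3) \<mapsto> 1, (2,2) \<mapsto> 1, (2,3) \<mapsto> 1, (3,1) \<mapsto> 1, (3,2) \<mapsto> -1, (4,5) \<mapsto> 1,
      (5,4) \<mapsto> -1, (6,6) \<mapsto> 1]"
| table_25: "listed_table
     [(1,3) \<mapsto> 1, (2,2) \<mapsto> 1, (2,3) \<mapsto> 1, (3,1) \<mapsto> 1, (3,2) \<mapsto> -1, (4,5) \<mapsto> 1,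
      (5,4) \<mapsto> -1, (5,5) \<mapsto> 1, (6,6) \<mapsto> 1]"
| table_26: "c \<notin> {1, -1} \<Longrightarrow>
    listed_table
     [(1,3) \<mapsto> 1, (2,2) \<mapsto> 1, (2,3) \<mapsto> 1, (3,1) \<mapsto> 1, (3,2) \<mapsto> -1, (4,5) \<mapsto> 1,
      (5,4) \<mapsto> c, (6,6) \<mapsto> 1]"
| table_27: "listed_table
     [(1,3) \<mapsto> 1, (3,2) \<mapsto> 1, (4,4) \<mapsto> 1, (5,5) \<mapsto> 1, (6,6) \<mapsto> 1]"
| table_28: "listed_table
     [(1,3) \<mapsto> 1, (2,2) \<mapsto> 1, (2,3) \<mapsto> 1, (3,1) \<mapsto> 1, (3,2) \<mapsto> -1, (4,4) \<mapsto> 1,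
      (5,5) \<mapsto> 1, (6,6) \<mapsto> 1]"
| table_29: "listed_table
     [(1,2) \<mapsto> 1, (2,1) \<mapsto> -1, (3,4) \<mapsto> 1, (4,3) \<mapsto> -1, (5,6) \<mapsto> 1, (6,5) \<mapsto> -1,
      (6,6) \<mapsto> 1]"
| table_30: "c \<notin> {1, -1} \<Longrightarrow>
    listed_table
     [(1,2) \<mapsto> 1, (2,1) \<mapsto> -1, (3,4) \<mapsto> 1, (4,3) \<mapsto> -1, (5,6) \<mapsto> 1, (6,5) \<mapsto> c]"
| table_31: "listed_table
     [(1,2) \<mapsto> 1, (2,1) \<mapsto> -1, (3,4) \<mapsto> 1, (4,3) \<mapsto> -1, (4,4) \<mapsto> 1, (5,6) \<mapsto> 1,
      (6,5) \<mapsto> -1, (6,6) \<mapsto> 1]"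
| table_32: "c \<notin> {1, -1} \<Longrightarrow>
    listed_table
     [(1,2) \<mapsto> 1, (2,1) \<mapsto> -1, (3,4) \<mapsto> 1, (4,3) \<mapsto> -1, (4,4) \<mapsto> 1, (5,6) \<mapsto> 1,
      (6,5) \<mapsto> c]"
| table_33: "c1 \<notin> {1, -1} \<Longrightarrow> c2 \<notin> {1, -1} \<Longrightarrow>
    listed_table
     [(1,2) \<mapsto> 1, (2,1) \<mapsto> -1, (3,4) \<mapsto> 1, (4,3) \<mapsto> c1, (5,6) \<mapsto> 1, (6,5) \<mapsto> c2]"
| table_34: "listed_table
     [(1,2) \<mapsto> 1, (2,1) \<mapsto> -1, (2,2) \<mapsto> 1, (3,4) \<mapsto> 1, (4,3) \<mapsto> -1, (4,4) \<mapsto> 1,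
      (5,6) \<mapsto> 1, (6,5) \<mapsto> -1, (6,6) \<mapsto> 1]"
| table_35: "c \<notin> {1, -1} \<Longrightarrow>
    listed_table
     [(1,2) \<mapsto> 1, (2,1) \<mapsto> -1, (2,2) \<mapsto> 1, (3,4) \<mapsto> 1, (4,3) \<mapsto> -1, (4,4) \<mapsto> 1,
      (5,6) \<mapsto> 1, (6,5) \<mapsto> c]"
| table_36: "c1 \<notin> {1, -1} \<Longrightarrow> c2 \<notin> {1, -1} \<Longrightarrow>
    listed_table
     [(1,2) \<mapsto> 1, (2,1) \<mapsto> -1, (2,2) \<mapsto> 1, (3,4) \<mapsto> 1, (4,3) \<mapsto> c1, (5,6) \<mapsto> 1,
      (6,5) \<mapsto> c2]"
| table_37: "c1 \<notin> {1, -1} \<Longrightarrow> c2 \<notin> {1, -1} \<Longrightarrow> c3 \<notin> {1, -1} \<Longrightarrow>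
    listed_table
     [(1,2) \<mapsto> 1, (2,1) \<mapsto> c1, (3,4) \<mapsto> 1, (4,3) \<mapsto> c2, (5,6) \<mapsto> 1, (6,5) \<mapsto> c3]"
| table_38: "listed_table
     [(1,2) \<mapsto> 1, (2,1) \<mapsto> -1, (3,4) \<mapsto> 1, (4,3) \<mapsto> -1, (5,5) \<mapsto> 1, (6,6) \<mapsto> 1]"
| table_39: "listed_table
     [(1,2) \<mapsto> 1, (2,1) \<mapsto> -1, (3,4) \<mapsto> 1, (4,3) \<mapsto> -1, (4,4) \<mapsto> 1, (5,5) \<mapsto> 1,
      (6,6) \<mapsto> 1]"
| table_40: "c \<notin> {1, -1} \<Longrightarrow>
    listed_table
     [(1,2) \<mapsto> 1, (2,1) \<mapsto> -1, (3,4) \<mapsto> 1, (4,3) \<mapsto> c, (5,5) \<mapsto> 1, (6,6) \<mapsto> 1]"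
| table_41: "listed_table
     [(1,2) \<mapsto> 1, (2,1) \<mapsto> -1, (2,2) \<mapsto> 1, (3,4) \<mapsto> 1, (4,3) \<mapsto> -1, (4,4) \<mapsto> 1,
      (5,5) \<mapsto> 1, (6,6) \<mapsto> 1]"
| table_42: "c \<notin> {1, -1} \<Longrightarrow>
    listed_table
     [(1,2) \<mapsto> 1, (2,1) \<mapsto> -1, (2,2) \<mapsto> 1, (3,4) \<mapsto> 1, (4,3) \<mapsto> c, (5,5) \<mapsto> 1,
      (6,6) \<mapsto> 1]"
| table_43: "c1 \<notin> {1, -1} \<Longrightarrow> c2 \<notin> {1, -1} \<Longrightarrow>
    listed_table
     [(1,2) \<mapsto> 1, (2,1) \<mapsto> c1, (3,4) \<mapsto> 1, (4,3) \<mapsto> c2, (5,5) \<mapsto> 1, (6,6) \<mapsto> 1]"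
| table_44: "listed_table
     [(1,2) \<mapsto> 1, (2,1) \<mapsto> -1, (3,3) \<mapsto> 1, (4,4) \<mapsto> 1, (5,5) \<mapsto> 1, (6,6) \<mapsto> 1]"
| table_45: "listed_table
     [(1,2) \<mapsto> 1, (2,1) \<mapsto> -1, (2,2) \<mapsto> 1, (3,3) \<mapsto> 1, (4,4) \<mapsto> 1, (5,5) \<mapsto> 1,
      (6,6) \<mapsto> 1]"
| table_46: "c \<notin> {1, -1} \<Longrightarrow>
    listed_table
     [(1,2) \<mapsto> 1, (2,1) \<mapsto> c, (3,3) \<mapsto> 1, (4,4) \<mapsto> 1, (5,5) \<mapsto> 1, (6,6) \<mapsto> 1]"
| table_47: "listed_table
     [(1,1) \<mapsto> 1, (2,2) \<mapsto> 1, (3,3) \<mapsto> 1, (4,4) \<mapsto> 1, (5,5) \<mapsto> 1, (6,6) \<mapsto> 1]"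

end

theory Submission
  imports Defs "HOL-Computational_Algebra.Fundamental_Theorem_Algebra"
begin

text \<open>The square of the algebra is a line spanned by some \<open>z\<close>, it is central by nilpotency, and the
  product is \<open>[a, b] = f(a, b) z\<close> for a bilinear form \<open>f\<close> on a 6-dimensional complement. As the algebra
  is non-split, no nonzero vector lies in both radicals of \<open>f\<close>, so everything comes down to the
  canonical forms of complex bilinear forms under congruence, which are reached by splitting off one
  indecomposable block at a time. Write \<open>f = S + K\<close> with \<open>S\<close> symmetric and \<open>K\<close> skew.

  If \<open>f\<close> has a left radical vector \<open>r\<close>, choose \<open>c\<close> with \<open>f(c, r) = 1\<close>; on a complement of
  \<open>\<langle>c, r\<rangle>\<close> the form splits off a chain by induction, and \<open>r, c\<close> either prolong this chain or form
  one of length 2. If \<open>K\<close> is degenerate, or else if \<open>S\<close> is, a radical vector and a partner span a plane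
  that is hyperbolic for \<open>S\<close> or for \<open>K\<close>, respectively; the other part of \<open>f\<close> meets this plane only in
  one functional \<open>h\<close> on the complement, and only the values of \<open>h\<close> on the radical of that part matter.
  In the remaining case \<open>f\<^sup>T - c f\<close> is degenerate for some \<open>c \<noteq> \<plusminus>1\<close>. The chain it splits off
  determines a block of \<open>f\<close>, because \<open>f\<close> is a combination of \<open>f\<^sup>T - c f\<close> and its transpose.\<close>

section \<open>Linear combinations and functionals\<close>

text \<open>The obstacle at every splitting step is one functional on the complement of the new
  plane. It can be cleared exactly when it is representable there, that is, when it kills the
  relevant radical. When it is not, the offending radical vector itself becomes a member of a longer
  block, so no Jordan theory is needed. The bound 6 keeps this manageable: after a plane and a first
  block, or a second plane, inside the complement, at most two dimensions remain. The excluded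
  parameters come from the eigenvalue in \<open>f(y, w) = c f(w, y)\<close>: for
  \<open>c = 1\<close> the vector \<open>w\<close> lies in the radical of \<open>K\<close>, for
  \<open>c = -1\<close> in that of \<open>S\<close>, and both situations are settled before. Only
  existence of a listed basis is claimed, so blocks may be split off in any order and no invariants
  are compared. Sorted by type, the blocks of total size six form 48 patterns. Being non-Lie removes
  the single alternating one, three copies of \<open>H2\<close>, and the other 47 are the
  tables.\<close>

locale complex_fd_space = finite_dimensional_vector_space scale Basis
  for scale :: "complex \<Rightarrow> 'a::ab_group_add \<Rightarrow> 'a" (infixr "\<odot>" 75) and Basis :: "'a set"
begin

definition linear_functional :: "('a \<Rightarrow> complex) \<Rightarrow> bool" where
  "linear_functional h \<longleftrightarrow> (\<forall>x y. h (x + y) = h x + h y) \<and> (\<forall>a x. h (a \<odot> x) = a * h x)"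

lemma subspace_kernel:
  assumes "subspace W" "linear_functional h"
  shows "subspace {u \<in> W. h u = 0}"
proof (rule subspaceI)
  have "h (0 \<odot> 0) = 0"
    using assms(2) unfolding linear_functional_def by (metis mult_zero_left)
  then show "0 \<in> {u \<in> W. h u = 0}"
    using assms(1) by (simp add: subspace_0)
qed (use assms in \<open>auto simp: linear_functional_def subspace_add subspace_scale\<close>)

text \<open>Induction on \<open>B\<close>: on the kernel of \<open>F(-, b)\<close> the other
  functionals suffice, and a vector \<open>w\<close> with \<open>F(w, b) = 1\<close> then dictates
  the coefficient of \<open>b\<close>.\<close>

lemma functional_in_span:
  assumes "finite B" "subspace W" "linear_functional h"
    and "\<And>b. b \<in> B \<Longrightarrow> linear_functional (\<lambda>u. F u b)"
    and "\<And>u. u \<in> W \<Longrightarrow> (\<forall>b\<in>B. F u b = 0) \<Longrightarrow> h u = 0"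
  shows "\<exists>c. \<forall>u\<in>W. h u = (\<Sum>b\<in>B. c b * F u b)"
  using assms
proof (induction B arbitrary: W rule: finite_induct)
  case empty
  then show ?case by simp
next
  case (insert b B)
  let ?W = "{u \<in> W. F u b = 0}"
  have "subspace ?W"
    using insert.prems by (intro subspace_kernel) auto
  with insert.IH[of ?W] insert.prems obtain c where c: "\<And>u. u \<in> ?W \<Longrightarrow> h u = (\<Sum>b\<in>B. c b * F u b)"
    by auto
  note Fb = insert.prems(3)
  show ?case
  proof (cases "\<exists>u\<in>W. F u b \<noteq> 0")
    case False
    then have "\<forall>u\<in>W. h u = (\<Sum>d\<in>insert b B. c d * F u d)"
      using c insert.hyps by auto
    then show ?thesis by blast
  next
    case True
    then obtain v where v: "v \<in> W" "F v b \<noteq> 0" by blast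
    define w where "w = (1 / F v b) \<odot> v"
    have w: "w \<in> W" "F w b = 1"
      using v insert.prems(1) Fb[of b] by (auto simp: w_def subspace_scale linear_functional_def)
    define c' where "c' = c(b := h w - (\<Sum>d\<in>B. c d * F w d))"
    have "h u = (\<Sum>d\<in>insert b B. c' d * F u d)" if u: "u \<in> W" for u
    proof -
      define u' where "u' = u + (- F u b) \<odot> w"
      have lin: "F u' d = F u d - F u b * F w d" if "d \<in> insert b B" for d
        using Fb[OF that] unfolding linear_functional_def u'_def
        by (simp only: mult_minus_left diff_conv_add_uminus)
      have "u' \<in> ?W"
        using u w insert.prems(1) lin[of b]
        by (auto simp: u'_def intro: subspace_diff subspace_scale)
      then have "h u' = (\<Sum>d\<in>B. c d * F u' d)" by (rule c)
      also have "\<dots> = (\<Sum>d\<in>B. c d * (F u d - F u b * F w d))"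
        by (intro sum.cong refl) (simp add: lin)
      also have "\<dots> = (\<Sum>d\<in>B. c d * F u d) - F u b * (\<Sum>d\<in>B. c d * F w d)"
        by (simp add: algebra_simps sum_subtractf sum_distrib_left)
      finally have *: "h u' = (\<Sum>d\<in>B. c d * F u d) - F u b * (\<Sum>d\<in>B. c d * F w d)" .
      have "h u' = h u - F u b * h w"
        using insert.prems(2) unfolding linear_functional_def u'_def
        by (simp only: mult_minus_left diff_conv_add_uminus)
      with * have "h u = (\<Sum>d\<in>B. c d * F u d) + (h w - (\<Sum>d\<in>B. c d * F w d)) * F u b"
        by (simp add: algebra_simps)
      moreover have "(\<Sum>d\<in>B. c' d * F u d) = (\<Sum>d\<in>B. c d * F u d)"
        using insert.hyps by (intro sum.cong) (auto simp: c'_def)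
      ultimately show ?thesis
        using insert.hyps by (simp add: c'_def)
    qed
    then show ?thesis by blast
  qed
qed

text \<open>Lists rather than finite sets, because Gram matrices and tables need an order. Surplus
  entries of the longer list are dropped, hence the length hypotheses below.\<close>

fun lincomb :: "complex list \<Rightarrow> 'a list \<Rightarrow> 'a" where
  "lincomb (c # cs) (u # us) = c \<odot> u + lincomb cs us"
| "lincomb cs us = 0"

lemma span_Un_subspaceE:
  assumes "x \<in> span (set us \<union> W)" "subspace W"
  obtains cs w where "length cs = length us" "w \<in> W" "x = lincomb cs us + w"
  using assms(1)
proof (induction us arbitrary: x thesis)
  case Nil
  have "x \<in> W"
    using Nil.prems(2) span_subspace[OF subset_refl span_superset assms(2)] by simp
  then show ?case using Nil.prems(1)[of "[]" x] by simp
next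
  case (Cons u us)
  from Cons.prems(2) obtain k where "x - k \<odot> u \<in> span (set us \<union> W)"
    by (auto simp: span_breakdown_eq)
  then obtain cs w where cw: "length cs = length us" "w \<in> W" "x - k \<odot> u = lincomb cs us + w"
    using Cons.IH by metis
  then have "x = lincomb (k # cs) (u # us) + w"
    by (simp add: algebra_simps)
  with cw Cons.prems(1)[of "k # cs" w] show ?case by simp
qed

lemma span_listE:
  assumes "x \<in> span (set us)"
  obtains cs where "length cs = length us" "x = lincomb cs us"
  using span_Un_subspaceE[of x us "{0}"] assms by auto

text \<open>The hypothesis is independence of the list modulo \<open>W\<close> in coefficient form,
  so each new vector raises the dimension by one.\<close>

lemma dim_list_Un_subspace:
  assumes "subspace W"
    and "\<And>cs. length cs = length us \<Longrightarrow> lincomb cs us \<in> W \<Longrightarrow> set cs \<subseteq> {0}"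
  shows "dim (set us \<union> W) = length us + dim W"
  using assms(2)
proof (induction us)
  case (Cons u us)
  have "set cs \<subseteq> {0}" if "length cs = length us" "lincomb cs us \<in> W" for cs
    using Cons.prems[of "0 # cs"] that by simp
  then have "dim (set us \<union> W) = length us + dim W"
    by (rule Cons.IH)
  moreover have "u \<notin> span (set us \<union> W)"
  proof
    assume "u \<in> span (set us \<union> W)"
    then obtain cs w where cw: "length cs = length us" "w \<in> W" "u = lincomb cs us + w"
      using assms(1) by (rule span_Un_subspaceE)
    have *: "lincomb (map uminus cs) us = - lincomb cs us"
      by (induction cs us rule: lincomb.induct) auto
    have "lincomb (1 # map uminus cs) (u # us) \<in> W"
      using cw(2,3) by (simp add: *)
    with cw(1) have "set (1 # map uminus cs) \<subseteq> {0}"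
      by (intro Cons.prems) simp_all
    then show False by simp
  qed
  ultimately show ?case by (simp add: dim_insert)
qed simp

lemma dim_less_subspace:
  assumes "subspace A" "subspace B" "A \<subseteq> B" "x \<in> B" "x \<notin> A"
  shows "dim A < dim B"
  using assms by (intro dim_psubset) (metis psubsetI span_eq_iff)

lemma subspace_kernel_two:
  assumes "subspace W" "linear_functional g" "linear_functional h"
  shows "subspace {u \<in> W. g u = 0 \<and> h u = 0}"
  using subspace_kernel[OF subspace_kernel[OF assms(1,2)] assms(3)]
  by (simp add: conj_assoc)

lemma span_Un_span: "span (A \<union> span B) = span (A \<union> B)"
proof
  have "span B \<subseteq> span (A \<union> B)" by (rule span_mono) simp
  then have "A \<union> span B \<subseteq> span (A \<union> B)" using span_superset[of "A \<union> B"] by blast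
  then show "span (A \<union> span B) \<subseteq> span (A \<union> B)"
    by (rule span_minimal) (rule subspace_span)
  show "span (A \<union> B) \<subseteq> span (A \<union> span B)"
    using span_superset[of B] by (intro span_mono) auto
qed

lemma span_pairE:
  assumes "w \<in> span {x, y}"
  obtains a b where "w = a \<odot> x + b \<odot> y"
proof -
  from assms have "w \<in> span (set [x, y])" by simp
  then obtain cs where "length cs = length [x, y]" "w = lincomb cs [x, y]" by (rule span_listE)
  then show thesis using that by (auto simp: length_Suc_conv)
qed

lemma lincomb_conv_sum:
  "length cs = length us \<Longrightarrow> lincomb cs us = (\<Sum>i<length us. cs ! i \<odot> us ! i)"
  by (induction cs us rule: lincomb.induct) (simp_all add: sum.lessThan_Suc_shift del: sum.lessThan_Suc)

text \<open>Read \<open>x i\<close> as \<open>T^i v\<close> for a linear map \<open>T\<close>. The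
  first \<open>x k\<close> that depends on its predecessors gives a monic polynomial annihilating
  \<open>v\<close>. Splitting off a root \<open>c\<close> leaves a quotient \<open>q\<close> of
  smaller degree; then \<open>q(T) v\<close> is nonzero by minimality of \<open>k\<close>, and it is
  an eigenvector for \<open>c\<close>. The claim is made for a bare sequence, so \<open>T\<close>
  need not be available as a linear map.\<close>

lemma cyclic_eigenvector:
  fixes x :: "nat \<Rightarrow> 'a"
  assumes "x 0 \<noteq> 0"
  obtains c k b where "(\<Sum>i<k. b i \<odot> x i) \<noteq> 0"
    "(\<Sum>i<k. b i \<odot> x (Suc i)) = c \<odot> (\<Sum>i<k. b i \<odot> x i)"
proof -
  have "\<exists>k. x k \<in> span (x ` {..<k})"
  proof (rule ccontr)
    assume none: "\<not> ?thesis"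
    have ind: "independent (x ` {..<k}) \<and> card (x ` {..<k}) = k" for k
    proof (induction k)
      case (Suc k)
      have "x k \<notin> span (x ` {..<k})" using none by blast
      moreover from this have "x k \<notin> x ` {..<k}" by (rule contrapos_nn) (rule span_base)
      ultimately show ?case
        using Suc by (simp add: lessThan_Suc independent_insert)
    qed (simp add: independent_empty)
    have "card (x ` {..<Suc (dim UNIV)}) \<le> dim (UNIV :: 'a set)"
      by (rule independent_card_le_dim[OF subset_UNIV]) (use ind in blast)
    then show False using ind[of "Suc (dim UNIV)"] by simp
  qed
  define k where "k = (LEAST k. x k \<in> span (x ` {..<k}))"
  have k: "x k \<in> span (x ` {..<k})"
    unfolding k_def by (rule LeastI_ex) fact
  have less: "x i \<notin> span (x ` {..<i})" if "i < k" for i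
    using not_less_Least that unfolding k_def by blast
  have "k \<noteq> 0" using k assms by (intro notI) simp
  then obtain m where m: "k = Suc m" by (cases k) auto
  have "x k \<in> span (set (map x [0..<k]))" using k by (simp add: atLeast0LessThan)
  then obtain cs where cs: "length cs = length (map x [0..<k])" "x k = lincomb cs (map x [0..<k])"
    by (rule span_listE)
  then have rel: "x k = (\<Sum>i<k. cs ! i \<odot> x i)"
    by (simp add: lincomb_conv_sum)
  define p where "p = monom 1 k - Poly cs"
  have coeff_p: "coeff p i = (if i = k then 1 else if i < k then - (cs ! i) else 0)" for i
    using cs(1) by (auto simp: p_def nth_default_def)
  have deg_p: "degree p = k"
    by (intro antisym degree_le le_degree) (auto simp: coeff_p)
  then have "\<not> constant (poly p)"
    using \<open>k \<noteq> 0\<close> by (simp add: constant_degree)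
  then obtain c where "poly p c = 0" using fundamental_theorem_of_algebra by blast
  then obtain q where q: "p = [:- c, 1:] * q" by (auto simp: poly_eq_0_iff_dvd)
  have "p \<noteq> 0" using deg_p \<open>k \<noteq> 0\<close> by auto
  then have "q \<noteq> 0" using q by auto
  then have "degree ([:- c, 1:] * q) = degree [:- c, 1:] + degree q"
    by (intro degree_mult_eq) auto
  then have deg_q: "degree q = m"
    using deg_p m unfolding q[symmetric] by simp
  have cp: "coeff p 0 = - c * coeff q 0" "coeff p (Suc i) = coeff q i - c * coeff q (Suc i)" for i
    by (simp_all add: q)
  have "coeff q m = 1"
    using cp(2)[of m] coeff_p[of k] m deg_q by (simp add: coeff_eq_0)
  show thesis
  proof
    show "(\<Sum>i<k. coeff q i \<odot> x i) \<noteq> 0"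
    proof
      assume "(\<Sum>i<k. coeff q i \<odot> x i) = 0"
      \<comment> \<open>Here \<open>q\<close> is monic of degree \<open>m = k - 1\<close>, so a
        vanishing combination would make \<open>x m\<close> depend on its predecessors.\<close>
      then have "x m = - (\<Sum>i<m. coeff q i \<odot> x i)"
        using \<open>coeff q m = 1\<close> by (simp add: m eq_neg_iff_add_eq_0 add.commute)
      also have "\<dots> \<in> span (x ` {..<m})"
        by (intro span_neg span_sum span_scale span_base) auto
      finally show False using less[of m] m by simp
    qed
    have "0 = (\<Sum>i<Suc k. coeff p i \<odot> x i)"
      by (simp add: coeff_p rel sum_negf)
    also have "\<dots> = coeff p 0 \<odot> x 0 + (\<Sum>i<k. coeff p (Suc i) \<odot> x (Suc i))"
      by (rule sum.lessThan_Suc_shift)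
    also have "\<dots> = (\<Sum>i<k. coeff q i \<odot> x (Suc i)) - (c \<odot> coeff q 0 \<odot> x 0 + (\<Sum>i<k. c \<odot> coeff q (Suc i) \<odot> x
      (Suc i)))"
      by (simp add: cp sum_subtractf scale_left_diff_distrib)
    also have "c \<odot> coeff q 0 \<odot> x 0 + (\<Sum>i<k. c \<odot> coeff q (Suc i) \<odot> x (Suc i)) =
      (\<Sum>i<Suc k. c \<odot> coeff q i \<odot> x i)"
      by (rule sum.lessThan_Suc_shift[symmetric])
    also have "\<dots> = c \<odot> (\<Sum>i<k. coeff q i \<odot> x i)"
      using deg_q m by (simp add: coeff_eq_0 scale_sum_right scale_right_distrib)
    finally show "(\<Sum>i<k. coeff q i \<odot> x (Suc i)) = c \<odot> (\<Sum>i<k. coeff q i \<odot> x i)"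
      by simp
  qed
qed

end

section \<open>Bilinear forms and orthogonal splittings\<close>

locale complex_bilinear_form = complex_fd_space scale Basis
  for scale :: "complex \<Rightarrow> 'a::ab_group_add \<Rightarrow> 'a" (infixr "\<odot>" 75) and Basis :: "'a set" +
  fixes f :: "'a \<Rightarrow> 'a \<Rightarrow> complex"
  assumes add_left [simp]: "f (x + y) z = f x z + f y z"
    and add_right [simp]: "f x (y + z) = f x y + f x z"
    and scale_left [simp]: "f (a \<odot> x) y = a * f x y"
    and scale_right [simp]: "f x (a \<odot> y) = a * f x y"
begin

lemma zero_left [simp]: "f 0 y = 0"
  using add_left[of 0 0 y] by simp

lemma zero_right [simp]: "f x 0 = 0"
  using add_right[of x 0 0] by simp

lemma minus_left [simp]: "f (- x) y = - f x y"
  using add_left[of x "- x" y] by (simp add: add_eq_0_iff)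

lemma minus_right [simp]: "f x (- y) = - f x y"
  using add_right[of x y "- y"] by (simp add: add_eq_0_iff)

lemma diff_left [simp]: "f (x - y) z = f x z - f y z"
  using add_left[of x "- y" z] by simp

lemma diff_right [simp]: "f x (y - z) = f x y - f x z"
  using add_right[of x y "- z"] by simp

lemma sum_left: "f (\<Sum>i\<in>I. g i) y = (\<Sum>i\<in>I. f (g i) y)"
  by (induction I rule: infinite_finite_induct) auto

lemma sum_right: "f y (\<Sum>i\<in>I. g i) = (\<Sum>i\<in>I. f y (g i))"
  by (induction I rule: infinite_finite_induct) auto

lemma linear_functional_left: "linear_functional (\<lambda>x. f x y)"
  and linear_functional_right: "linear_functional (f y)"
  by (auto simp: linear_functional_def)

text \<open>A Fredholm alternative: vectors of \<open>W\<close> that pair to zero with all of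
  \<open>U\<close> are the only obstruction. A basis of \<open>U\<close> reduces it to
  \<open>functional_in_span\<close>.\<close>

lemma representable:
  assumes "subspace W" "subspace U" "linear_functional h"
    and "\<And>u. u \<in> W \<Longrightarrow> (\<forall>v\<in>U. f u v = 0) \<Longrightarrow> h u = 0"
  obtains v where "v \<in> U" "\<And>u. u \<in> W \<Longrightarrow> f u v = h u"
proof -
  obtain B where B: "B \<subseteq> U" "independent B" "U \<subseteq> span B"
    by (rule basis_exists)
  then have fin: "finite B" by (simp add: finiteI_independent)
  have "h u = 0" if u: "u \<in> W" "\<forall>b\<in>B. f u b = 0" for u
  proof -
    have "f u v = 0" if "v \<in> U" for v
    proof -
      from that B have "v \<in> span B" by blast
      then show ?thesis
        by (induction rule: span_induct_alt) (use u in auto)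
    qed
    with assms(4) u show ?thesis by blast
  qed
  then obtain c where c: "\<forall>u\<in>W. h u = (\<Sum>b\<in>B. c b * f u b)"
    using functional_in_span[OF fin assms(1) assms(3), of f] linear_functional_left by blast
  show thesis
  proof
    show "(\<Sum>b\<in>B. c b \<odot> b) \<in> U"
      using B assms(2) by (auto intro!: subspace_sum subspace_scale)
    show "f u (\<Sum>b\<in>B. c b \<odot> b) = h u" if "u \<in> W" for u
      using c that by (simp add: sum_right)
  qed
qed

lemma lincomb_left: "length cs = length us \<Longrightarrow> f (lincomb cs us) y = (\<Sum>i<length us. cs ! i * f (us ! i) y)"
proof (induction cs us rule: lincomb.induct)
  case (1 c cs u us)
  then show ?case by (simp add: sum.lessThan_Suc_shift del: sum.lessThan_Suc)
qed auto

lemma lincomb_right: "length cs = length us \<Longrightarrow> f y (lincomb cs us) = (\<Sum>i<length us. cs ! i * f y (us ! i))"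
proof (induction cs us rule: lincomb.induct)
  case (1 c cs u us)
  then show ?case by (simp add: sum.lessThan_Suc_shift del: sum.lessThan_Suc)
qed auto

definition orthogonal :: "'a set \<Rightarrow> 'a set \<Rightarrow> bool" where
  "orthogonal A B \<longleftrightarrow> (\<forall>a\<in>A. \<forall>b\<in>B. f a b = 0 \<and> f b a = 0)"

lemma orthogonal_sym: "orthogonal A B \<longleftrightarrow> orthogonal B A"
  by (auto simp: orthogonal_def)

lemma orthogonal_mono: "orthogonal A B \<Longrightarrow> A' \<subseteq> A \<Longrightarrow> B' \<subseteq> B \<Longrightarrow> orthogonal A' B'"
  by (auto simp: orthogonal_def)

lemma orthogonal_span: 
  assumes "orthogonal A B"
  shows "orthogonal (span A) B"
  unfolding orthogonal_def
proof
  fix a assume "a \<in> span A"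
  then show "\<forall>b\<in>B. f a b = 0 \<and> f b a = 0"
    by (induction rule: span_induct_alt) (use assms in \<open>auto simp: orthogonal_def\<close>)
qed

text \<open>Only vectors that are radical on both sides are excluded; these are the central vectors
  that would split the algebra. One-sided radicals survive and lead to chains.\<close>

definition no_radical :: "'a set \<Rightarrow> bool" where
  "no_radical V \<longleftrightarrow> (\<forall>x\<in>V. (\<forall>y\<in>V. f x y = 0 \<and> f y x = 0) \<longrightarrow> x = 0)"

text \<open>The Gram matrix of a list \<open>us\<close> with this property has no common radical; in particular \<open>us\<close>
  is linearly independent.\<close>

definition gram_regular :: "'a list \<Rightarrow> bool" where
  "gram_regular us \<longleftrightarrow> (\<forall>cs. length cs = length us \<longrightarrow>
     (\<forall>u\<in>set us. f (lincomb cs us) u = 0 \<and> f u (lincomb cs us) = 0) \<longrightarrow> set cs \<subseteq> {0})"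

definition splits :: "'a set \<Rightarrow> 'a list \<Rightarrow> 'a set \<Rightarrow> bool" where
  "splits V us W \<longleftrightarrow> subspace W \<and> V = span (set us \<union> W) \<and> orthogonal (set us) W"

lemma splits_dim:
  assumes "splits V us W" "gram_regular us"
  shows "dim V = length us + dim W"
proof -
  have "dim (set us \<union> W) = length us + dim W"
  proof (rule dim_list_Un_subspace)
    fix cs assume "length cs = length us" "lincomb cs us \<in> W"
    then show "set cs \<subseteq> {0}"
      using assms by (auto simp: splits_def gram_regular_def orthogonal_def)
  qed (use assms in \<open>simp add: splits_def\<close>)
  then show ?thesis using assms by (simp add: splits_def)
qed

lemma splits_span: "splits V us W \<Longrightarrow> V = span (set us \<union> W)"
  and splits_subspace: "splits V us W \<Longrightarrow> subspace W"
  and splits_orthogonal: "splits V us W \<Longrightarrow> orthogonal (set us) W"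
  by (auto simp: splits_def)

lemma splits_subsets: "splits V us W \<Longrightarrow> set us \<subseteq> V \<and> W \<subseteq> V"
  by (auto simp: splits_def intro: span_base)

lemma splits_orthogonal_all:
  assumes "splits V us W" "x \<in> W" "y \<in> V"
    and "\<forall>w\<in>W. f x w = 0 \<and> f w x = 0"
  shows "f x y = 0 \<and> f y x = 0"
proof -
  have "orthogonal (set us \<union> W) {x}"
    using assms by (auto simp: splits_def orthogonal_def)
  then have "orthogonal (span (set us \<union> W)) {x}" by (rule orthogonal_span)
  then show ?thesis using assms by (auto simp: splits_def orthogonal_def)
qed

lemma splits_no_radical:
  assumes "splits V us W" "no_radical V"
  shows "no_radical W"
  unfolding no_radical_def
proof (intro ballI impI)
  fix x assume x: "x \<in> W" "\<forall>y\<in>W. f x y = 0 \<and> f y x = 0"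
  then have "\<forall>y\<in>V. f x y = 0 \<and> f y x = 0"
    using splits_orthogonal_all[OF assms(1)] by blast
  moreover have "x \<in> V" using x splits_subsets[OF assms(1)] by blast
  ultimately show "x = 0" using assms(2) by (simp add: no_radical_def)
qed

section \<open>Degenerate forms split off a chain\<close>

lemma splitsI:
  assumes "subspace V" "subspace W" "set us \<subseteq> V" "W \<subseteq> V" "V \<subseteq> span (set us \<union> W)"
    and "\<And>u w. u \<in> set us \<Longrightarrow> w \<in> W \<Longrightarrow> f u w = 0 \<and> f w u = 0"
  shows "splits V us W"
  using assms span_minimal[of "set us \<union> W" V] by (auto simp: splits_def orthogonal_def)

text \<open>The Gram matrix is a nilpotent Jordan block: on the span of the chain the last vector is
  left radical and the first one right radical.\<close>

definition chain :: "'a list \<Rightarrow> bool" where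
  "chain es \<longleftrightarrow> (\<forall>i<length es. \<forall>j<length es. f (es ! i) (es ! j) = (if j = Suc i then 1 else 0))"

lemma chain_nth: "chain es \<Longrightarrow> i < length es \<Longrightarrow> j < length es \<Longrightarrow> f (es ! i) (es ! j) =
  (if j = Suc i then 1 else 0)"
  by (simp add: chain_def)

lemma chain_lincomb_left:
  assumes "chain es" "length cs = length es" "Suc i < length es"
  shows "f (lincomb cs es) (es ! Suc i) = cs ! i"
proof -
  have "f (lincomb cs es) (es ! Suc i) = (\<Sum>k<length es. cs ! k * f (es ! k) (es ! Suc i))"
    using assms by (simp add: lincomb_left)
  also have "\<dots> = (\<Sum>k<length es. if k = i then cs ! k else 0)"
    using assms by (intro sum.cong) (auto simp: chain_nth)
  finally show ?thesis using assms by simp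
qed

lemma chain_lincomb_right:
  assumes "chain es" "length cs = length es" "Suc i < length es"
  shows "f (es ! i) (lincomb cs es) = cs ! Suc i"
proof -
  have "f (es ! i) (lincomb cs es) = (\<Sum>k<length es. cs ! k * f (es ! i) (es ! k))"
    using assms by (simp add: lincomb_right)
  also have "\<dots> = (\<Sum>k<length es. if k = Suc i then cs ! k else 0)"
    using assms by (intro sum.cong) (auto simp: chain_nth)
  finally show ?thesis using assms by simp
qed

text \<open>Pairing with the successor reads off every coefficient but the last, pairing with the
  predecessor every coefficient but the first. A chain of one vector would be radical, hence the
  length bound.\<close>

lemma chain_gram_regular:
  assumes "chain es" "2 \<le> length es"
  shows "gram_regular es"
  unfolding gram_regular_def
proof (intro allI impI)
  fix cs assume cs: "length cs = length es"
    and 0: "\<forall>u\<in>set es. f (lincomb cs es) u = 0 \<and> f u (lincomb cs es) = 0"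
  have "cs ! i = 0" if "i < length es" for i
  proof (cases "Suc i < length es")
    case True
    then show ?thesis using chain_lincomb_left[OF assms(1) cs True] 0 by simp
  next
    case False
    then obtain k where k: "i = Suc k" using assms(2) that by (cases i) auto
    then show ?thesis using chain_lincomb_right[OF assms(1) cs, of k] 0 that by simp
  qed
  then show "set cs \<subseteq> {0}" using cs by (auto simp: in_set_conv_nth)
qed

lemma chain_append:
  assumes "chain es" "es \<noteq> []"
    and "\<And>x. x \<in> set es \<Longrightarrow> f x r = 0 \<and> f r x = 0 \<and> f c x = 0"
    and "f (last es) c = 1" "\<And>x. x \<in> set (butlast es) \<Longrightarrow> f x c = 0"
    and "f c c = 0" "f c r = 1" "f r c = 0" "f r r = 0"
  shows "chain (es @ [c, r])"
proof -
  have *: "f (es ! i) c = (if Suc i = length es then 1 else 0)" if "i < length es" for i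
  proof (cases "Suc i = length es")
    case True
    then have "es ! i = last es" using assms(2) by (simp add: last_conv_nth flip: True)
    then show ?thesis using True assms(4) by simp
  next
    case False
    then have "es ! i \<in> set (butlast es)"
      using that by (auto simp: in_set_conv_nth nth_butlast intro!: exI[of _ i])
    then show ?thesis using False assms(5) by simp
  qed
  show ?thesis
    unfolding chain_def
    using assms * by (auto simp: nth_append nth_Cons' chain_nth less_Suc_eq)
qed

text \<open>Relative to \<open>V = \<langle>c, r\<rangle> \<oplus> U\<close> the only entries of \<open>f\<close> not yet normalised are those of \<open>U\<close> and
  the functional \<open>f(-, c)\<close> on \<open>U\<close>, which replacing \<open>c\<close> by \<open>c - u\<close> changes by \<open>f(-, u)\<close>.\<close>

context
  fixes V c r U
  assumes V: "subspace V" and r: "r \<in> V" "\<forall>y\<in>V. f r y = 0"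
    and c: "c \<in> V" "f c r = 1" "f c c = 0"
  defines "U \<equiv> {u \<in> V. f u r = 0 \<and> f c u = 0}"
begin

lemma deg_subspace: "subspace U"
  by (simp add: U_def subspace_kernel_two V linear_functional_left linear_functional_right)

lemma deg_dim: "dim U + 2 \<le> dim V"
proof -
  let ?U1 = "{u \<in> V. f u r = 0}"
  have sub: "subspace ?U1" by (simp add: subspace_kernel V linear_functional_left)
  then have "dim U < dim ?U1"
    using r c by (intro dim_less_subspace[OF deg_subspace, of _ r]) (auto simp: U_def)
  moreover have "dim ?U1 < dim V"
    using c V sub by (intro dim_less_subspace[of _ _ c]) auto
  ultimately show ?thesis by simp
qed

lemma deg_mem: "u \<in> U \<Longrightarrow> u \<in> V \<and> f u r = 0 \<and> f c u = 0 \<and> f r u = 0"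
  using r by (auto simp: U_def)

lemma deg_decomp:
  assumes "v \<in> V"
  obtains u where "u \<in> U" "v = f v r \<odot> c + f c v \<odot> r + u"
proof
  show "v - f v r \<odot> c - f c v \<odot> r \<in> U"
    using assms V r c by (auto simp: U_def intro: subspace_diff subspace_scale)
qed simp

text \<open>All of \<open>U\<close> pairs to zero with \<open>c - u0\<close> as right argument. The
  values of \<open>c - u0\<close> as left argument need no hypothesis: multiples of \<open>r\<close>
  added to the vectors of \<open>U\<close> absorb them, since \<open>r\<close> is left radical and
  \<open>f(c', r) = 1\<close>.\<close>

lemma deg_split_two:
  assumes u0: "u0 \<in> U" and h: "\<And>u. u \<in> U \<Longrightarrow> f u u0 = f u c"
  shows "\<exists>es W. 2 \<le> length es \<and> chain es \<and> splits V es W"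
proof -
  define c' where "c' = c - u0"
  note [simp] = c(2,3) deg_mem[OF u0, THEN conjunct2, THEN conjunct1] 
    deg_mem[OF u0, THEN conjunct2, THEN conjunct2, THEN conjunct1] h[OF u0]
  have c'V: "c' \<in> V" using u0 deg_mem V c by (auto simp: c'_def intro: subspace_diff)
  have c': "f c' c' = 0" "f c' r = 1" by (simp_all add: c'_def)
  define W where "W = {v \<in> V. f v r = 0 \<and> f c' v = 0}"
  have "chain [c', r]"
    using r c'V c' by (auto simp: chain_def less_Suc_eq)
  moreover have "splits V [c', r] W"
  proof (rule splitsI)
    show W: "subspace W"
      by (simp add: W_def subspace_kernel_two V linear_functional_left linear_functional_right)
    show "V \<subseteq> span (set [c', r] \<union> W)"
    proof
      fix v assume v: "v \<in> V"
      define w where "w = v - f v r \<odot> c' - f c' v \<odot> r"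
      have "w \<in> W" using v V c'V r c' by (auto simp: w_def W_def intro: subspace_diff subspace_scale)
      then have "f v r \<odot> c' + f c' v \<odot> r + w \<in> span (set [c', r] \<union> W)"
        by (intro span_add span_scale span_base) auto
      then show "v \<in> span (set [c', r] \<union> W)" by (simp add: w_def)
    qed
    fix x w assume x: "x \<in> set [c', r]" and w: "w \<in> W"
    then have "w \<in> V" by (simp add: W_def)
    then obtain u where u: "u \<in> U" "w = f w r \<odot> c + f c w \<odot> r + u" by (rule deg_decomp)
    then have wu: "w = f c w \<odot> r + u" using w by (simp add: W_def)
    have "f u c' = 0" using u(1) h by (simp add: c'_def)
    then have "f w c' = 0" using r c'V by (subst wu) simp
    then show "f x w = 0 \<and> f w x = 0"
      using x w r by (auto simp: W_def)
  qed (use V c'V r in \<open>auto simp: W_def\<close>)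
  ultimately show ?thesis by (intro exI[of _ "[c', r]"]) auto
qed

text \<open>As \<open>e\<close> is radical in \<open>U\<close>, the value \<open>f(e, c)\<close>
  cannot be cleared. Instead \<open>e\<close> is placed in front of \<open>c\<close>, and the kernel
  of \<open>f(-, c)\<close> in \<open>U\<close> is left as complement.\<close>

lemma deg_split_three:
  assumes e: "e \<in> U" "f e c \<noteq> 0" "\<And>u. u \<in> U \<Longrightarrow> f e u = 0 \<and> f u e = 0"
  shows "\<exists>es W. 2 \<le> length es \<and> chain es \<and> splits V es W"
proof -
  define e1 where "e1 = (1 / f e c) \<odot> e"
  have e1: "e1 \<in> U" "f e1 c = 1" "\<And>u. u \<in> U \<Longrightarrow> f e1 u = 0 \<and> f u e1 = 0"
    using e deg_subspace by (auto simp: e1_def subspace_scale)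
  define W where "W = {u \<in> U. f u c = 0}"
  have "chain [e1, c, r]"
    using r c e1 deg_mem by (auto simp: chain_def less_Suc_eq)
  moreover have "splits V [e1, c, r] W"
  proof (rule splitsI)
    show W: "subspace W"
      by (simp add: W_def subspace_kernel deg_subspace linear_functional_left)
    show "V \<subseteq> span (set [e1, c, r] \<union> W)"
    proof
      fix v assume v: "v \<in> V"
      then obtain u where u: "u \<in> U" "v = f v r \<odot> c + f c v \<odot> r + u" by (rule deg_decomp)
      define w where "w = u - f u c \<odot> e1"
      have "w \<in> W"
        using e1 u deg_subspace by (auto simp: w_def W_def intro: subspace_diff subspace_scale)
      then have "f v r \<odot> c + f c v \<odot> r + (f u c \<odot> e1 + w) \<in> span (set [e1, c, r] \<union> W)"
        by (intro span_add span_scale span_base) auto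
      then show "v \<in> span (set [e1, c, r] \<union> W)" using u by (simp add: w_def)
    qed
  qed (use V r c e1 deg_mem in \<open>auto simp: W_def\<close>)
  ultimately show ?thesis by (intro exI[of _ "[e1, c, r]"]) auto
qed

text \<open>On the part of \<open>U\<close> without the last chain vector, only the left radical of
  \<open>W0\<close> could keep \<open>f(-, c)\<close> from being represented, and \<open>h\<close>
  excludes that. What is left is the value at \<open>last es\<close>: if it is zero,
  \<open>c, r\<close> split off alone, otherwise it links the chain to \<open>c\<close> and
  \<open>r\<close>.\<close>

lemma deg_split_extend:
  assumes es: "chain es" "2 \<le> length es" "splits U es W0"
    and h: "\<And>w. w \<in> W0 \<Longrightarrow> (\<forall>v\<in>W0. f w v = 0) \<Longrightarrow> f w c = 0"
  shows "\<exists>es W. 2 \<le> length es \<and> chain es \<and> splits V es W"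
proof -
  note esU = splits_subsets[OF es(3)] and W0 = splits_subspace[OF es(3)]
    and Uspan = splits_span[OF es(3)] and orth = splits_orthogonal[OF es(3)]
  define W1 where "W1 = span (set (butlast es) \<union> W0)"
  have W1U: "W1 \<subseteq> U"
    unfolding W1_def Uspan by (intro span_mono) (auto dest: in_set_butlastD)
  have lastU: "last es \<in> U" using es(2) esU by (cases es rule: rev_cases) auto
  \<comment> \<open>Pairing with \<open>es ! Suc i\<close> isolates the coefficient of
    \<open>es ! i\<close>, so a vector of \<open>W1\<close> that is left radical for
    \<open>U\<close> lies in \<open>W0\<close>.\<close>
  have rad: "f u c = 0" if u: "u \<in> W1" "\<forall>v\<in>U. f u v = 0" for u
  proof -
    obtain cs w where cw: "length cs = length (butlast es)" "w \<in> W0" "u = lincomb cs (butlast es) + w"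
      using u(1) W0 unfolding W1_def by (rule span_Un_subspaceE)
    have "cs ! i = 0" if i: "i < length cs" for i
    proof -
      have i': "Suc i < length es" using cw(1) i by simp
      then have "es ! Suc i \<in> U" using esU by auto
      then have "0 = f u (es ! Suc i)" using u(2) by auto
      also have "\<dots> = f (lincomb cs (butlast es)) (es ! Suc i) + f w (es ! Suc i)"
        by (simp add: cw(3))
      also have "f w (es ! Suc i) = 0"
        using orth cw(2) i' by (auto simp: orthogonal_def)
      also have "f (lincomb cs (butlast es)) (es ! Suc i)
          = (\<Sum>k<length (butlast es). cs ! k * f (butlast es ! k) (es ! Suc i))"
        using cw(1) by (rule lincomb_left)
      also have "\<dots> = (\<Sum>k<length (butlast es). if k = i then cs ! k else 0)"
        using es(1) i' cw(1) by (intro sum.cong) (auto simp: chain_nth nth_butlast)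
      also have "\<dots> = cs ! i" using i cw(1) by simp
      finally show ?thesis by simp
    qed
    then have "set cs \<subseteq> {0}" by (auto simp: in_set_conv_nth)
    then have "lincomb cs us = 0" for us
      by (induction cs us rule: lincomb.induct) auto
    then have "u = w" using cw by simp
    then show ?thesis using h cw(2) u(2) esU by blast
  qed
  obtain u0 where u0: "u0 \<in> U" "\<And>u. u \<in> W1 \<Longrightarrow> f u u0 = f u c"
    using representable[of W1 U "\<lambda>u. f u c"] rad deg_subspace linear_functional_left
    unfolding W1_def by blast
  have last0: "f (last es) u = 0" if "u \<in> U" for u
  proof -
    have lst: "last es = es ! (length es - 1)" using es(2) by (subst last_conv_nth) auto
    have "last es \<in> set es" using es(2) by (intro last_in_set) auto
    then have gen: "f (last es) x = 0" if "x \<in> set es \<union> W0" for x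
      using that es orth lst by (auto simp: in_set_conv_nth chain_nth orthogonal_def)
    have "f (last es) x = 0" if "x \<in> span (set es \<union> W0)" for x
      using that by (induction rule: span_induct_alt) (use gen in auto)
    then show ?thesis using that Uspan by blast
  qed
  show ?thesis
  proof (cases "f (last es) c = 0")
    case True
    have sub: "set es \<union> W0 \<subseteq> insert (last es) (set (butlast es) \<union> W0)"
      using es(2) by (cases es rule: rev_cases) auto
    have "f u u0 = f u c" if "u \<in> U" for u
      using that unfolding Uspan
    proof (induction rule: span_induct_alt)
      case (step k x y)
      then have "x = last es \<or> x \<in> W1"
        using sub unfolding W1_def by (auto intro: span_base)
      then have "f x u0 = f x c"
        using u0 last0[OF u0(1)] True by auto
      then show ?case using step by simp
    qed simp
    then show ?thesis using deg_split_two u0(1) by blast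
  next
    case a: False
    \<comment> \<open>Subtracting \<open>u0\<close> clears \<open>f(-, c)\<close> on
      \<open>W1\<close>; the multiple of \<open>r\<close> restores
      \<open>f(c', c') = 0\<close>.\<close>
    define c' where "c' = c - u0 + (f u0 c - f u0 u0) \<odot> r"
    \<comment> \<open>\<open>\<phi>\<close> moves \<open>U\<close> into the kernel of
      \<open>f(c', -)\<close>. Gram entries survive because \<open>r\<close> pairs to zero with
      \<open>U\<close> on both sides.\<close>
    define \<phi> where "\<phi> x = x - f c' x \<odot> r" for x
    \<comment> \<open>Reciprocal scalings, so that the links from \<open>last es\<close> to
      \<open>X\<close> and from \<open>X\<close> to \<open>Y\<close> both become 1.\<close>
    define X where "X = (1 / f (last es) c) \<odot> c'"
    define Y where "Y = f (last es) c \<odot> r"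
    have [simp]: "f r x = 0" if "x \<in> U" for x using deg_mem[OF that] by simp
    have [simp]: "f x r = 0" if "x \<in> U" for x using deg_mem[OF that] by simp
    have [simp]: "f c x = 0" if "x \<in> U" for x using deg_mem[OF that] by simp
    have [simp]: "f r r = 0" "f r c = 0" "f c r = 1" "f c c = 0" using r c by auto
    have [simp]: "f r u0 = 0" "f u0 r = 0" "f c u0 = 0" using u0(1) by auto
    have c'V: "c' \<in> V" unfolding c'_def
      using u0 deg_mem V c r by (intro subspace_add subspace_diff subspace_scale) auto
    have [simp]: "f c' c' = 0" "f c' r = 1" "f r c' = 0"
      by (simp_all add: c'_def)
    have phi: "f (\<phi> x) (\<phi> y) = f x y" "f c' (\<phi> x) = 0" "f (\<phi> x) r = 0" "f r (\<phi> x) = 0"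
      "f (\<phi> x) c' = f x c - f x u0"
      if "x \<in> U" "y \<in> U" for x y
      using that by (simp_all add: \<phi>_def) (simp add: c'_def)
    define W where "W = {w \<in> span (insert r W0). f c' w = 0}"
    let ?es = "map \<phi> es @ [X, Y]"
    have W_rep: "\<exists>w0\<in>W0. w = \<phi> w0" if "w \<in> W" for w
    proof -
      from that obtain k where k: "w - k \<odot> r \<in> W0"
        using W0 by (auto simp: W_def span_breakdown_eq span_eq_iff[THEN iffD2])
      have "f c' (w - k \<odot> r) = - k" using that by (simp add: W_def)
      then have "w = \<phi> (w - k \<odot> r)" by (simp add: \<phi>_def)
      with k show ?thesis by blast
    qed
    have "chain ?es"
    proof (rule chain_append)
      show "chain (map \<phi> es)"
        using es(1) esU phi by (auto simp: chain_def subset_iff)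
      show "map \<phi> es \<noteq> []" using es(2) by auto
      show "f x Y = 0 \<and> f Y x = 0 \<and> f X x = 0" if "x \<in> set (map \<phi> es)" for x
        using that esU phi by (auto simp: X_def Y_def)
      show "f (last (map \<phi> es)) X = 1"
        using es(2) a lastU last0[OF u0(1)] phi(5)[OF lastU lastU]
        by (subst last_map) (auto simp: X_def)
      show "f x X = 0" if "x \<in> set (butlast (map \<phi> es))" for x
      proof -
        from that obtain e where e: "e \<in> set (butlast es)" "x = \<phi> e"
          by (auto simp: map_butlast[symmetric])
        then have "e \<in> W1" by (auto simp: W1_def intro: span_base)
        then show ?thesis using phi(5)[of e e] W1U u0(2) e by (auto simp: X_def)
      qed
    qed (use a in \<open>simp_all add: X_def Y_def\<close>)
    moreover have "splits V ?es W"
    proof (rule splitsI)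
      show "subspace W"
        by (simp add: W_def subspace_kernel linear_functional_right)
      have phiV: "\<phi> x \<in> V" if "x \<in> U" for x
        using that deg_mem V r by (auto simp: \<phi>_def intro: subspace_diff subspace_scale)
      show "set ?es \<subseteq> V"
        using esU phiV c'V r V by (auto simp: X_def Y_def subspace_scale)
      show "W \<subseteq> V"
        using W_rep phiV esU by blast
      let ?X = "span (set ?es \<union> W)"
      have "X \<in> ?X" "Y \<in> ?X" by (auto intro: span_base)
      then have "f (last es) c \<odot> X \<in> ?X" "(1 / f (last es) c) \<odot> Y \<in> ?X"
        by (auto intro: span_scale)
      then have c'X: "c' \<in> ?X" and rX: "r \<in> ?X" using a by (simp_all add: X_def Y_def)
      have un: "x \<in> ?X" if "\<phi> x \<in> ?X" for x
      proof -
        have "\<phi> x + f c' x \<odot> r \<in> ?X" using that rX by (intro span_add span_scale)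
        then show ?thesis by (simp add: \<phi>_def)
      qed
      have "\<phi> w \<in> W" if "w \<in> W0" for w
      proof -
        have "\<phi> w \<in> span (insert r W0)"
          unfolding \<phi>_def using that by (intro span_diff span_scale span_base) auto
        then show ?thesis using phi(2) that esU by (auto simp: W_def)
      qed
      then have "\<phi> x \<in> ?X" if "x \<in> set es \<union> W0" for x
        using that by (intro span_base) auto
      then have "set es \<union> W0 \<subseteq> ?X" using un by blast
      then have UX: "U \<subseteq> ?X"
        unfolding Uspan by (rule span_minimal) (rule subspace_span)
      have "c' + u0 - (f u0 c - f u0 u0) \<odot> r \<in> ?X"
        using c'X rX UX u0(1) by (intro span_add span_diff span_scale) auto
      then have cX: "c \<in> ?X" by (simp add: c'_def)
      show "V \<subseteq> ?X"
      proof
        fix v assume "v \<in> V"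
        then obtain u where u: "u \<in> U" "v = f v r \<odot> c + f c v \<odot> r + u" by (rule deg_decomp)
        have "f v r \<odot> c + f c v \<odot> r + u \<in> ?X"
          using u(1) UX cX rX by (intro span_add span_scale) auto
        then show "v \<in> ?X" using u(2) by simp
      qed
      fix x w assume x: "x \<in> set ?es" and w: "w \<in> W"
      obtain w0 where w0: "w0 \<in> W0" "w = \<phi> w0" using W_rep[OF w] by blast
      then have "w0 \<in> U" "w0 \<in> W1" using esU by (auto simp: W1_def intro: span_base)
      then show "f x w = 0 \<and> f w x = 0"
        using x w0 orth esU phi u0(2)[of w0] by (auto simp: X_def Y_def orthogonal_def)
    qed (use V in simp)
    ultimately show ?thesis using es(2) by (intro exI[of _ ?es]) auto
  qed
qed

end

text \<open>The cases are governed by \<open>f(-, c)\<close> on \<open>U\<close>. A representable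
  functional gives length 2 and a common radical vector of \<open>U\<close> length 3; otherwise
  \<open>U\<close> splits off a chain by induction, and the only difficulty is a complement whose
  own left radical meets \<open>f(-, c)\<close>.\<close>

theorem degenerate_splits_chain:
  assumes "subspace V" "no_radical V" "dim V \<le> 6"
    and "r \<in> V" "r \<noteq> 0" "\<And>y. y \<in> V \<Longrightarrow> f r y = 0"
  shows "\<exists>es W. 2 \<le> length es \<and> chain es \<and> splits V es W"
  using assms
proof (induction "dim V" arbitrary: V r rule: less_induct)
  case less
  note V = less.prems(1) and nr = less.prems(2) and r = less.prems(4-6)
  obtain y where y: "y \<in> V" "f y r \<noteq> 0"
    using nr r unfolding no_radical_def by blast
  define y' where "y' = (1 / f y r) \<odot> y"
  define c where "c = y' - f y' y' \<odot> r"
  have y': "y' \<in> V" "f y' r = 1" using y V by (auto simp: y'_def subspace_scale)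
  have c: "c \<in> V" "f c r = 1" "f c c = 0"
    using y' V r by (auto simp: c_def subspace_diff subspace_scale)
  define U where "U = {u \<in> V. f u r = 0 \<and> f c u = 0}"
  have r_left: "\<forall>y\<in>V. f r y = 0" using r(3) by blast
  note set_up = V r(1) r_left c
  note U_facts = deg_subspace[OF set_up, folded U_def] deg_dim[OF set_up, folded U_def]
    deg_mem[OF set_up, folded U_def]
  note two = deg_split_two[OF set_up, folded U_def] and three = deg_split_three[OF set_up, folded U_def]
    and extend = deg_split_extend[OF set_up, folded U_def]
  consider (rep) u0 where "u0 \<in> U" "\<And>u. u \<in> U \<Longrightarrow> f u u0 = f u c"
    | (rad) e where "e \<in> U" "e \<noteq> 0" "\<And>u. u \<in> U \<Longrightarrow> f e u = 0 \<and> f u e = 0"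
    | (deg) e where "e \<in> U" "e \<noteq> 0" "\<And>u. u \<in> U \<Longrightarrow> f e u = 0" "no_radical U"
  proof (cases "\<exists>e\<in>U. f e c \<noteq> 0 \<and> (\<forall>u\<in>U. f e u = 0)")
    case False
    then have "\<exists>u0\<in>U. \<forall>u\<in>U. f u u0 = f u c"
      using representable[of U U "\<lambda>u. f u c"] U_facts(1) linear_functional_left by metis
    then show ?thesis using rep by blast
  next
    case True
    then obtain e where e: "e \<in> U" "e \<noteq> 0" "\<And>u. u \<in> U \<Longrightarrow> f e u = 0"
      by (metis zero_left)
    show ?thesis
    proof (cases "no_radical U")
      case True
      then show ?thesis using deg e by blast
    next
      case False
      then show ?thesis unfolding no_radical_def using rad by blast
    qed
  qed
  then show ?case
  proof cases
    case rep
    show ?thesis by (rule two[OF rep])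
  next
    case rad
    \<comment> \<open>Otherwise \<open>e\<close> would be radical on both sides in all of
      \<open>V\<close>.\<close>
    have "f e c \<noteq> 0"
    proof
      assume 0: "f e c = 0"
      have "f e v = 0 \<and> f v e = 0" if v: "v \<in> V" for v
      proof -
        obtain u where u: "u \<in> U" "v = f v r \<odot> c + f c v \<odot> r + u"
          using deg_decomp[OF set_up v, folded U_def] by blast
        show ?thesis
          using u(1) 0 rad U_facts(3)[OF rad(1)] by (subst (1 2) u(2)) simp
      qed
      then show False using nr rad(1,2) U_facts(3) unfolding no_radical_def by blast
    qed
    with rad show ?thesis by (intro three[of e]) auto
  next
    case deg
    have "dim U < dim V" "dim U \<le> 6" using U_facts(2) less.prems(3) by auto
    with less.hyps[OF _ U_facts(1) deg(4) _ deg(1-3)] obtain es W where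
      es: "2 \<le> length es" "chain es" "splits U es W" by blast
    have dimU: "dim U = length es + dim W"
      using splits_dim[OF es(3) chain_gram_regular] es by simp
    show ?thesis
    proof (cases "\<forall>w\<in>W. (\<forall>v\<in>W. f w v = 0) \<longrightarrow> f w c = 0")
      case True
      then show ?thesis using extend[OF es(2,1,3)] by blast
    next
      case False
      then obtain w where w: "w \<in> W" "\<And>v. v \<in> W \<Longrightarrow> f w v = 0" "w \<noteq> 0"
        by (metis zero_left)
      have W: "subspace W" "no_radical W" "dim W < dim V" "dim W \<le> 6"
        using splits_subspace[OF es(3)] splits_no_radical[OF es(3) deg(4)] dimU U_facts(2) less.prems(3)
        by auto
      obtain ds W2 where ds: "2 \<le> length ds" "chain ds" "splits W ds W2"
        using less.hyps[OF W(3,1,2,4) w(1,3,2)] by blast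
      have dimW: "dim W = length ds + dim W2"
        using splits_dim[OF ds(3) chain_gram_regular] ds by simp
      \<comment> \<open>Since \<open>dim U \<le> 4\<close> and both chains have at least two
        vectors, they exhaust \<open>U\<close>.\<close>
      have "length es = 2" "length ds = 2" "dim W2 = 0"
        using dimU dimW U_facts(2) less.prems(3) es(1) ds(1) by linarith+
      then obtain e1 e2 d1 d2 where es2: "es = [e1, e2]" "ds = [d1, d2]"
        by (auto simp: numeral_2_eq_2 length_Suc_conv)
      have "W2 \<subseteq> {0}" using \<open>dim W2 = 0\<close> by simp
      then have Wd: "W = span {d1, d2}"
        using splits_span[OF ds(3)] splits_subspace[OF ds(3)] subspace_0
        by (metis Un_insert_right es2(2) list.set(1,2) span_insert_0 subset_singletonD
            sup_bot_right)
      have Ue: "U = span ({e1, e2} \<union> span {d1, d2})"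
        using splits_span[OF es(3)] es2 Wd by simp
      have E: "f e1 e1 = 0" "f e1 e2 = 1" "f e2 e1 = 0" "f e2 e2 = 0"
        and D: "f d1 d1 = 0" "f d1 d2 = 1" "f d2 d1 = 0" "f d2 d2 = 0"
        using es(2) ds(2) es2 by (auto simp: chain_def less_Suc_eq)
      have O: "f x y = 0" "f y x = 0" if "x \<in> {e1, e2}" "y \<in> {d1, d2}" for x y
        using splits_orthogonal[OF es(3)] es2 Wd that
        by (auto simp: orthogonal_def intro: span_base)
      have pair: "\<exists>a b. w = a \<odot> x + b \<odot> y" if "w \<in> span {x, y}" for w x y
      proof -
        from that have "w \<in> span (set [x, y])" by simp
        then obtain cs where "length cs = length [x, y]" "w = lincomb cs [x, y]"
          by (rule span_listE)
        then show ?thesis by (auto simp: length_Suc_conv) blast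
      qed
      show ?thesis
      proof (cases "f e2 c = 0")
        case True
        \<comment> \<open>The chains trade places: the left radical of the new complement is the
          line of \<open>e2\<close>, on which \<open>f(-, c)\<close> vanishes.\<close>
        have "splits U [d1, d2] (span {e1, e2})"
        proof (rule splitsI)
          show "U \<subseteq> span (set [d1, d2] \<union> span {e1, e2})"
            unfolding Ue span_Un_span by (simp add: insert_commute)
          show "set [d1, d2] \<subseteq> U" unfolding Ue by (auto intro: span_base)
          show "span {e1, e2} \<subseteq> U" unfolding Ue span_Un_span by (intro span_mono) auto
          show "f u w = 0 \<and> f w u = 0" if "u \<in> set [d1, d2]" "w \<in> span {e1, e2}" for u w
            using pair[OF that(2)] that(1) O by auto
        qed (use U_facts in auto)
        moreover have "f w c = 0" if "w \<in> span {e1, e2}" "\<forall>v\<in>span {e1, e2}. f w v = 0" for w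
          using pair[OF that(1)] that(2)[rule_format, of e2] True E by (auto simp: span_base)
        ultimately show ?thesis
          using extend[of "[d1, d2]" "span {e1, e2}"] ds(2) es2 by auto
      next
        case False
        \<comment> \<open>\<open>\<beta>\<close> is chosen so that \<open>f(-, c)\<close> kills the
          radical vector \<open>d2'\<close> of the second chain; the multiple of \<open>d1\<close>
          added to \<open>e1\<close> keeps the two chains orthogonal.\<close>
        define \<beta> where "\<beta> = f d2 c / f e2 c"
        define e1' where "e1' = e1 + \<beta> \<odot> d1"
        define d2' where "d2' = d2 - \<beta> \<odot> e2"
        have hd2': "f d2' c = 0" using False by (simp add: d2'_def \<beta>_def)
        have "splits U [e1', e2] (span {d1, d2'})"
        proof (rule splitsI)
          let ?X = "span (set [e1', e2] \<union> span {d1, d2'})"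
          have *: "e1' \<in> ?X" "e2 \<in> ?X" "d1 \<in> ?X" "d2' \<in> ?X"
            by (auto intro: span_base)
          then have "e1' - \<beta> \<odot> d1 \<in> ?X" "d2' + \<beta> \<odot> e2 \<in> ?X"
            by (auto intro: span_add span_diff span_scale)
          then have "{e1, e2, d1, d2} \<subseteq> ?X" using * by (simp add: e1'_def d2'_def)
          then show "U \<subseteq> ?X"
            unfolding Ue span_Un_span by (intro span_minimal) auto
          have *: "e1 \<in> U" "e2 \<in> U" "d1 \<in> U" "d2 \<in> U" 
            unfolding Ue by (auto intro: span_base)
          then have **: "e1' \<in> U" "d2' \<in> U"
            using U_facts(1) by (auto simp: e1'_def d2'_def subspace_add subspace_diff subspace_scale)
          show "set [e1', e2] \<subseteq> U" using * ** by auto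
          show "span {d1, d2'} \<subseteq> U" using * ** U_facts(1) by (intro span_minimal) auto
          show "f u w = 0 \<and> f w u = 0" if "u \<in> set [e1', e2]" "w \<in> span {d1, d2'}" for u w
            using pair[OF that(2)] that(1) O E D by (auto simp: e1'_def d2'_def)
        qed (use U_facts in auto)
        moreover have "chain [e1', e2]"
          using E D O by (auto simp: chain_def less_Suc_eq e1'_def)
        moreover have "f w c = 0" if "w \<in> span {d1, d2'}" "\<forall>v\<in>span {d1, d2'}. f w v = 0" for w
        proof -
          from pair[OF that(1)] obtain a b where ab: "w = a \<odot> d1 + b \<odot> d2'" by blast
          have "f w d2' = a" using ab E D O by (simp add: d2'_def)
          then have "a = 0" using that(2) by (simp add: span_base)
          then show ?thesis using ab hd2' by simp
        qed
        ultimately show ?thesis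
          using extend[of "[e1', e2]" "span {d1, d2'}"] by auto
      qed
    qed
  qed
qed

end

section \<open>Canonical blocks\<close>

text \<open>Writing \<open>J\<close> for the nilpotent Jordan matrix of size \<open>2n\<close>, the block \<open>Ch2n c\<close> is
  \<open>J + c J\<^sup>T\<close>, also known as \<open>H\<^sub>2\<^sub>n(c)\<close> for \<open>c \<noteq> 0\<close>; \<open>J3\<close> and \<open>J5\<close> are nilpotent Jordan
  matrices, \<open>Gn\<close> is \<open>\<Gamma>\<^sub>n\<close> and \<open>H2n\<close> is the exceptional \<open>H\<^sub>2\<^sub>n((-1)\<^sup>n)\<close>. All matrices are written in
  the order of the basis vectors in the multiplication tables, not in chain order.\<close>

datatype block = Ch2 complex | Ch4 complex | Ch6 complex | J3 | J5
  | G1 | G2 | G3 | G4 | G5 | G6 | H2 | H4 | H6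

fun block_matrix :: "block \<Rightarrow> complex list list" where
  "block_matrix (Ch2 c) = [[0, 1], [c, 0]]"
| "block_matrix (Ch4 c) = [[0, 0, 0, 1], [0, 0, 1, c], [0, c, 0, 0], [c, 1, 0, 0]]"
| "block_matrix (Ch6 c) = [[0, 0, 0, 0, 0, 1], [0, 0, 0, 0, 1, c], [0, 0, 0, 1, c, 0],
     [0, 0, c, 0, 0, 0], [0, c, 1, 0, 0, 0], [c, 1, 0, 0, 0, 0]]"
| "block_matrix J3 = [[0, 0, 1], [0, 0, 0], [0, 1, 0]]"
| "block_matrix J5 = [[0, 0, 0, 1, 0], [0, 0, 0, 0, 1], [0, 0, 0, 0, 0], [0, 1, 0, 0, 0],
     [0, 0, 1, 0, 0]]"
| "block_matrix G1 = [[1]]"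
| "block_matrix G2 = [[0, 1], [-1, 1]]"
| "block_matrix G3 = [[0, 0, 1], [0, 1, 1], [1, -1, 0]]"
| "block_matrix G4 = [[0, 0, 0, 1], [0, 0, 1, 1], [0, -1, 1, 0], [-1, 1, 0, 0]]"
| "block_matrix G5 = [[0, 0, 0, 0, 1], [0, 0, 0, 1, 1], [0, 0, 1, 1, 0], [0, 1, -1, 0, 0],
     [1, -1, 0, 0, 0]]"
| "block_matrix G6 = [[0, 0, 0, 0, 0, 1], [0, 0, 0, 0, 1, 1], [0, 0, 0, 1, 1, 0],
     [0, 0, -1, 1, 0, 0], [0, -1, 1, 0, 0, 0], [-1, 1, 0, 0, 0, 0]]"
| "block_matrix H2 = [[0, 1], [-1, 0]]"
| "block_matrix H4 = [[0, 0, 0, 1], [0, 0, 1, 1], [0, 1, 0, 0], [1, -1, 0, 0]]"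
| "block_matrix H6 = [[0, 0, 0, 0, 0, 1], [0, 0, 0, 0, 1, 1], [0, 0, 0, 1, 1, 0],
     [0, 0, -1, 0, 0, 0], [0, -1, 1, 0, 0, 0], [-1, 1, 0, 0, 0, 0]]"

fun valid_block :: "block \<Rightarrow> bool" where
  "valid_block (Ch2 c) = (c \<notin> {1, -1})"
| "valid_block (Ch4 c) = (c \<notin> {1, -1})"
| "valid_block (Ch6 c) = (c \<notin> {1, -1})"
| "valid_block _ = True"

text \<open>Matrix form of \<open>gram_regular\<close>, which turns regularity into one finite
  computation per block.\<close>

definition matrix_regular :: "complex list list \<Rightarrow> bool" where
  "matrix_regular M \<longleftrightarrow> (\<forall>cs. length cs = length M \<longrightarrow>
     (\<forall>j<length M. (\<Sum>i<length M. cs ! i * M ! i ! j) = 0 \<and> (\<Sum>i<length M. cs ! i * M ! j ! i) = 0)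
     \<longrightarrow> set cs \<subseteq> {0})"

lemma block_matrix_regular:
  assumes "valid_block k"
  shows "matrix_regular (block_matrix k)"
  unfolding matrix_regular_def
proof (intro allI impI)
  fix cs assume cs: "length cs = length (block_matrix k)"
    and 0: "\<forall>j<length (block_matrix k). (\<Sum>i<length (block_matrix k). cs ! i * block_matrix k ! i ! j) =
      0 \<and>
      (\<Sum>i<length (block_matrix k). cs ! i * block_matrix k ! j ! i) = 0"
  show "set cs \<subseteq> {0}"
  proof (cases k)
    case (Ch2 c)
    then show ?thesis using assms cs 0
      by (auto simp: length_Suc_conv All_less_Suc2 sum.lessThan_Suc_shift simp del: sum.lessThan_Suc)
  next
    case (Ch4 c)
    then show ?thesis using assms cs 0
      by (clarsimp simp: length_Suc_conv All_less_Suc2 sum.lessThan_Suc_shift simp del: sum.lessThan_Suc)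
  next
    case (Ch6 c)
    then show ?thesis using assms cs 0
      by (clarsimp simp: length_Suc_conv All_less_Suc2 sum.lessThan_Suc_shift simp del: sum.lessThan_Suc)
  qed (use cs 0 in \<open>clarsimp simp: length_Suc_conv All_less_Suc2 sum.lessThan_Suc_shift
    simp del: sum.lessThan_Suc\<close>)+
qed

context complex_bilinear_form
begin

definition realizes :: "block \<Rightarrow> 'a list \<Rightarrow> bool" where
  "realizes k us \<longleftrightarrow> valid_block k \<and> map (\<lambda>u. map (f u) us) us = block_matrix k"

lemma realizes_length: "realizes k us \<Longrightarrow> length us = length (block_matrix k)"
  unfolding realizes_def by (metis length_map)

lemma realizes_nth:
  assumes "realizes k us" "i < length us" "j < length us"
  shows "f (us ! i) (us ! j) = block_matrix k ! i ! j"
proof -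
  have "block_matrix k ! i ! j = map (\<lambda>u. map (f u) us) us ! i ! j"
    using assms(1) by (simp add: realizes_def)
  then show ?thesis using assms(2,3) by simp
qed

lemma realizes_gram_regular:
  assumes "realizes k us"
  shows "gram_regular us"
  unfolding gram_regular_def
proof (intro allI impI)
  fix cs assume cs: "length cs = length us"
    and 0: "\<forall>u\<in>set us. f (lincomb cs us) u = 0 \<and> f u (lincomb cs us) = 0"
  have len: "length us = length (block_matrix k)" by (rule realizes_length[OF assms])
  have "(\<Sum>i<length us. cs ! i * block_matrix k ! i ! j) = 0 \<and> (\<Sum>i<length us. cs ! i * block_matrix k ! j !
    i) = 0"
    if j: "j < length us" for j
  proof -
    have "us ! j \<in> set us" using j by simp
    then have "f (lincomb cs us) (us ! j) = 0" "f (us ! j) (lincomb cs us) = 0" using 0 by auto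
    then show ?thesis
      using realizes_nth[OF assms] j by (simp add: lincomb_left lincomb_right cs)
  qed
  moreover have "matrix_regular (block_matrix k)"
    using assms by (intro block_matrix_regular) (simp add: realizes_def)
  ultimately show "set cs \<subseteq> {0}"
    using cs len by (simp add: matrix_regular_def)
qed

text \<open>Regularity of the block makes the sum direct, so that a dimension bound replaces the
  proof of spanning.\<close>

lemma splits_of_dim:
  assumes V: "subspace V" "subspace W" "set us \<subseteq> V" "W \<subseteq> V" "realizes k us" "orthogonal (set us) W"
    and "dim V \<le> length us + dim W"
  shows "splits V us W"
proof -
  have *: "splits (span (set us \<union> W)) us W"
    using assms by (simp add: splits_def)
  then have "dim (span (set us \<union> W)) = length us + dim W"
    using splits_dim realizes_gram_regular[OF V(5)] by blast
  moreover have "span (set us \<union> W) \<subseteq> V" using V by (intro span_minimal) auto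
  ultimately have "span (set us \<union> W) = V"
    using assms(7) V(1) by (intro subspace_dim_equal) auto
  with * show ?thesis by simp
qed

lemma splits_all:
  assumes "subspace V" "set us \<subseteq> V" "realizes k us" "dim V \<le> length us"
  shows "splits V us {0}"
  using assms subspace_0[OF assms(1)] by (intro splits_of_dim) (auto simp: orthogonal_def)

lemma realizes_dim_span: "realizes k us \<Longrightarrow> dim (span (set us)) = length us"
  using splits_dim[of "span (set us)" us "{0}"] realizes_gram_regular[of k us]
  by (simp add: splits_def orthogonal_def)

lemma splits_two_blocks:
  assumes "subspace V" "set us \<subseteq> V" "set vs \<subseteq> V" "realizes k us" "realizes l vs"
    and "orthogonal (set us) (set vs)" "dim V \<le> length us + length vs"
  shows "splits V us (span (set vs))"
proof (rule splits_of_dim[OF assms(1) subspace_span assms(2) _ assms(4)])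
  show "span (set vs) \<subseteq> V" using assms by (intro span_minimal) auto
  show "orthogonal (set us) (span (set vs))"
    using assms(6) by (metis orthogonal_span orthogonal_sym)
  show "dim V \<le> length us + dim (span (set vs))"
    using assms by (simp only: realizes_dim_span)
qed

definition nondegenerate :: "'a set \<Rightarrow> bool" where
  "nondegenerate V \<longleftrightarrow> (\<forall>x\<in>V. (\<forall>y\<in>V. f x y = 0) \<longrightarrow> x = 0)"

lemma nondegenerateD: "nondegenerate V \<Longrightarrow> x \<in> V \<Longrightarrow> x \<noteq> 0 \<Longrightarrow> \<exists>y\<in>V. f x y \<noteq> 0"
  by (auto simp: nondegenerate_def)

section \<open>Symmetric and skew-symmetric part of the form\<close>

definition sy :: "'a \<Rightarrow> 'a \<Rightarrow> complex" where "sy x y = (f x y + f y x) / 2"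
definition sk :: "'a \<Rightarrow> 'a \<Rightarrow> complex" where "sk x y = (f x y - f y x) / 2"

lemma f_eq: "f x y = sy x y + sk x y"
  by (simp add: sy_def sk_def field_simps)

lemma sy_commute: "sy x y = sy y x"
  by (simp add: sy_def add.commute)

lemma sk_anti: "sk x y = - sk y x"
  by (simp add: sk_def field_simps)

lemma sk_self [simp]: "sk x x = 0"
  by (simp add: sk_def)

lemma sy_flip: "sy x y = a \<Longrightarrow> sy y x = a"
  by (simp add: sy_commute)

lemma sk_flip: "sk x y = a \<Longrightarrow> sk y x = - a"
  by (subst sk_anti) simp

lemma sy_bilinear: "complex_bilinear_form scale Basis sy"
  and sk_bilinear: "complex_bilinear_form scale Basis sk"
  by (unfold_locales; simp add: sy_def sk_def field_simps)+

interpretation sy: complex_bilinear_form scale Basis sy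
  by (rule sy_bilinear)

interpretation sk: complex_bilinear_form scale Basis sk
  by (rule sk_bilinear)

section \<open>Degenerate skew-symmetric part\<close>

text \<open>On \<open>V\<close> the functionals \<open>f(z, -)\<close> and \<open>sy z\<close>
  agree, so nondegeneracy supplies a partner; subtracting a multiple of \<open>z\<close> makes it
  isotropic.\<close>

lemma hyperbolic_partner:
  assumes "subspace V" "nondegenerate V" "z \<in> V" "z \<noteq> 0" "\<forall>v\<in>V. sk z v = 0" "sy z z = 0"
  obtains w where "w \<in> V" "sy z w = 1" "sy w w = 0"
proof -
  obtain y where y: "y \<in> V" "f z y \<noteq> 0"
    using assms nondegenerateD by blast
  then have "sy z y \<noteq> 0" using assms(5) by (simp add: f_eq)
  define y' where "y' = (1 / sy z y) \<odot> y"
  have y': "y' \<in> V" "sy z y' = 1" "sy y' z = 1"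
    using y \<open>sy z y \<noteq> 0\<close> assms(1) by (auto simp: y'_def subspace_scale sy_commute[of y z])
  show thesis
  proof
    show "y' - (sy y' y' / 2) \<odot> z \<in> V"
      using y' assms by (intro subspace_diff subspace_scale)
  qed (use y' assms in simp_all)
qed

text \<open>Here the functional on the complement \<open>U\<close> of the plane is
  \<open>sk w\<close>. The letters \<open>e\<close>, \<open>q\<close> and \<open>d\<close> below
  stand for vectors that are radical for \<open>sk\<close> on the complement at hand.\<close>

context
  fixes V z w U
  assumes V: "subspace V" "nondegenerate V"
    and z: "z \<in> V" "\<forall>v\<in>V. sk z v = 0" "sy z z = 0"
    and w: "w \<in> V" "sy z w = 1" "sy w w = 0"
  defines "U \<equiv> {u \<in> V. sy z u = 0 \<and> sy w u = 0}"
begin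

lemma hyp_subspace: "subspace U"
  by (simp add: U_def subspace_kernel_two V sy.linear_functional_right)

lemma hyp_dim: "dim U + 2 \<le> dim V"
proof -
  let ?U1 = "{u \<in> V. sy z u = 0}"
  have sub: "subspace ?U1" by (simp add: subspace_kernel V sy.linear_functional_right)
  then have "dim U < dim ?U1"
    using z w sy_flip[OF w(2)] by (intro dim_less_subspace[OF hyp_subspace, of _ z]) (auto simp: U_def)
  moreover have "dim ?U1 < dim V"
    using w V sub by (intro dim_less_subspace[of _ _ w]) auto
  ultimately show ?thesis by simp
qed

lemma hyp_base: "sy w z = 1" "sk z w = 0" "sk w z = 0" "v \<in> V \<Longrightarrow> sk z v = 0" "v \<in> V \<Longrightarrow> sk v z = 0"
  using z w sy_flip[OF w(2)] sk_flip[of z] by auto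

lemma hyp_mem:
  assumes "u \<in> U"
  shows "u \<in> V" "sy z u = 0" "sy u z = 0" "sy w u = 0" "sy u w = 0" "sk z u = 0" "sk u z = 0"
  using assms z sk_flip[of z u 0] sy_flip[of z u 0] sy_flip[of w u 0] by (auto simp: U_def)

lemma hyp_decomp:
  assumes "v \<in> V"
  obtains u where "u \<in> U" "v = sy w v \<odot> z + sy z v \<odot> w + u"
proof
  show "v - sy w v \<odot> z - sy z v \<odot> w \<in> U"
    using assms V z w hyp_base by (auto simp: U_def intro: subspace_diff subspace_scale)
qed simp

text \<open>A vector \<open>x\<close> of \<open>U\<close> left orthogonal to \<open>U\<close> can
  pair with \<open>V\<close> only through \<open>sk x w\<close>. Subtracting that multiple of
  \<open>z\<close> cancels it, because \<open>sy z w = 1\<close>, and the difference is left radical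
  in \<open>V\<close>.\<close>

lemma hyp_nondegenerate: "nondegenerate U"
  unfolding nondegenerate_def
proof (intro ballI impI)
  fix x assume x: "x \<in> U" "\<forall>y\<in>U. f x y = 0"
  define y where "y = x - sk x w \<odot> z"
  have "f y v = 0" if v: "v \<in> V" for v
  proof -
    from v obtain u where u: "u \<in> U" "v = sy w v \<odot> z + sy z v \<odot> w + u" by (rule hyp_decomp)
    have "f y w = 0" "f y z = 0" "f y u = 0"
      using hyp_mem[OF x(1)] hyp_mem[OF u(1)] hyp_base(1-3) x(2) u(1) z w
      by (auto simp: y_def f_eq)
    then show ?thesis by (subst u(2)) simp
  qed
  moreover have "y \<in> V"
    using hyp_mem[OF x(1)] z V by (auto simp: y_def intro: subspace_diff subspace_scale)
  ultimately have "y = 0" using V(2) by (simp add: nondegenerate_def)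
  then have "x = sk x w \<odot> z" by (simp add: y_def)
  moreover from this have "sk x w = 0"
    using hyp_mem(5)[OF x(1)] w(2) by (metis mult.right_neutral sy.scale_left)
  ultimately show "x = 0" by simp
qed

lemma hyp_radical:
  assumes "q \<in> U" "\<forall>u\<in>U. sk q u = 0" "sk w q = 0" "v \<in> V"
  shows "sk q v = 0"
proof -
  from assms(4) obtain u where u: "u \<in> U" "v = sy w v \<odot> z + sy z v \<odot> w + u" by (rule hyp_decomp)
  show ?thesis
    using assms hyp_mem[OF assms(1)] u(1) sk_flip[OF assms(3)] by (subst u(2)) simp
qed

lemma hyp_adjust:
  assumes "subspace U'" "U' \<subseteq> U"
    and "\<And>u. u \<in> U' \<Longrightarrow> (\<forall>v\<in>U'. sk u v = 0) \<Longrightarrow> sk w u = 0"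
  obtains u0 where "u0 \<in> U'" "\<And>u. u \<in> U' \<Longrightarrow> sk (w + u0) u = 0"
proof -
  obtain u0 where u0: "u0 \<in> U'" "\<And>u. u \<in> U' \<Longrightarrow> sk u u0 = sk w u"
    using sk.representable[of U' U' "sk w"] assms sk.linear_functional_right by blast
  then have "sk (w + u0) u = 0" if "u \<in> U'" for u
    using that sk_flip[of u u0 "sk w u"] by simp
  with u0 show thesis using that by blast
qed

text \<open>If \<open>sk w\<close> vanished on the \<open>sk\<close>-radical of \<open>U\<close>,
  some \<open>w + u0\<close> would be \<open>sk\<close>-radical in \<open>V\<close>. Its pairing
  with \<open>z\<close> under \<open>sy\<close> is 1, so \<open>z\<close>, \<open>w + u0\<close> and
  their sum could not all be isotropic, against \<open>iso\<close>.\<close>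

lemma hyp_radical_vector:
  assumes iso: "\<And>x. x \<in> V \<Longrightarrow> \<forall>v\<in>V. sk x v = 0 \<Longrightarrow> sy x x = 0"
  obtains e where "e \<in> U" "\<And>u. u \<in> U \<Longrightarrow> sk e u = 0" "sk w e = 1"
proof -
  have "\<exists>e\<in>U. (\<forall>u\<in>U. sk e u = 0) \<and> sk w e \<noteq> 0"
  proof (rule ccontr)
    assume "\<not> ?thesis"
    then obtain u0 where u0: "u0 \<in> U" "\<And>u. u \<in> U \<Longrightarrow> sk (w + u0) u = 0"
      using hyp_adjust[OF hyp_subspace order_refl] by blast
    define x where "x = w + u0"
    have x: "x \<in> V" using u0 w hyp_mem V by (auto simp: x_def intro: subspace_add)
    have "sk x w = 0"
      using u0(2)[OF u0(1)] sk_flip[of w u0 0] by (simp add: x_def)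
    then have rad: "sk x v = 0" if v: "v \<in> V" for v
    proof -
      from v obtain u where u: "u \<in> U" "v = sy w v \<odot> z + sy z v \<odot> w + u" by (rule hyp_decomp)
      show ?thesis
        using u0(2)[OF u(1)] \<open>sk x w = 0\<close> hyp_base(5)[OF x] by (subst u(2)) (simp add: x_def)
    qed
    have "z + x \<in> V" "\<forall>v\<in>V. sk (z + x) v = 0" "\<forall>v\<in>V. sk x v = 0"
      using x rad z V hyp_base by (auto intro: subspace_add)
    then have "sy x x = 0" "sy (z + x) (z + x) = 0"
      using iso x by blast+
    moreover have "sy z x = 1" "sy x z = 1"
      using w hyp_base(1) hyp_mem[OF u0(1)] by (simp_all add: x_def)
    ultimately show False using z(3) by simp
  qed
  then obtain e where e: "e \<in> U" "\<forall>u\<in>U. sk e u = 0" "sk w e \<noteq> 0" by blast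
  show thesis
  proof
    show "(1 / sk w e) \<odot> e \<in> U" using e hyp_subspace by (simp add: subspace_scale)
  qed (use e in simp_all)
qed

text \<open>The vector \<open>e\<close> has a nonzero square and carries the skew pairing with
  \<open>w\<close>, so \<open>z, e, w\<close> form \<open>G3\<close> up to scaling. By
  \<open>iso\<close> the functional \<open>sk w\<close> kills the \<open>sk\<close>-radical of the
  \<open>sy\<close>-complement of \<open>e\<close> in \<open>U\<close>, hence can be cleared
  there.\<close>

lemma hyp_split_G3:
  assumes e: "e \<in> U" "\<And>u. u \<in> U \<Longrightarrow> sk e u = 0" "sk w e = 1" "sy e e \<noteq> 0"
    and iso: "\<And>q. q \<in> U \<Longrightarrow> \<forall>u\<in>U. sk q u = 0 \<Longrightarrow> sk w q = 0 \<Longrightarrow> sy q e = 0"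
  shows "\<exists>us W. realizes G3 us \<and> splits V us W"
proof -
  define U' where "U' = {u \<in> U. sy e u = 0}"
  have U': "subspace U'" "U' \<subseteq> U"
    by (auto simp: U'_def subspace_kernel hyp_subspace sy.linear_functional_right)
  have rad: "sk w u = 0" if u: "u \<in> U'" "\<forall>v\<in>U'. sk u v = 0" for u
  proof -
    have uU: "u \<in> U" "sy e u = 0" using u by (auto simp: U'_def)
    have "sk u v = 0" if v: "v \<in> U" for v
    proof -
      let ?v = "v - (sy e v / sy e e) \<odot> e"
      have "?v \<in> U'"
        using v e hyp_subspace by (auto simp: U'_def intro: subspace_diff subspace_scale)
      then have "sk u ?v = 0" using u by blast
      then show ?thesis using sk_flip[OF e(2)[OF uU(1)]] by simp
    qed
    then have "sy (u - sk w u \<odot> e) e = 0"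
      using e uU hyp_subspace by (intro iso) (auto intro: subspace_diff subspace_scale)
    then show ?thesis using e(4) sy_flip[OF uU(2)] by simp
  qed
  obtain u0 where u0: "u0 \<in> U'" "\<And>u. u \<in> U' \<Longrightarrow> sk (w + u0) u = 0"
    using hyp_adjust[OF U' rad] by blast
  have u0U: "u0 \<in> U" "sy e u0 = 0" "sy u0 e = 0"
    using u0 sy_flip[of e u0 0] by (auto simp: U'_def)
  \<comment> \<open>The multiple of \<open>z\<close> makes the partner isotropic again after the
    change by \<open>u0\<close>.\<close>
  define w' where "w' = w + u0 - (sy u0 u0 / 2) \<odot> z"
  have eV: "e \<in> V" using hyp_mem e by blast
  have w'V: "w' \<in> V"
    using w z V hyp_mem(1)[OF u0U(1)] by (auto simp: w'_def intro: subspace_add subspace_diff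
      subspace_scale)
  have w': "sy w' w' = 0" "sy z w' = 1" "sy w' z = 1" "sy w' e = 0" "sy e w' = 0"
    "sk w' e = 1" "sk e w' = -1" "sk z w' = 0" "sk w' z = 0"
    using hyp_base(1-3) z w hyp_mem[OF u0U(1)] hyp_mem[OF e(1)] u0U e(2)[OF u0U(1)] e(3)
      sk_flip[OF e(3)] sk_flip[OF e(2)[OF u0U(1)]]
    by (simp_all add: w'_def)
  define \<mu> where "\<mu> = 1 / csqrt (sy e e)"
  have \<mu>: "\<mu> * (\<mu> * sy e e) = 1" "\<mu> \<noteq> 0"
    using e(4) power2_csqrt[of "sy e e"] by (auto simp: \<mu>_def power2_eq_square field_simps)
  define us where "us = [(-\<mu>) \<odot> z, \<mu> \<odot> e, (-(1/\<mu>)) \<odot> w']"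
  have "realizes G3 us"
    using w' \<mu> z hyp_mem[OF e(1)] by (simp add: us_def realizes_def f_eq)
  moreover have "splits V us {v \<in> V. sy z v = 0 \<and> sy w' v = 0 \<and> sy e v = 0}" (is "splits V us ?W")
  proof (rule splitsI)
    show "subspace ?W"
      using subspace_kernel[OF subspace_kernel_two[of V "sy z" "sy w'"], of "sy e"]
      by (simp add: V sy.linear_functional_right conj_assoc)
    show "set us \<subseteq> V" using z eV w'V V by (simp add: us_def subspace_neg subspace_scale)
    show "V \<subseteq> span (set us \<union> ?W)"
    proof
      fix v assume v: "v \<in> V"
      let ?X = "span (set us \<union> ?W)"
      define x where "x = v - sy w' v \<odot> z - sy z v \<odot> w' - (sy e v / sy e e) \<odot> e"
      have "x \<in> ?W"
        using v z eV w'V V w' hyp_mem[OF e(1)] e(4)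
        by (auto simp: x_def intro: subspace_diff subspace_scale)
      have "(-\<mu>) \<odot> z \<in> ?X" "\<mu> \<odot> e \<in> ?X" "(-(1/\<mu>)) \<odot> w' \<in> ?X"
        by (auto simp: us_def intro: span_base)
      then have "(-(1/\<mu>)) \<odot> (-\<mu>) \<odot> z \<in> ?X" "(1/\<mu>) \<odot> \<mu> \<odot> e \<in> ?X" "(-\<mu>) \<odot> (-(1/\<mu>)) \<odot> w' \<in> ?X"
        by (blast intro: span_scale)+
      then have "z \<in> ?X" "e \<in> ?X" "w' \<in> ?X"
        using \<mu>(2) by simp_all
      moreover have "x \<in> ?X" using \<open>x \<in> ?W\<close> by (intro span_base) auto
      ultimately have "x + sy w' v \<odot> z + sy z v \<odot> w' + (sy e v / sy e e) \<odot> e \<in> ?X"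
        by (intro span_add span_scale)
      then show "v \<in> ?X" by (simp add: x_def)
    qed
    fix x v assume x: "x \<in> set us" and v: "v \<in> ?W"
    then have vV: "v \<in> V" "sy z v = 0" "sy v z = 0" "sy w' v = 0" "sy v w' = 0" "sy e v = 0" "sy v e = 0"
      "sk z v = 0" "sk v z = 0"
      using sy_flip[of z v 0] sy_flip[of w' v 0] sy_flip[of e v 0] hyp_base by auto
    from vV(1) obtain u where u: "u \<in> U" "v = sy w v \<odot> z + sy z v \<odot> w + u" by (rule hyp_decomp)
    have "sy e u = 0"
      using vV(2,6) hyp_mem[OF e(1)] by (subst (asm) (2) u(2)) simp
    then have "u \<in> U'" using u by (simp add: U'_def)
    from u0(2)[OF this] have "sk w' u = 0"
      using hyp_mem[OF u(1)] by (simp add: w'_def)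
    then have "sk w' v = 0" "sk e v = 0"
      using vV(2) w' e(2)[OF u(1)] hyp_mem[OF e(1)] by (subst u(2); simp)+
    then show "f x v = 0 \<and> f v x = 0"
      using x vV sk_flip[of w' v 0] sk_flip[of e v 0] by (auto simp: us_def f_eq)
  qed (use V in auto)
  ultimately show ?thesis by blast
qed

text \<open>Now \<open>q\<close> is radical for \<open>sk\<close> in all of \<open>V\<close> and
  pairs with \<open>e\<close>. So \<open>q1, e1\<close> span a second hyperbolic plane of
  \<open>sy\<close>, tied to the first only by \<open>sk w e1 = 1\<close>. Hypothesis
  \<open>iso\<close> removes the obstruction to clearing \<open>sk w\<close> on the rest of
  \<open>U\<close>.\<close>

lemma hyp_split_H4:
  assumes e: "e \<in> U" "\<And>u. u \<in> U \<Longrightarrow> sk e u = 0" "sk w e = 1"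
    and q: "q \<in> U" "\<And>u. u \<in> U \<Longrightarrow> sk q u = 0" "sk w q = 0" "sy q e \<noteq> 0"
    and iso: "\<And>p. p \<in> U \<Longrightarrow> \<forall>u\<in>U. sk p u = 0 \<Longrightarrow> sk w p = 0 \<Longrightarrow> sy p q = 0"
  shows "\<exists>us W. realizes H4 us \<and> splits V us W"
proof -
  have qq: "sy q q = 0" using q iso by blast
  define q1 where "q1 = (1 / sy q e) \<odot> q"
  have q1: "q1 \<in> U" "\<And>u. u \<in> U \<Longrightarrow> sk q1 u = 0" "sk w q1 = 0" "sy q1 e = 1" "sy q1 q1 = 0" "sy e q1 = 1"
    using q qq hyp_subspace sy_commute[of q e] by (auto simp: q1_def subspace_scale)
  define e1 where "e1 = e - (sy e e / 2) \<odot> q1"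
  have e1: "e1 \<in> U" "\<And>u. u \<in> U \<Longrightarrow> sk e1 u = 0" "sk w e1 = 1" "sy q1 e1 = 1" "sy e1 e1 = 0" "sy e1 q1 = 1"
    using e q1 hyp_subspace by (auto simp: e1_def intro: subspace_diff subspace_scale)
  define U' where "U' = {u \<in> U. sy e1 u = 0 \<and> sy q1 u = 0}"
  have U': "subspace U'" "U' \<subseteq> U"
    by (auto simp: U'_def subspace_kernel_two hyp_subspace sy.linear_functional_right)
  have rad: "sk w u = 0" if u: "u \<in> U'" "\<forall>v\<in>U'. sk u v = 0" for u
  proof -
    have uU: "u \<in> U" "sy e1 u = 0" "sy q1 u = 0" using u by (auto simp: U'_def)
    have "sk u v = 0" if v: "v \<in> U" for v
    proof -
      let ?v = "v - sy e1 v \<odot> q1 - sy q1 v \<odot> e1"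
      have "?v \<in> U'"
        using v e1 q1 hyp_subspace by (auto simp: U'_def intro: subspace_diff subspace_scale)
      then have "sk u ?v = 0" using u by blast
      then show ?thesis using sk_flip[OF e1(2)[OF uU(1)]] sk_flip[OF q1(2)[OF uU(1)]] by simp
    qed
    then have "sy (u - sk w u \<odot> e1) q = 0"
      using e1 uU hyp_subspace by (intro iso) (auto intro: subspace_diff subspace_scale)
    then have "sy (u - sk w u \<odot> e1) q1 = 0" by (simp add: q1_def)
    then show ?thesis using e1 sy_flip[OF uU(3)] by simp
  qed
  obtain u0 where u0: "u0 \<in> U'" "\<And>u. u \<in> U' \<Longrightarrow> sk (w + u0) u = 0"
    using hyp_adjust[OF U' rad] by blast
  have u0U: "u0 \<in> U" "sy e1 u0 = 0" "sy u0 e1 = 0" "sy q1 u0 = 0" "sy u0 q1 = 0"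
    using u0 sy_flip[of e1 u0 0] sy_flip[of q1 u0 0] by (auto simp: U'_def)
  define w' where "w' = w + u0 - (sy u0 u0 / 2) \<odot> z"
  have eqV: "e1 \<in> V" "q1 \<in> V" using hyp_mem e1 q1 by blast+
  have w'V: "w' \<in> V"
    using w z V hyp_mem(1)[OF u0U(1)] by (auto simp: w'_def intro: subspace_add subspace_diff
      subspace_scale)
  have w': "sy w' w' = 0" "sy z w' = 1" "sy w' z = 1" "sy w' e1 = 0" "sy e1 w' = 0"
    "sy w' q1 = 0" "sy q1 w' = 0" "sk w' q1 = 0" "sk q1 w' = 0"
    "sk w' e1 = 1" "sk e1 w' = -1" "sk z w' = 0" "sk w' z = 0"
    using hyp_base(1-3) z w hyp_mem[OF u0U(1)] hyp_mem[OF e1(1)] hyp_mem[OF q1(1)] u0U e1(2)[OF u0U(1)]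
      e1(3)
      sk_flip[OF e1(3)] sk_flip[OF e1(2)[OF u0U(1)]] q1(2)[OF u0U(1)] q1(3)
      sk_flip[OF q1(3)] sk_flip[OF q1(2)[OF u0U(1)]]
    by (simp_all add: w'_def)
  define us where "us = [q1, w', z, e1]"
  have "realizes H4 us"
    using w' z hyp_mem[OF e1(1)] hyp_mem[OF q1(1)] e1(4-6) q1(5) q1(2)[OF e1(1)] e1(2)[OF q1(1)]
    by (simp add: us_def realizes_def f_eq)
  moreover have "splits V us {v \<in> {v \<in> V. sy z v = 0 \<and> sy w' v = 0}. sy e1 v = 0 \<and> sy q1 v = 0}"
    (is "splits V us ?W")
  proof (rule splitsI)
    show "subspace ?W"
      by (intro subspace_kernel_two V sy.linear_functional_right)
    show "set us \<subseteq> V" using z eqV w'V V by (simp add: us_def)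
    show "V \<subseteq> span (set us \<union> ?W)"
    proof
      fix v assume v: "v \<in> V"
      let ?X = "span (set us \<union> ?W)"
      define x where "x = v - sy w' v \<odot> z - sy z v \<odot> w' - sy e1 v \<odot> q1 - sy q1 v \<odot> e1"
      have "x \<in> ?W"
        using v z eqV w'V V w' hyp_mem[OF e1(1)] hyp_mem[OF q1(1)] e1(4-6) q1(5)
        by (auto simp: x_def intro!: subspace_diff subspace_scale)
      have "z \<in> ?X" "w' \<in> ?X" "q1 \<in> ?X" "e1 \<in> ?X"
        by (auto simp: us_def intro: span_base)
      moreover have "x \<in> ?X" using \<open>x \<in> ?W\<close> by (intro span_base) auto
      ultimately have "x + sy w' v \<odot> z + sy z v \<odot> w' + sy e1 v \<odot> q1 + sy q1 v \<odot> e1 \<in> ?X"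
        by (intro span_add span_scale)
      then show "v \<in> ?X" by (simp add: x_def)
    qed
    fix x v assume x: "x \<in> set us" and v: "v \<in> ?W"
    then have vV: "v \<in> V" "sy z v = 0" "sy v z = 0" "sy w' v = 0" "sy v w' = 0" "sy e1 v = 0"
      "sy v e1 = 0"
      "sy q1 v = 0" "sy v q1 = 0" "sk z v = 0" "sk v z = 0"
      using sy_flip[of z v 0] sy_flip[of w' v 0] sy_flip[of e1 v 0] sy_flip[of q1 v 0] hyp_base by auto
    from vV(1) obtain u where u: "u \<in> U" "v = sy w v \<odot> z + sy z v \<odot> w + u" by (rule hyp_decomp)
    have "sy e1 u = 0"
      using vV(2,6) hyp_mem[OF e1(1)] by (subst (asm) (2) u(2)) simp
    moreover have "sy q1 u = 0"
      using vV(2,8) hyp_mem[OF q1(1)] by (subst (asm) (2) u(2)) simp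
    ultimately have "u \<in> U'" using u by (simp add: U'_def)
    from u0(2)[OF this] have "sk w' u = 0"
      using hyp_mem[OF u(1)] by (simp add: w'_def)
    then have "sk w' v = 0" "sk e1 v = 0" "sk q1 v = 0"
      using vV(2) w' e1(2)[OF u(1)] hyp_mem[OF e1(1)] q1(2)[OF u(1)] hyp_mem[OF q1(1)]
      by (subst u(2); simp)+
    then show "f x v = 0 \<and> f v x = 0"
      using x vV sk_flip[of w' v 0] sk_flip[of e1 v 0] sk_flip[of q1 v 0] by (auto simp: us_def f_eq)
  qed (use V in auto)
  ultimately show ?thesis by blast
qed

text \<open>The remaining case: the radical of the skew part of \<open>U\<close> is totally isotropic, so the same
  construction applies once more inside \<open>U\<close>. In dimension at most 6 this leaves \<open>\<Gamma>\<^sub>5\<close> and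
  \<open>\<Gamma>\<^sub>3 \<oplus> \<Gamma>\<^sub>3\<close>.\<close>

lemma hyp_split_small:
  assumes dim: "dim V \<le> 6"
    and e: "e \<in> U" "\<And>u. u \<in> U \<Longrightarrow> sk e u = 0" "sk w e = 1"
    and iso: "\<And>x. x \<in> U \<Longrightarrow> \<forall>u\<in>U. sk x u = 0 \<Longrightarrow> sy x x = 0"
    and e1: "e1 \<in> U" "sy e e1 = 1" "sy e1 e1 = 0"
    and U1: "U1 = {u \<in> U. sy e u = 0 \<and> sy e1 u = 0}" "subspace U1" "dim U1 \<le> 2" "nondegenerate U1"
    and U1_decomp: "\<And>u. u \<in> U \<Longrightarrow> \<exists>x\<in>U1. u = sy e1 u \<odot> e + sy e u \<odot> e1 + x"
    and d: "d \<in> U1" "\<And>u. u \<in> U1 \<Longrightarrow> sk d u = 0" "sk e1 d = 1"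
  shows "\<exists>k us W. realizes k us \<and> us \<noteq> [] \<and> splits V us W"
proof -
  have eV: "e \<in> V" "e1 \<in> V" "d \<in> V" and dU: "d \<in> U" using hyp_mem e e1 d U1 by auto
  have U1_mem: "u \<in> U" "u \<in> V" "sy e u = 0" "sy u e = 0" "sy e1 u = 0" "sy u e1 = 0" "sk e u = 0"
    "sk u e = 0"
    if "u \<in> U1" for u
    using that U1(1) e(2)[of u] sk_flip[of e u 0] sy_flip[of e u 0] sy_flip[of e1 u 0] hyp_mem by auto
  have ee: "sy e e = 0" using iso e by blast
  have E: "sy e e1 = 1" "sy e1 e = 1" "sy e1 e1 = 0" "sk e e1 = 0" "sk e1 e = 0"
    using e1 e(2)[OF e1(1)] sy_flip[of e e1] sk_flip[of e e1] by auto
  note D = d(3) sk_flip[OF d(3)] U1_mem[OF d(1)]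
  define b1 b2 where "b1 = sk w e1" and "b2 = sk w d"
  have B: "sk w e1 = b1" "sk e1 w = - b1" "sk w d = b2" "sk d w = - b2" "sk w e = 1" "sk e w = -1"
    using sk_flip[of w e1] sk_flip[of w d] sk_flip[OF e(3)] e(3) by (auto simp: b1_def b2_def)
  note base = hyp_base(1-3) z(3) w(2,3) hyp_mem(2-7)[OF e(1)] hyp_mem(2-7)[OF e1(1)] hyp_mem(2-7)[OF dU]
  show ?thesis
  proof (cases "\<exists>q\<in>U1. q \<noteq> 0 \<and> sk e1 q = 0")
    case False
    \<comment> \<open>No nonzero vector of \<open>U1\<close> is killed by \<open>sk e1\<close>, so
      \<open>U1\<close> is the line of \<open>d\<close>, and five vectors span
      \<open>V\<close>.\<close>
    have U1d: "u = sk e1 u \<odot> d" if "u \<in> U1" for u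
    proof -
      have "u - sk e1 u \<odot> d \<in> U1" using that d U1 by (intro subspace_diff subspace_scale)
      then show ?thesis using False d(3) by force
    qed
    define \<sigma> where "\<sigma> = sy d d"
    have "\<sigma> \<noteq> 0"
    proof
      assume "\<sigma> = 0"
      have "f d u = 0" if "u \<in> U1" for u
        by (subst U1d[OF that]) (use \<open>\<sigma> = 0\<close> in \<open>simp add: \<sigma>_def f_eq\<close>)
      then have "d = 0" using U1(4) d(1) by (auto simp: nondegenerate_def)
      then show False using d(3) by simp
    qed
    define \<rho> where "\<rho> = 1 / csqrt \<sigma>"
    have \<rho>: "\<rho> * (\<rho> * \<sigma>) = 1" "\<rho> \<noteq> 0"
      using \<open>\<sigma> \<noteq> 0\<close> power2_csqrt[of \<sigma>] by (auto simp: \<rho>_def power2_eq_square field_simps)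
    \<comment> \<open>The multiples of \<open>e1\<close> and \<open>d\<close> remove the entries
      \<open>sk w d\<close> and \<open>sk w e1\<close>, and the multiple of \<open>z\<close> keeps
      \<open>w'\<close> isotropic. The corrections of \<open>e\<close> and \<open>d\<close> by
      \<open>z\<close> restore their \<open>sy\<close>-orthogonality to \<open>w'\<close>.\<close>
    define w' where "w' = w - b2 \<odot> e1 + b1 \<odot> d - (b1 * b1 * \<sigma> / 2) \<odot> z"
    define e' where "e' = e + b2 \<odot> z"
    define d' where "d' = d - (b1 * \<sigma>) \<odot> z"
    define us where "us = [\<rho> \<odot> z, (-\<rho>) \<odot> e', \<rho> \<odot> d', (-(1/\<rho>)) \<odot> e1, (1/\<rho>) \<odot> w']"
    have dd: "sy d d = \<sigma>" by (simp add: \<sigma>_def)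
    have sub: "set us \<subseteq> V"
      using z(1) eV w(1) V by (auto simp: us_def w'_def e'_def d'_def intro!: subspace_add subspace_diff
        subspace_scale subspace_neg)
    have "realizes G5 us"
      using \<rho> by (simp add: us_def realizes_def f_eq w'_def e'_def d'_def dd base E D B ee algebra_simps)
    moreover have "dim V \<le> 5"
    proof -
      have "v \<in> span {z, w, e, e1, d}" if v: "v \<in> V" for v
      proof -
        from v obtain u where u: "u \<in> U" "v = sy w v \<odot> z + sy z v \<odot> w + u" by (rule hyp_decomp)
        obtain x where x: "x \<in> U1" "u = sy e1 u \<odot> e + sy e u \<odot> e1 + x" using U1_decomp[OF u(1)] by blast
        have "sy w v \<odot> z + sy z v \<odot> w + (sy e1 u \<odot> e + sy e u \<odot> e1 + sk e1 x \<odot> d) \<in> span {z, w, e, e1, d}"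
          by (intro span_add span_scale span_base) auto
        then show ?thesis using u(2) x(2) U1d[OF x(1)] by metis
      qed
      then have "dim V \<le> card {z, w, e, e1, d}" by (intro dim_le_card) auto
      also have "\<dots> \<le> 5" by (intro card_insert_le_m1) auto
      finally show ?thesis .
    qed
    ultimately show ?thesis
      using splits_all[OF V(1) sub] by (intro exI[of _ G5] exI[of _ us] exI[of _ "{0}"]) (auto
        simp: us_def)
  next
    case True
    then obtain q where q: "q \<in> U1" "q \<noteq> 0" "sk e1 q = 0" by blast
    have "independent {q, d}"
    proof -
      have "d \<noteq> 0" using d(3) by auto
      moreover have "q \<notin> span {d}"
        using q d(3) by (auto simp: span_singleton)
      ultimately show ?thesis by (simp add: independent_insert)
    qed
    moreover have "q \<noteq> d" using q(3) d(3) by auto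
    then have "card {q, d} = 2" by simp
    ultimately have U1_span: "U1 \<subseteq> span {q, d}"
      using U1(3) q(1) d(1) by (intro card_ge_dim_independent) auto
    have qU: "sk q u = 0" if "u \<in> U1" for u
    proof -
      have "sk q d = 0" using sk_flip[OF d(2)[OF q(1)]] by simp
      from that U1_span have "u \<in> span {q, d}" by blast
      then show ?thesis
        by (induction rule: span_induct_alt) (use \<open>sk q d = 0\<close> in auto)
    qed
    have "sk q u = 0" if u: "u \<in> U" for u
    proof -
      obtain x where x: "x \<in> U1" "u = sy e1 u \<odot> e + sy e u \<odot> e1 + x" using U1_decomp[OF u] by blast
      show ?thesis
        using qU[OF x(1)] U1_mem[OF q(1)] sk_flip[OF q(3)] by (subst x(2)) simp
    qed
    then have qq: "sy q q = 0" using iso U1_mem[OF q(1)] by blast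
    have "sy q d \<noteq> 0"
    proof
      assume 0: "sy q d = 0"
      have "f q u = 0" if "u \<in> U1" for u
      proof -
        from that U1_span have "u \<in> span {q, d}" by blast
        then have "sy q u = 0"
          by (induction rule: span_induct_alt) (use qq 0 in auto)
        then show ?thesis using qU[OF that] by (simp add: f_eq)
      qed
      then show False using U1(4) q(1,2) by (auto simp: nondegenerate_def)
    qed
    define q1 where "q1 = (1 / sy q d) \<odot> q"
    define d1 where "d1 = d - (sy d d / 2) \<odot> q1"
    have q1: "q1 \<in> U1" "sk e1 q1 = 0" "sk q1 d = 0" "sy q1 q1 = 0" "sy q1 d = 1" "sy d q1 = 1"
      using q U1(2) qU[OF d(1)] qq \<open>sy q d \<noteq> 0\<close> sy_commute[of q d] by (auto simp: q1_def subspace_scale)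
    have d1: "d1 \<in> U1" "sk e1 d1 = 1" "sk q1 d1 = 0" "sy d1 d1 = 0" "sy q1 d1 = 1"
      using q1 d(1,3) U1(2) by (auto simp: d1_def intro: subspace_diff subspace_scale)
    have Vs: "q1 \<in> V" "d1 \<in> V" using U1_mem q1(1) d1(1) by auto
    define b a1 a2 where "b = sk w q1" and "a1 = sk w e1" and "a2 = sk w d1"
    note flips = sy_flip[OF d1(5)] sk_flip[OF d1(2)] sk_flip[OF d1(3)] sk_flip[OF q1(2)]
    have A: "sk w q1 = b" "sk q1 w = - b" "sk w e1 = a1" "sk e1 w = - a1" "sk w d1 = a2" "sk d1 w = - a2"
      using sk_flip[of w q1] sk_flip[of w e1] sk_flip[of w d1] by (auto simp: b_def a1_def a2_def)
    note facts = A B(5,6) E ee flips q1(2,4) d1(2-5) U1_mem(3-8)[OF q1(1)] U1_mem(3-8)[OF d1(1)]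
      hyp_base(1-3) z(3) w(2,3) hyp_mem(2-7)[OF e(1)] hyp_mem(2-7)[OF e1(1)]
      hyp_mem(2-7)[OF U1_mem(1)[OF q1(1)]] hyp_mem(2-7)[OF U1_mem(1)[OF d1(1)]]
    \<comment> \<open>The three stray entries \<open>a1\<close>, \<open>a2\<close>, \<open>b\<close>
      of \<open>sk w\<close> are removed by changing \<open>w\<close> and \<open>q1\<close>; each
      change that disturbs \<open>sy\<close> is matched by one of the dual vector.\<close>
    define e1' where "e1' = e1 + b \<odot> d1"
    define w' where "w' = w - a2 \<odot> e1' + (a1 + b * a2) \<odot> d1"
    define e' where "e' = e + a2 \<odot> z"
    define q' where "q' = q1 - b \<odot> e - (a1 + b * a2) \<odot> z"
    \<comment> \<open>Now \<open>sy\<close> pairs \<open>z\<close> with \<open>w'\<close>,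
      \<open>e'\<close> with \<open>e1'\<close> and \<open>q'\<close> with \<open>d1\<close>, while
      \<open>sk\<close> only pairs \<open>w'\<close> with \<open>e'\<close> and \<open>e1'\<close>
      with \<open>d1\<close>. Suitable sums and differences decouple this into two triples. The
      middle vector of the second one has square -1, which the factors \<open>\<i>\<close>
      correct.\<close>
    define us where "us = [(1/2) \<odot> z - q', - (e1' + (1/2) \<odot> e'), w' - (1/2) \<odot> d1]"
    define vs where "vs = [(- \<i>) \<odot> (q' + (1/2) \<odot> z), (- \<i>) \<odot> (e1' - (1/2) \<odot> e'), \<i> \<odot> (w' + (1/2) \<odot> d1)]"
    have s: "sy z z = 0" "sy z w' = 1" "sy z e' = 0" "sy z e1' = 0" "sy z q' = 0" "sy z d1 = 0"
      "sy w' w' = 0" "sy w' e' = 0" "sy w' e1' = 0" "sy w' q' = 0" "sy w' d1 = 0"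
      "sy e' e' = 0" "sy e' e1' = 1" "sy e' q' = 0" "sy e' d1 = 0"
      "sy e1' e1' = 0" "sy e1' q' = 0" "sy e1' d1 = 0" "sy q' q' = 0" "sy q' d1 = 1" "sy d1 d1 = 0"
      by (simp_all add: e1'_def w'_def e'_def q'_def facts algebra_simps)
    have k: "sk z w' = 0" "sk z e' = 0" "sk z e1' = 0" "sk z q' = 0" "sk z d1 = 0"
      "sk w' e' = 1" "sk w' e1' = 0" "sk w' q' = 0" "sk w' d1 = 0"
      "sk e' e1' = 0" "sk e' q' = 0" "sk e' d1 = 0"
      "sk e1' q' = 0" "sk e1' d1 = 1" "sk q' d1 = 0"
      by (simp_all add: e1'_def w'_def e'_def q'_def facts algebra_simps)
    note all = s k s[THEN sy_flip] k[THEN sk_flip]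
    have "realizes G3 us" "realizes G3 vs" "orthogonal (set us) (set vs)"
      by (simp_all add: us_def vs_def realizes_def orthogonal_def f_eq all field_simps)
    moreover have "set us \<subseteq> V" "set vs \<subseteq> V"
      using z(1) w(1) eV Vs V(1)
      by (auto simp: us_def vs_def w'_def e'_def q'_def e1'_def intro!: subspace_add subspace_diff
        subspace_scale subspace_neg)
    moreover have "dim V \<le> length us + length vs" using dim by (simp add: us_def vs_def)
    ultimately have "splits V us (span (set vs))"
      by (intro splits_two_blocks[OF V(1)])
    with \<open>realizes G3 us\<close> show ?thesis
      by (intro exI[of _ G3] exI[of _ us] exI[of _ "span (set vs)"]) (simp add: us_def)
  qed
qed

end

lemma split_G1:
  assumes V: "subspace V" and x: "x \<in> V" "\<forall>v\<in>V. sk x v = 0" "sy x x \<noteq> 0"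
  shows "\<exists>us W. realizes G1 us \<and> splits V us W"
proof -
  define y where "y = (1 / csqrt (sy x x)) \<odot> x"
  have y: "y \<in> V" "\<And>v. v \<in> V \<Longrightarrow> sk y v = 0" "sy y y = 1"
    using x V power2_csqrt[of "sy x x"] by (auto simp: y_def subspace_scale power2_eq_square field_simps)
  have "realizes G1 [y]" using y by (simp add: realizes_def f_eq)
  moreover have "splits V [y] {v \<in> V. sy y v = 0}" (is "splits V _ ?W")
  proof (rule splitsI)
    show "V \<subseteq> span (set [y] \<union> ?W)"
    proof
      fix v assume v: "v \<in> V"
      have "v - sy y v \<odot> y \<in> ?W" using v y V by (auto intro: subspace_diff subspace_scale)
      then have "sy y v \<odot> y + (v - sy y v \<odot> y) \<in> span (set [y] \<union> ?W)"
        by (intro span_add span_scale span_base) auto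
      then show "v \<in> span (set [y] \<union> ?W)" by simp
    qed
    fix u w assume "u \<in> set [y]" "w \<in> ?W"
    then show "f u w = 0 \<and> f w u = 0"
      using y(2)[of w] sy_flip[of y w 0] sk_flip[of y w 0] by (auto simp: f_eq)
  qed (use V y in \<open>auto intro: subspace_kernel sy.linear_functional_right\<close>)
  ultimately show ?thesis by blast
qed

text \<open>A radical vector of \<open>sk\<close> that is not isotropic gives \<open>G1\<close>.
  Otherwise that radical is totally isotropic, and the pairing of \<open>e\<close> with it and with
  itself decides between \<open>H4\<close>, \<open>G3\<close> and a second hyperbolic plane inside
  \<open>U\<close>.\<close>

theorem skew_degenerate_splits:
  assumes V: "subspace V" "nondegenerate V" and dim: "dim V \<le> 6"
    and z: "z \<in> V" "z \<noteq> 0" "\<forall>v\<in>V. sk z v = 0"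
  shows "\<exists>k us W. realizes k us \<and> us \<noteq> [] \<and> splits V us W"
proof (cases "\<exists>x\<in>V. (\<forall>v\<in>V. sk x v = 0) \<and> sy x x \<noteq> 0")
  case True
  then obtain us W where us: "realizes G1 us" "splits V us W" using split_G1[OF V(1)] by blast
  then have "us \<noteq> []" by (auto simp: realizes_def)
  then show ?thesis using us by blast
next
  case False
  then have iso: "sy x x = 0" if "x \<in> V" "\<forall>v\<in>V. sk x v = 0" for x using that by blast
  have zz: "sy z z = 0" using iso z by blast
  obtain w where w: "w \<in> V" "sy z w = 1" "sy w w = 0"
    using hyperbolic_partner[OF V z zz] by blast
  define U where "U = {u \<in> V. sy z u = 0 \<and> sy w u = 0}"
  note set_up = V z(1,3) zz w
  note U = hyp_subspace[OF set_up, folded U_def] hyp_dim[OF set_up, folded U_def]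
    hyp_nondegenerate[OF set_up, folded U_def]
  note U_mem = hyp_mem[OF set_up, folded U_def]
  note rad_ext = hyp_radical[OF set_up, folded U_def]
  obtain e where e: "e \<in> U" "\<And>u. u \<in> U \<Longrightarrow> sk e u = 0" "sk w e = 1"
    using hyp_radical_vector[OF set_up, folded U_def] iso by blast
  \<comment> \<open>Polarisation: in a subspace of isotropic vectors any two are orthogonal.\<close>
  have rad_iso: "sy p q = 0"
    if "p \<in> U" "\<forall>u\<in>U. sk p u = 0" "sk w p = 0" "q \<in> U" "\<forall>u\<in>U. sk q u = 0" "sk w q = 0" for p q
  proof -
    have rad: "\<forall>v\<in>V. sk p v = 0" "\<forall>v\<in>V. sk q v = 0" "\<forall>v\<in>V. sk (p + q) v = 0"
      using rad_ext that by auto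
    have mem: "p \<in> V" "q \<in> V" "p + q \<in> V" using that U_mem V by (auto intro: subspace_add)
    have "sy p p = 0" "sy q q = 0" "sy (p + q) (p + q) = 0"
      using iso[OF mem(1) rad(1)] iso[OF mem(2) rad(2)] iso[OF mem(3) rad(3)] by auto
    then show ?thesis using sy_commute[of q p] by simp
  qed
  consider (H4) q where "q \<in> U" "\<And>u. u \<in> U \<Longrightarrow> sk q u = 0" "sk w q = 0" "sy q e \<noteq> 0"
    | (perp) "\<And>q. q \<in> U \<Longrightarrow> \<forall>u\<in>U. sk q u = 0 \<Longrightarrow> sk w q = 0 \<Longrightarrow> sy q e = 0"
    by blast
  then show ?thesis
  proof cases
    case H4
    have q: "\<forall>u\<in>U. sk q u = 0" using H4(2) by blast
    have "\<exists>us W. realizes H4 us \<and> splits V us W"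
      by (rule hyp_split_H4[OF set_up, folded U_def, OF e H4]) (assumption | rule
        rad_iso[OF _ _ _ H4(1) q H4(3)])+
    then obtain us W where us: "realizes H4 us" "splits V us W" by blast
    then have "us \<noteq> []" by (auto simp: realizes_def)
    then show ?thesis using us by blast
  next
    case perp
    show ?thesis
    proof (cases "sy e e = 0")
      case False
      obtain us W where us: "realizes G3 us" "splits V us W"
        using hyp_split_G3[OF set_up, folded U_def, OF e False perp] by blast
      then have "us \<noteq> []" by (auto simp: realizes_def)
      then show ?thesis using us by blast
    next
      case True
      \<comment> \<open>Subtracting \<open>sk w x\<close> times \<open>e\<close> leads into the
        \<open>sk\<close>-radical of \<open>V\<close>, where everything is isotropic and, in this
        case, orthogonal to \<open>e\<close>.\<close>
      have isoU: "sy x x = 0" if x: "x \<in> U" "\<forall>u\<in>U. sk x u = 0" for x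
      proof -
        define y where "y = x - sk w x \<odot> e"
        have y: "y \<in> U" "\<forall>u\<in>U. sk y u = 0" "sk w y = 0"
          using x e U(1) by (auto simp: y_def intro: subspace_diff subspace_scale)
        have "sy y y = 0" "sy y e = 0" using rad_iso[OF y y] perp[OF y] by auto
        moreover have "sy e y = 0" using sy_flip[OF \<open>sy y e = 0\<close>] .
        moreover have "x = y + sk w x \<odot> e" by (simp add: y_def)
        ultimately show ?thesis using True by (metis add.right_neutral mult_zero_right sy.add_left
          sy.add_right sy.scale_left sy.scale_right)
      qed
      have "e \<noteq> 0" using e(3) by auto
      then obtain e1 where e1: "e1 \<in> U" "sy e e1 = 1" "sy e1 e1 = 0"
        using hyperbolic_partner[OF U(1,3) e(1)] e(2) True by blast
      define U1 where "U1 = {u \<in> U. sy e u = 0 \<and> sy e1 u = 0}"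
      have e_left: "\<forall>u\<in>U. sk e u = 0" using e(2) by blast
      note set_up1 = U(1,3) e(1) e_left True e1
      note U1 = hyp_subspace[OF set_up1, folded U1_def] hyp_dim[OF set_up1, folded U1_def]
        hyp_nondegenerate[OF set_up1, folded U1_def]
      obtain d where d: "d \<in> U1" "\<And>u. u \<in> U1 \<Longrightarrow> sk d u = 0" "sk e1 d = 1"
        using hyp_radical_vector[OF set_up1, folded U1_def] isoU by blast
      have dimU1: "dim U1 \<le> 2" using dim U(2) U1(2) by linarith
      have decomp: "\<exists>x\<in>U1. u = sy e1 u \<odot> e + sy e u \<odot> e1 + x" if "u \<in> U" for u
        using hyp_decomp[OF set_up1 that, folded U1_def] by metis
      show ?thesis
        by (rule hyp_split_small[OF set_up dim, folded U_def, OF e isoU e1 U1_def U1(1) dimU1 U1(3) decomp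
          d])
    qed
  qed
qed

section \<open>Degenerate symmetric part\<close>

context
  fixes V s c U
  assumes V: "subspace V"
    and s: "s \<in> V" "\<forall>v\<in>V. sy s v = 0"
    and c: "c \<in> V" "sk s c = 1"
  defines "U \<equiv> {u \<in> V. sk s u = 0 \<and> sk c u = 0}"
begin

lemma symp_subspace: "subspace U"
  by (simp add: U_def subspace_kernel_two V sk.linear_functional_right)

lemma symp_base: "sk c s = -1" "sy s s = 0" "sy s c = 0" "sy c s = 0" "v \<in> V \<Longrightarrow> sy s v = 0"
  "v \<in> V \<Longrightarrow> sy v s = 0"
  using s c sk_flip[OF c(2)] sy_commute[of c s] sy_commute[of v s] by auto

lemma symp_mem:
  assumes "u \<in> U"
  shows "u \<in> V" "sk s u = 0" "sk u s = 0" "sk c u = 0" "sk u c = 0" "sy s u = 0" "sy u s = 0"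
  using assms s sy_flip[of s u 0] sk_flip[of s u 0] sk_flip[of c u 0] by (auto simp: U_def)

lemma symp_decomp:
  assumes "v \<in> V"
  obtains u where "u \<in> U" "v = sk s v \<odot> c - sk c v \<odot> s + u"
proof
  show "v + sk c v \<odot> s - sk s v \<odot> c \<in> U"
    using assms V s c symp_base(1) by (auto simp: U_def intro: subspace_add subspace_diff subspace_scale)
qed simp

lemma symp_dim: "dim V = dim U + 2"
proof -
  have "s \<notin> U" using symp_base(1) by (auto simp: U_def)
  then have sU: "s \<notin> span U" by (metis span_eq_iff symp_subspace)
  have "c \<notin> span (insert s U)"
  proof
    assume "c \<in> span (insert s U)"
    then have "sk s c = 0"
      by (induction rule: span_induct_alt) (auto simp: symp_mem)
    then show False using c by simp
  qed
  then have "dim (insert c (insert s U)) = dim U + 2"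
    using sU by (simp add: dim_insert)
  moreover have "span (insert c (insert s U)) = V"
  proof
    show "span (insert c (insert s U)) \<subseteq> V"
      using V s c symp_mem by (intro span_minimal) auto
    show "V \<subseteq> span (insert c (insert s U))"
    proof
      fix v assume "v \<in> V"
      then obtain u where u: "u \<in> U" "v = sk s v \<odot> c - sk c v \<odot> s + u" by (rule symp_decomp)
      have "sk s v \<odot> c - sk c v \<odot> s + u \<in> span (insert c (insert s U))"
        using u(1) by (intro span_add span_diff span_scale span_base) auto
      then show "v \<in> span (insert c (insert s U))" using u(2) by simp
    qed
  qed
  ultimately show ?thesis by (metis dim_span)
qed

lemma symp_nondegenerate:
  assumes "\<And>x. x \<in> V \<Longrightarrow> \<forall>v\<in>V. sk x v = 0 \<Longrightarrow> x = 0" "x \<in> U" "\<forall>u\<in>U. sk x u = 0"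
  shows "x = 0"
proof (rule assms(1))
  show "x \<in> V" using assms symp_mem by blast
  show "\<forall>v\<in>V. sk x v = 0"
  proof
    fix v assume "v \<in> V"
    then obtain u where u: "u \<in> U" "v = sk s v \<odot> c - sk c v \<odot> s + u" by (rule symp_decomp)
    show "sk x v = 0" using symp_mem[OF assms(2)] u(1) assms(3) by (subst u(2)) simp
  qed
qed

text \<open>The vector \<open>c - u0\<close> is \<open>sy\<close>-orthogonal to \<open>U\<close>, so
  the plane splits off. Its last entry \<open>sy c' c'\<close> is 0 or can be scaled to 1, which
  decides between \<open>H2\<close> and \<open>G2\<close>.\<close>

lemma symp_split_two:
  assumes u0: "u0 \<in> U" "\<And>u. u \<in> U \<Longrightarrow> sy u0 u = sy c u"
  shows "\<exists>k us W. k \<in> {H2, G2} \<and> realizes k us \<and> splits V us W"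
proof -
  define c' where "c' = c - u0"
  have c'V: "c' \<in> V" using u0 symp_mem V c by (auto simp: c'_def intro: subspace_diff)
  have c': "sk s c' = 1" "sk c' s = -1" "sy s c' = 0" "sy c' s = 0"
    using c symp_base symp_mem[OF u0(1)] by (simp_all add: c'_def)
  define \<nu> where "\<nu> = (if sy c' c' = 0 then 1 else csqrt (sy c' c'))"
  have \<nu>: "\<nu> \<noteq> 0" "sy c' c' \<noteq> 0 \<Longrightarrow> \<nu> * \<nu> = sy c' c'"
    using power2_csqrt[of "sy c' c'"] by (auto simp: \<nu>_def power2_eq_square)
  define k where "k = (if sy c' c' = 0 then H2 else G2)"
  define us where "us = [\<nu> \<odot> s, (1 / \<nu>) \<odot> c']"
  have "realizes k us"
    using c' \<nu> symp_base by (auto simp: us_def k_def realizes_def f_eq field_simps)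
  moreover have "splits V us {v \<in> V. sk s v = 0 \<and> sk c' v = 0}" (is "splits V us ?W")
  proof (rule splitsI)
    show "subspace ?W" by (intro subspace_kernel_two V sk.linear_functional_right)
    show "set us \<subseteq> V" using s c'V V by (simp add: us_def subspace_scale)
    show "V \<subseteq> span (set us \<union> ?W)"
    proof
      fix v assume v: "v \<in> V"
      let ?X = "span (set us \<union> ?W)"
      have "v + sk c' v \<odot> s - sk s v \<odot> c' \<in> ?W"
        using v V s c'V c' by (auto intro: subspace_add subspace_diff subspace_scale)
      then have "(sk s v * \<nu>) \<odot> ((1 / \<nu>) \<odot> c') - (sk c' v / \<nu>) \<odot> (\<nu> \<odot> s) + (v + sk c' v \<odot> s - sk s v \<odot> c')
        \<in> ?X"
        by (intro span_add span_diff span_scale span_base) (auto simp: us_def)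
      then show "v \<in> ?X" using \<nu> by simp
    qed
    fix x v assume x: "x \<in> set us" and v: "v \<in> ?W"
    then have "v \<in> V" by simp
    then obtain u where u: "u \<in> U" "v = sk s v \<odot> c - sk c v \<odot> s + u" by (rule symp_decomp)
    have "sy c' u = 0" using u0(2)[OF u(1)] by (simp add: c'_def)
    then have "sy c' v = 0" using v c' by (subst u(2)) simp
    then show "f x v = 0 \<and> f v x = 0"
      using x v symp_base(5,6)[of v] sy_flip[of c' v 0] sk_flip[of c' v 0] sk_flip[of s v 0]
      by (auto simp: us_def f_eq)
  qed (use V in auto)
  ultimately show ?thesis by (intro exI[of _ k] exI[of _ us]) (auto simp: k_def)
qed

context
  fixes c'
  assumes c': "c' \<in> V" "sk s c' = 1"
begin

text \<open>\<open>shift\<close> maps \<open>U\<close> isometrically onto the complement belonging to \<open>c'\<close> in place of \<open>c\<close>.\<close>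

definition shift :: "'a \<Rightarrow> 'a" where "shift u = u + sk c' u \<odot> s"

lemma shift:
  assumes "u \<in> U" "v \<in> U"
  shows "sk (shift u) (shift v) = sk u v" "sy (shift u) (shift v) = sy u v"
    "f (shift u) (shift v) = f u v"
    "sk c' (shift u) = 0" "sk (shift u) c' = 0" "sy c' (shift u) = sy c' u" "sy (shift u) c' = sy c' u"
    "sk s (shift u) = 0" "sk (shift u) s = 0" "sy s (shift u) = 0" "sy (shift u) s = 0" "shift u \<in> V"
  using symp_mem[OF assms(1)] symp_mem[OF assms(2)] c' sk_flip[OF c'(2)] s symp_base(5,6)[OF c'(1)]
    symp_base(2) V
    sk_anti[of u c'] sy_commute[of u c']
  by (auto simp: shift_def f_eq intro: subspace_add subspace_scale)

lemma shift_splits: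
  assumes "splits U us W"
  shows "splits {u \<in> V. sk s u = 0 \<and> sk c' u = 0} (map shift us) (shift ` W)"
proof -
  let ?U = "{u \<in> V. sk s u = 0 \<and> sk c' u = 0}"
  note sub = splits_subsets[OF assms] and W = splits_subspace[OF assms]
  have add: "shift (u + v) = shift u + shift v" and scale: "shift (a \<odot> u) = a \<odot> shift u" for a u v
    by (simp_all add: shift_def scale_left_distrib scale_right_distrib)
  have zero: "shift 0 = 0" by (simp add: shift_def)
  have Wsub: "subspace (shift ` W)"
  proof (rule subspaceI)
    show "0 \<in> shift ` W" using zero subspace_0[OF W] by (metis image_eqI)
    show "x + y \<in> shift ` W" if xy: "x \<in> shift ` W" "y \<in> shift ` W" for x y
    proof -
      obtain x' y' where "x' \<in> W" "y' \<in> W" "x = shift x'" "y = shift y'" using xy by blast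
      then show ?thesis using subspace_add[OF W] add by (metis image_eqI)
    qed
    show "a \<odot> x \<in> shift ` W" if x: "x \<in> shift ` W" for a x
    proof -
      obtain x' where "x' \<in> W" "x = shift x'" using x by blast
      then show ?thesis using subspace_scale[OF W] scale by (metis image_eqI)
    qed
  qed
  show ?thesis
  proof (rule splitsI)
    show "subspace ?U" by (intro subspace_kernel_two V sk.linear_functional_right)
    show "set (map shift us) \<subseteq> ?U" "shift ` W \<subseteq> ?U" using sub shift by auto
    show "?U \<subseteq> span (set (map shift us) \<union> shift ` W)"
    proof
      fix v assume v: "v \<in> ?U"
      then have "v \<in> V" by simp
      then obtain u where u: "u \<in> U" "v = sk s v \<odot> c - sk c v \<odot> s + u" by (rule symp_decomp)
      then have v_eq: "v = u - sk c v \<odot> s" using v by simp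
      have "sk c' u + sk c v = 0"
        using v sk_flip[OF c'(2)] by (subst (asm) v_eq) simp
      then have "v = shift u" using v_eq by (simp add: shift_def eq_neg_iff_add_eq_0[symmetric])
      moreover have "u \<in> span (set us \<union> W)" using u(1) splits_span[OF assms] by simp
      then have "shift u \<in> span (set (map shift us) \<union> shift ` W)"
        by (induction rule: span_induct_alt) (auto simp: zero add scale intro!: span_add span_scale
          intro: span_zero span_base)
      ultimately show "v \<in> span (set (map shift us) \<union> shift ` W)" by simp
    qed
    fix x w assume x: "x \<in> set (map shift us)" and w: "w \<in> shift ` W"
    then obtain x' w' where "x' \<in> set us" "w' \<in> W" "x = shift x'" "w = shift w'" by auto
    then show "f x w = 0 \<and> f w x = 0"
      using shift(3) sub splits_orthogonal[OF assms] by (auto simp: orthogonal_def subset_iff)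
  qed (rule Wsub)
qed

end

end

text \<open>Entered anew with the same data, because the results above are now also applied with
  \<open>c'\<close> in the role of \<open>c\<close>.\<close>

context
  fixes V s c U
  assumes V: "subspace V"
    and s: "s \<in> V" "\<forall>v\<in>V. sy s v = 0"
    and c: "c \<in> V" "sk s c = 1"
  defines "U \<equiv> {u \<in> V. sk s u = 0 \<and> sk c u = 0}"
begin

context
  fixes c'
  assumes c': "c' \<in> V" "sk s c' = 1"
begin

lemma shift_ff: "u \<in> U \<Longrightarrow> v \<in> U \<Longrightarrow> f (shift s c' u) (shift s c' v) = f u v"
  using shift(3)[OF V s c c', folded U_def] .

lemma shift_f:
  assumes "u \<in> U"
  shows "f s (shift s c' u) = 0" "f (shift s c' u) s = 0"
    "f c' (shift s c' u) = sy c' u" "f (shift s c' u) c' = sy c' u"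
  using shift[OF V s c c', folded U_def, OF assms assms] by (simp_all add: f_eq)

lemma shift_base: "f s s = 0" "f s c' = 1" "f c' s = -1" "f c' c' = sy c' c'"
  using symp_base[OF V s c'] c' by (simp_all add: f_eq)

lemma shift_in: "u \<in> U \<Longrightarrow> shift s c' u \<in> V"
  using shift(12)[OF V s c c', folded U_def] .

lemma shift_complement:
  assumes us: "realizes k us" "splits U us W" and 0: "\<And>w. w \<in> W \<Longrightarrow> sy c' w = 0"
  defines "W' \<equiv> shift s c' ` W"
  shows "subspace W'" "W' \<subseteq> V" "dim V = 2 + length us + dim W'"
    "orthogonal (set (s # c' # map (shift s c') us)) W'"
proof -
  note sp = shift_splits[OF V s c c', folded U_def, OF us(2), folded W'_def]
  note sub = splits_subsets[OF us(2)]
  show "subspace W'" by (rule splits_subspace[OF sp])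
  show "W' \<subseteq> V" using splits_subsets[OF sp] by auto
  have "f (us ! i) (us ! j) = f (map (shift s c') us ! i) (map (shift s c') us ! j)"
    if "i < length us" "j < length us" for i j
    using shift_ff[of "us ! i" "us ! j"] sub that by (auto simp: subset_iff)
  then have "map (\<lambda>u. map (f u) (map (shift s c') us)) (map (shift s c') us) = map (\<lambda>u. map (f u) us) us"
    by (intro nth_equalityI) auto
  then have "realizes k (map (shift s c') us)" using us(1) by (simp only: realizes_def)
  then have "dim {u \<in> V. sk s u = 0 \<and> sk c' u = 0} = length us + dim W'"
    using splits_dim[OF sp] realizes_gram_regular by fastforce
  then show "dim V = 2 + length us + dim W'"
    using symp_dim[OF V s c'] by simp
  show "orthogonal (set (s # c' # map (shift s c') us)) W'"
    using splits_orthogonal[OF sp] 0 sub shift_f by (auto simp: orthogonal_def W'_def)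
qed

end

text \<open>As \<open>y1\<close> is \<open>sy\<close>-radical in its block, the value
  \<open>sy c y1\<close> cannot be cleared; it joins plane and block to a \<open>G4\<close>. The
  other values can be cleared, because \<open>y2\<close> has square 1 and \<open>w0\<close>
  represents \<open>sy c\<close> on \<open>W\<close>.\<close>

lemma symp_extend_G2:
  assumes y: "realizes G2 [y1, y2]" "splits U [y1, y2] W"
    and w0: "w0 \<in> W" "\<And>w. w \<in> W \<Longrightarrow> sy w0 w = sy c w" and a: "sy c y1 \<noteq> 0"
  shows "\<exists>us W'. realizes G4 us \<and> splits V us W'"
proof -
  note sub = splits_subsets[OF y(2)]
  have yU: "y1 \<in> U" "y2 \<in> U" and WU: "W \<subseteq> U" using sub by auto
  have F: "f y1 y1 = 0" "f y1 y2 = 1" "f y2 y1 = -1" "f y2 y2 = 1"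
    using y(1) by (auto simp: realizes_def)
  then have S: "sy y1 y1 = 0" "sy y1 y2 = 0" "sy y2 y1 = 0" "sy y2 y2 = 1" by (simp_all add: sy_def)
  have O: "sy y1 w = 0" "sy y2 w = 0" "sy w y1 = 0" "sy w y2 = 0" if "w \<in> W" for w
    using splits_orthogonal[OF y(2)] that by (auto simp: orthogonal_def sy_def)
  define c1 where "c1 = c - sy c y2 \<odot> y2 - w0"
  \<comment> \<open>\<open>y1\<close> is isotropic and pairs with \<open>c1\<close>, so this
    multiple of it makes \<open>c'\<close> isotropic.\<close>
  define c' where "c' = c1 - (sy c1 c1 / (2 * sy c y1)) \<odot> y1"
  have c1: "sy c1 y1 = sy c y1" "sy c1 y2 = 0" "sy y1 c1 = sy c y1" "\<And>w. w \<in> W \<Longrightarrow> sy c1 w = 0"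
    using w0 O S O[OF w0(1)] sy_commute[of y1 c] by (auto simp: c1_def)
  have c'h: "sy c' y1 = sy c y1" "sy c' y2 = 0" "\<And>w. w \<in> W \<Longrightarrow> sy c' w = 0" "sy c' c' = 0"
    using c1 S O a by (auto simp: c'_def field_simps)
  have UV: "U \<subseteq> V" by (auto simp: U_def)
  have c'V: "c' \<in> V" using c(1) yU w0(1) WU UV V
    by (auto simp: c'_def c1_def intro!: subspace_diff subspace_scale)
  have c's: "sk s c' = 1"
    using c(2) symp_mem(2)[OF V s c, folded U_def] yU w0(1) WU by (auto simp: c'_def c1_def)
  note sh = shift_ff[OF c'V c's] shift_f[OF c'V c's] shift_base[OF c'V c's] shift_in[OF c'V c's]
    and comp = shift_complement[OF c'V c's y c'h(3)]
  let ?sh = "shift s c'"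
  define us where "us = [sy c y1 \<odot> s, ?sh y1, ?sh y2, (1 / sy c y1) \<odot> c']"
  have "realizes G4 us"
    using a by (simp add: us_def realizes_def sh yU F c'h)
  moreover have "splits V us (?sh ` W)"
  proof (rule splits_of_dim[OF V comp(1) _ comp(2) \<open>realizes G4 us\<close>])
    show "set us \<subseteq> V" using s(1) c'V sh(10) yU V by (auto simp: us_def intro: subspace_scale)
    show "orthogonal (set us) (?sh ` W)" using comp(4) by (auto simp: us_def orthogonal_def)
    show "dim V \<le> length us + dim (?sh ` W)" using comp(3) by (simp add: us_def)
  qed
  ultimately show ?thesis by blast
qed

text \<open>On \<open>s, y1, y2, c'\<close> the only nonzero pairing of \<open>sy\<close> is that of
  \<open>y1\<close> with \<open>c'\<close>. Diagonalising this hyperbolic pair breaks the four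
  vectors into two copies of \<open>G2\<close>, so no new block arises.\<close>

lemma symp_extend_H2:
  assumes y: "realizes H2 [y1, y2]" "splits U [y1, y2] W"
    and w0: "w0 \<in> W" "\<And>w. w \<in> W \<Longrightarrow> sy w0 w = sy c w" and a: "sy c y1 \<noteq> 0" "sy c y2 = 0"
  shows "\<exists>us W'. realizes G2 us \<and> splits V us W'"
proof -
  note sub = splits_subsets[OF y(2)]
  have yU: "y1 \<in> U" "y2 \<in> U" and WU: "W \<subseteq> U" using sub by auto
  have F: "f y1 y1 = 0" "f y1 y2 = 1" "f y2 y1 = -1" "f y2 y2 = 0"
    using y(1) by (auto simp: realizes_def)
  then have S: "sy y1 y1 = 0" "sy y1 y2 = 0" "sy y2 y1 = 0" "sy y2 y2 = 0" by (simp_all add: sy_def)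
  have O: "sy y1 w = 0" "sy y2 w = 0" "sy w y1 = 0" "sy w y2 = 0" if "w \<in> W" for w
    using splits_orthogonal[OF y(2)] that by (auto simp: orthogonal_def sy_def)
  define c1 where "c1 = c - w0"
  define c' where "c' = c1 - (sy c1 c1 / (2 * sy c y1)) \<odot> y1"
  have c1: "sy c1 y1 = sy c y1" "sy c1 y2 = 0" "sy y1 c1 = sy c y1" "\<And>w. w \<in> W \<Longrightarrow> sy c1 w = 0"
    using w0 O S O[OF w0(1)] sy_commute[of y1 c] a by (auto simp: c1_def)
  have c'h: "sy c' y1 = sy c y1" "sy c' y2 = 0" "\<And>w. w \<in> W \<Longrightarrow> sy c' w = 0" "sy c' c' = 0"
    using c1 S O a by (auto simp: c'_def field_simps)
  have UV: "U \<subseteq> V" by (auto simp: U_def)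
  have c'V: "c' \<in> V" using c(1) yU w0(1) WU UV V
    by (auto simp: c'_def c1_def intro!: subspace_diff subspace_scale)
  have c's: "sk s c' = 1"
    using c(2) symp_mem(2)[OF V s c, folded U_def] yU w0(1) WU by (auto simp: c'_def c1_def)
  note sh = shift_ff[OF c'V c's] shift_f[OF c'V c's] shift_base[OF c'V c's] shift_in[OF c'V c's]
    and comp = shift_complement[OF c'V c's y c'h(3)]
  let ?sh = "shift s c'"
  define S' where "S' = sy c y1 \<odot> s"
  define C' where "C' = (1 / sy c y1) \<odot> c'"
  \<comment> \<open>The second vectors of the two pairs have squares 1 and -1 before scaling; the
    factor \<open>\<i>\<close> corrects the sign, and \<open>-\<i>\<close> on its partner preserves
    their skew pairing.\<close>
  define us where "us = [(1/2) \<odot> S' - ?sh y2, C' + (1/2) \<odot> ?sh y1]"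
  define vs where "vs = [(- \<i>) \<odot> ((1/2) \<odot> S' + ?sh y2), \<i> \<odot> (C' - (1/2) \<odot> ?sh y1)]"
  have usvs: "realizes G2 us" "realizes G2 vs" "orthogonal (set us) (set vs)"
    using a by (simp_all add: us_def vs_def realizes_def orthogonal_def S'_def C'_def sh yU F c'h
      field_simps)
  define W' where "W' = span (set vs \<union> ?sh ` W)"
  have sub: "set us \<subseteq> V" "set vs \<subseteq> V"
    using s(1) c'V sh(10) yU V
    by (auto simp: us_def vs_def S'_def C'_def intro!: subspace_add subspace_diff subspace_scale
      subspace_neg)
  have orth: "orthogonal (set us) (?sh ` W)" "orthogonal (set vs) (?sh ` W)"
    using comp(4) by (auto simp: us_def vs_def S'_def C'_def orthogonal_def)
  have "splits W' vs (?sh ` W)"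
    using comp(1) orth by (simp add: splits_def W'_def)
  then have "dim W' = 2 + dim (?sh ` W)"
    using splits_dim[OF _ realizes_gram_regular[OF usvs(2)]] by (simp add: vs_def)
  have "splits V us W'"
  proof (rule splits_of_dim[OF V _ sub(1) _ usvs(1)])
    show "subspace W'" by (simp add: W'_def)
    show "W' \<subseteq> V" unfolding W'_def using sub comp(2) V by (intro span_minimal) auto
    have "orthogonal (set vs \<union> ?sh ` W) (set us)"
      using usvs(3) orth by (auto simp: orthogonal_def)
    then show "orthogonal (set us) W'"
      unfolding W'_def by (metis orthogonal_span orthogonal_sym)
    show "dim V \<le> length us + dim W'" using comp(3) \<open>dim W' = _\<close> by (simp add: us_def)
  qed
  then show ?thesis using usvs by blast
qed

text \<open>The radical of \<open>sy\<close> on \<open>G4\<close> is the line of \<open>y1\<close>,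
  so every value of \<open>sy c\<close> except the one at \<open>y1\<close> can be cleared. That
  value lengthens the block by \<open>s\<close> in front and \<open>c'\<close> at the end, and the
  six vectors exhaust \<open>V\<close>.\<close>

lemma symp_full_G4:
  assumes y: "realizes G4 [y1, y2, y3, y4]" "{y1, y2, y3, y4} \<subseteq> U"
    and a: "sy c y1 \<noteq> 0" and dim: "dim V \<le> 6"
  shows "\<exists>us W'. realizes G6 us \<and> splits V us W'"
proof -
  have yU: "y1 \<in> U" "y2 \<in> U" "y3 \<in> U" "y4 \<in> U" using y(2) by auto
  have F: "f y1 y1 = 0" "f y1 y2 = 0" "f y1 y3 = 0" "f y1 y4 = 1"
    "f y2 y1 = 0" "f y2 y2 = 0" "f y2 y3 = 1" "f y2 y4 = 1"
    "f y3 y1 = 0" "f y3 y2 = -1" "f y3 y3 = 1" "f y3 y4 = 0"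
    "f y4 y1 = -1" "f y4 y2 = 1" "f y4 y3 = 0" "f y4 y4 = 0"
    using y(1) by (auto simp: realizes_def)
  then have S: "sy y1 y1 = 0" "sy y1 y2 = 0" "sy y1 y3 = 0" "sy y1 y4 = 0"
    "sy y2 y1 = 0" "sy y2 y2 = 0" "sy y2 y3 = 0" "sy y2 y4 = 1"
    "sy y3 y1 = 0" "sy y3 y2 = 0" "sy y3 y3 = 1" "sy y3 y4 = 0"
    "sy y4 y1 = 0" "sy y4 y2 = 1" "sy y4 y3 = 0" "sy y4 y4 = 0" by (simp_all add: sy_def)
  \<comment> \<open>Under \<open>sy\<close> the vectors \<open>y2\<close> and \<open>y4\<close> are
    dual and \<open>y3\<close> is dual to itself, hence the crossed coefficients.\<close>
  define c1 where "c1 = c - sy c y4 \<odot> y2 - sy c y3 \<odot> y3 - sy c y2 \<odot> y4"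
  define c' where "c' = c1 - (sy c1 c1 / (2 * sy c y1)) \<odot> y1"
  have c1: "sy c1 y1 = sy c y1" "sy c1 y2 = 0" "sy c1 y3 = 0" "sy c1 y4 = 0" "sy y1 c1 = sy c y1"
    using S sy_commute[of y1 c] by (auto simp: c1_def)
  have c'h: "sy c' y1 = sy c y1" "sy c' y2 = 0" "sy c' y3 = 0" "sy c' y4 = 0" "sy c' c' = 0"
    using c1 S a by (auto simp: c'_def field_simps)
  have UV: "U \<subseteq> V" by (auto simp: U_def)
  have c'V: "c' \<in> V" using c(1) yU UV V
    by (auto simp: c'_def c1_def intro!: subspace_diff subspace_scale)
  have c's: "sk s c' = 1"
    using c(2) symp_mem(2)[OF V s c, folded U_def] yU by (auto simp: c'_def c1_def)
  note sh = shift_ff[OF c'V c's] shift_f[OF c'V c's] shift_base[OF c'V c's] shift_in[OF c'V c's]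
  let ?sh = "shift s c'"
  define us where "us = [sy c y1 \<odot> s, ?sh y1, ?sh y2, ?sh y3, ?sh y4, (1 / sy c y1) \<odot> c']"
  have "realizes G6 us"
    using a by (simp add: us_def realizes_def sh yU F c'h)
  moreover have "set us \<subseteq> V" using s(1) c'V sh(10) yU V by (auto simp: us_def intro: subspace_scale)
  ultimately show ?thesis
    using splits_all[OF V, of us G6] dim by (auto simp: us_def)
qed

text \<open>Simultaneous rotations of two \<open>G2\<close> blocks act on the pair of values
  \<open>sy c y1\<close>, \<open>sy c y3\<close> by complex orthogonal maps. A nonzero isotropic
  pair can never be rotated to one with a zero entry, and this is where \<open>H6\<close> comes
  from.\<close>

lemma symp_full_H6:
  assumes y: "realizes G2 [y1, y2]" "realizes G2 [y3, y4]" "orthogonal {y1, y2} {y3, y4}"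
      "{y1, y2, y3, y4} \<subseteq> U"
    and a: "sy c y1 \<noteq> 0" "sy c y1 * sy c y1 + sy c y3 * sy c y3 = 0" and dim: "dim V \<le> 6"
  shows "\<exists>us W'. realizes H6 us \<and> splits V us W'"
proof -
  have yU: "y1 \<in> U" "y2 \<in> U" "y3 \<in> U" "y4 \<in> U" using y(4) by auto
  have F: "f y1 y1 = 0" "f y1 y2 = 1" "f y2 y1 = -1" "f y2 y2 = 1"
    "f y3 y3 = 0" "f y3 y4 = 1" "f y4 y3 = -1" "f y4 y4 = 1"
    "f y1 y3 = 0" "f y1 y4 = 0" "f y2 y3 = 0" "f y2 y4 = 0"
    "f y3 y1 = 0" "f y4 y1 = 0" "f y3 y2 = 0" "f y4 y2 = 0"
    using y(1-3) by (auto simp: realizes_def orthogonal_def)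
  then have S: "sy y1 y1 = 0" "sy y1 y2 = 0" "sy y2 y1 = 0" "sy y2 y2 = 1"
    "sy y3 y3 = 0" "sy y3 y4 = 0" "sy y4 y3 = 0" "sy y4 y4 = 1"
    "sy y1 y3 = 0" "sy y1 y4 = 0" "sy y2 y3 = 0" "sy y2 y4 = 0"
    "sy y3 y1 = 0" "sy y4 y1 = 0" "sy y3 y2 = 0" "sy y4 y2 = 0" by (simp_all add: sy_def)
  define a where "a = sy c y1"
  define \<iota> where "\<iota> = - (sy c y3 / a)"
  have a0: "a \<noteq> 0" and \<iota>: "\<iota> * \<iota> = -1" "sy c y3 = - (\<iota> * a)"
    using a by (auto simp: a_def \<iota>_def field_simps add_eq_0_iff)
  have \<iota>': "\<iota> * (\<iota> * x) = - x" for x using \<iota>(1) by (metis mult.assoc mult_minus1)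
  \<comment> \<open>With \<open>\<iota>\<close> the square root of -1 that fits the isotropic pair,
    these are the isotropic directions of the rotations; on them \<open>sy c'\<close> is nonzero
    only at \<open>x2\<close>.\<close>
  define x2 where "x2 = y1 + \<iota> \<odot> y3"
  define x3 where "x3 = y2 + \<iota> \<odot> y4"
  define x4 where "x4 = (- 1/2) \<odot> (y1 - \<iota> \<odot> y3)"
  define x5 where "x5 = (1/2) \<odot> (y2 - \<iota> \<odot> y4)"
  have xU: "x2 \<in> U" "x3 \<in> U" "x4 \<in> U" "x5 \<in> U"
    using yU symp_subspace[OF V s c, folded U_def]
    by (auto simp: x2_def x3_def x4_def x5_def intro!: subspace_add subspace_diff subspace_scale
      subspace_neg)
  define c1 where "c1 = c - sy c y2 \<odot> y2 - sy c y4 \<odot> y4"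
  define c' where "c' = c1 - (sy c1 c1 / (4 * a)) \<odot> x2"
  have c1: "sy c1 y1 = a" "sy c1 y2 = 0" "sy c1 y3 = - (\<iota> * a)" "sy c1 y4 = 0" "sy c1 x2 = 2 * a"
    "sy x2 c1 = 2 * a"
    using S \<iota>' \<iota> sy_commute[of x2 c1] by (auto simp: c1_def a_def[symmetric] x2_def)
  have X: "sy x2 x2 = 0" "sy x2 y1 = 0" "sy x2 y2 = 0" "sy x2 y3 = 0" "sy x2 y4 = 0"
    using S by (simp_all add: x2_def)
  have c'h: "sy c' y1 = a" "sy c' y2 = 0" "sy c' y3 = - (\<iota> * a)" "sy c' y4 = 0" "sy c' c' = 0"
    using c1 X a0 by (auto simp: c'_def field_simps)
  have c'x: "sy c' x2 = 2 * a" "sy c' x3 = 0" "sy c' x4 = 0" "sy c' x5 = 0"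
    using c'h \<iota>' by (auto simp: x2_def x3_def x4_def x5_def)
  have UV: "U \<subseteq> V" by (auto simp: U_def)
  have c'V: "c' \<in> V" using c(1) yU xU UV V
    by (auto simp: c'_def c1_def intro!: subspace_diff subspace_scale)
  have c's: "sk s c' = 1"
    using c(2) symp_mem(2)[OF V s c, folded U_def] yU xU by (auto simp: c'_def c1_def)
  have FX: "f x2 x2 = 0" "f x2 x3 = 0" "f x2 x4 = 0" "f x2 x5 = 1"
     "f x3 x2 = 0" "f x3 x3 = 0" "f x3 x4 = 1" "f x3 x5 = 1"
     "f x4 x2 = 0" "f x4 x3 = -1" "f x4 x4 = 0" "f x4 x5 = 0"
     "f x5 x2 = -1" "f x5 x3 = 1" "f x5 x4 = 0" "f x5 x5 = 0"
    by (simp_all add: x2_def x3_def x4_def x5_def F \<iota>' \<iota>(1) field_simps)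
  note sh = shift_ff[OF c'V c's] shift_f[OF c'V c's] shift_base[OF c'V c's] shift_in[OF c'V c's]
  let ?sh = "shift s c'"
  define us where "us = [(2 * a) \<odot> s, ?sh x2, ?sh x3, ?sh x4, ?sh x5, (1 / (2 * a)) \<odot> c']"
  have "realizes H6 us"
    using a0 by (simp add: us_def realizes_def sh xU FX c'x c'h(5))
  moreover have "set us \<subseteq> V" using s(1) c'V sh(10) xU V by (auto simp: us_def intro: subspace_scale)
  ultimately show ?thesis
    using splits_all[OF V, of us H6] dim by (auto simp: us_def)
qed

end

text \<open>If \<open>sy c\<close> is not representable on \<open>U\<close>, then \<open>sy\<close>
  has a radical vector there and \<open>U\<close> splits off a block by induction. As
  \<open>dim U \<le> 4\<close>, this is \<open>G4\<close>, or one of \<open>H2\<close> and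
  \<open>G2\<close>, possibly with another such block beside it. The cases differ in which values of
  \<open>sy c\<close> can be cleared.\<close>

theorem sym_degenerate_splits:
  assumes "subspace V" "\<And>x. x \<in> V \<Longrightarrow> \<forall>v\<in>V. sk x v = 0 \<Longrightarrow> x = 0" "dim V \<le> 6"
    and "s \<in> V" "s \<noteq> 0" "\<forall>v\<in>V. sy s v = 0"
  shows "\<exists>k us W. k \<in> {H2, G2, G4, G6, H6} \<and> realizes k us \<and> splits V us W"
  using assms
proof (induction "dim V" arbitrary: V s rule: less_induct)
  case less
  note V = less.prems(1) and ndg = less.prems(2) and dimV = less.prems(3) and s = less.prems(4,6)
  obtain y where y: "y \<in> V" "sk s y \<noteq> 0" using ndg s(1) less.prems(5) by blast
  define c where "c = (1 / sk s y) \<odot> y"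
  have c: "c \<in> V" "sk s c = 1" using y V by (auto simp: c_def subspace_scale)
  define U where "U = {u \<in> V. sk s u = 0 \<and> sk c u = 0}"
  note set_up = V s c
  note U = symp_subspace[OF set_up, folded U_def] symp_dim[OF set_up, folded U_def]
  have U_ndg: "x = 0" if "x \<in> U" "\<forall>u\<in>U. sk x u = 0" for x
    using symp_nondegenerate[OF set_up, folded U_def, of x] ndg that by blast
  let ?P = "\<exists>k us W. k \<in> {H2, G2, G4, G6, H6} \<and> realizes k us \<and> splits V us W"
  have dimU: "dim U \<le> 4" using U(2) dimV by simp
  show ?case
  proof (cases "\<exists>u0\<in>U. \<forall>u\<in>U. sy u0 u = sy c u")
    case True
    then obtain u0 where u0: "u0 \<in> U" "\<And>u. u \<in> U \<Longrightarrow> sy u0 u = sy c u" by blast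
    show ?thesis using symp_split_two[OF set_up, folded U_def, OF u0] by blast
  next
    case nonrep: False
    have rep_span: False
      if "u0 \<in> U" "U = span A" "\<And>x. x \<in> A \<Longrightarrow> sy u0 x = sy c x" for u0 A
    proof -
      have "sy u0 x = sy c x" if "x \<in> span A" for x
        using that by (induction rule: span_induct_alt) (use \<open>\<And>x. x \<in> A \<Longrightarrow> sy u0 x = sy c x\<close> in auto)
      then show False using nonrep that by blast
    qed
    \<comment> \<open>The obstruction now sits in the plane of \<open>y1, y2\<close>. In
      \<open>G2\<close> only \<open>y1\<close> is \<open>sy\<close>-radical; in \<open>H2\<close>
      both vectors are, and a change of basis makes \<open>sy c\<close> vanish on the second
      one.\<close>
    have two_ext: ?P if k: "k \<in> {H2, G2}" "realizes k [y1, y2]" "splits U [y1, y2] W"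
      and w0: "w0 \<in> W" "\<And>w. w \<in> W \<Longrightarrow> sy w0 w = sy c w" for k y1 y2 W w0
    proof -
      note sub = splits_subsets[OF k(3)] and Uspan = splits_span[OF k(3)]
      have O: "sy y1 w = 0" "sy y2 w = 0" "sy w y1 = 0" "sy w y2 = 0"
        "f y1 w = 0" "f y2 w = 0" "f w y1 = 0" "f w y2 = 0" if "w \<in> W" for w
        using splits_orthogonal[OF k(3)] that by (auto simp: orthogonal_def sy_def)
      have rep: False if u: "u \<in> span {y1, y2}" "sy u y1 = sy c y1" "sy u y2 = sy c y2" for u
      proof -
        obtain a b where ab: "u = a \<odot> y1 + b \<odot> y2" using u(1) by (rule span_pairE)
        have "u + w0 \<in> U" using ab sub w0(1) U(1) by (auto intro!: subspace_add subspace_scale)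
        then show False
          by (rule rep_span[OF _ Uspan]) (use u w0 O O[OF w0(1)] ab in auto)
      qed
      show ?P
      proof (cases "k = G2")
        case True
        then have F: "f y1 y1 = 0" "f y1 y2 = 1" "f y2 y1 = -1" "f y2 y2 = 1"
          using k(2) by (auto simp: realizes_def)
        have "sy c y1 \<noteq> 0"
        proof
          assume "sy c y1 = 0"
          then show False
            by (intro rep[of "sy c y2 \<odot> y2"]) (auto simp: sy_def F intro: span_scale span_base)
        qed
        then show ?P
          using symp_extend_G2[OF set_up, folded U_def, OF _ k(3) w0] k(2) True by blast
      next
        case False
        then have H: "realizes H2 [y1, y2]" using k by auto
        then have F: "f y1 y1 = 0" "f y1 y2 = 1" "f y2 y1 = -1" "f y2 y2 = 0"
          by (auto simp: realizes_def)
        have dims: "dim U \<le> 2 + dim W"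
          using splits_dim[OF k(3) realizes_gram_regular[OF k(2)]] by simp
        have W: "subspace W" by (rule splits_subspace[OF k(3)])
        have basis: "splits U [z1, z2] W" if "realizes H2 [z1, z2]" "z1 \<in> span {y1, y2}"
          "z2 \<in> span {y1, y2}" for z1 z2
        proof -
          from that(2,3) obtain a1 b1 a2 b2 where z: "z1 = a1 \<odot> y1 + b1 \<odot> y2" "z2 = a2 \<odot> y1 + b2 \<odot> y2"
            using span_pairE by metis
          show ?thesis
          proof (rule splits_of_dim[OF U(1) W _ _ that(1)])
            show "set [z1, z2] \<subseteq> U" using z sub U(1) by (auto intro!: subspace_add subspace_scale)
            show "orthogonal (set [z1, z2]) W" using O z by (auto simp: orthogonal_def)
          qed (use sub dims in auto)
        qed
        show ?P
        proof (cases "sy c y1 = 0")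
          case c1: True
          have c2: "sy c y2 \<noteq> 0"
            using rep[of 0] c1 by (auto simp: span_zero)
          have "realizes H2 [y2, - y1]" using F by (simp add: realizes_def)
          moreover from this have "splits U [y2, - y1] W"
            by (rule basis) (auto intro: span_base span_neg)
          ultimately show ?P
            using symp_extend_H2[OF set_up, folded U_def, OF _ _ w0, of y2 "- y1"] c1 c2 by force
        next
          case c1: False
          define z2 where "z2 = y2 - (sy c y2 / sy c y1) \<odot> y1"
          have "realizes H2 [y1, z2]" using F by (simp add: realizes_def z2_def)
          moreover from this have "splits U [y1, z2] W"
            by (rule basis) (auto simp: z2_def intro: span_base span_diff span_scale)
          moreover have "sy c z2 = 0" using c1 by (simp add: z2_def)
          ultimately show ?P
            using symp_extend_H2[OF set_up, folded U_def, OF _ _ w0, of y1 z2] c1 by blast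
        qed
      qed
    qed
    have two': ?P if "k \<in> {H2, G2}" "l \<in> {H2, G2}" "realizes k [y1, y2]" "realizes l [y3, y4]"
      "orthogonal {y1, y2} {y3, y4}" "{y1, y2, y3, y4} \<subseteq> U"
      "w0 \<in> span {y3, y4}" "sy w0 y3 = sy c y3" "sy w0 y4 = sy c y4" for k l y1 y2 y3 y4 w0
    proof -
      have sp: "splits U [y1, y2] (span (set [y3, y4]))"
        by (rule splits_two_blocks[OF U(1) _ _ that(3,4)]) (use that dimU in auto)
      note w0 = that(7-9)
      have "sy w0 w = sy c w" if "w \<in> span (set [y3, y4])" for w
        using that by (induction rule: span_induct_alt) (use w0 in auto)
      then show ?P using two_ext[OF that(1,3) sp, of w0] that(7) by simp
    qed
    have pair: ?P if "k \<in> {H2, G2}" "realizes k [y1, y2]" "realizes H2 [y3, y4]"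
      "orthogonal {y1, y2} {y3, y4}" "{y1, y2, y3, y4} \<subseteq> U" "sy c y1 \<noteq> 0" for k y1 y2 y3 y4
    proof -
      \<comment> \<open>Shears along the \<open>sy\<close>-radical vector \<open>y1\<close> clear
        \<open>sy c\<close> on the \<open>H2\<close> block; \<open>z2\<close> is adjusted so that
        the two blocks stay orthogonal.\<close>
      define z2 where "z2 = y2 - (sy c y4 / sy c y1) \<odot> y3 + (sy c y3 / sy c y1) \<odot> y4"
      define z3 where "z3 = y3 - (sy c y3 / sy c y1) \<odot> y1"
      define z4 where "z4 = y4 - (sy c y4 / sy c y1) \<odot> y1"
      have F: "f y1 y1 = 0" "f y1 y2 = 1" "f y2 y1 = -1" 
        using that(1,2) by (auto simp: realizes_def)
      have F': "f y3 y3 = 0" "f y3 y4 = 1" "f y4 y3 = -1" "f y4 y4 = 0"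
        using that(3) by (auto simp: realizes_def)
      have O: "f x y = 0" "f y x = 0" if "x \<in> {y1, y2}" "y \<in> {y3, y4}" for x y
        using \<open>orthogonal {y1, y2} {y3, y4}\<close> that by (auto simp: orthogonal_def)
      have z: "realizes k [y1, z2]" "realizes H2 [z3, z4]" "orthogonal {y1, z2} {z3, z4}"
        using that(2) by (auto simp: realizes_def orthogonal_def z2_def z3_def z4_def F F' O)
      have "{y1, z2, z3, z4} \<subseteq> U"
        using that(5) U(1) by (auto simp: z2_def z3_def z4_def intro!: subspace_add subspace_diff
          subspace_scale)
      moreover have "sy c z3 = 0" "sy c z4 = 0" using that(6) by (simp_all add: z3_def z4_def)
      ultimately show ?P
        using two'[OF that(1) _ z, of 0] by (auto simp: span_zero)
    qed
    obtain e where e: "e \<in> U" "e \<noteq> 0" "\<forall>u\<in>U. sy e u = 0"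
    proof -
      have "\<exists>e\<in>U. sy c e \<noteq> 0 \<and> (\<forall>u\<in>U. sy e u = 0)"
      proof (rule ccontr)
        assume "\<not> ?thesis"
        then obtain u0 where "u0 \<in> U" "\<And>u. u \<in> U \<Longrightarrow> sy u u0 = sy c u"
          using sy.representable[OF U(1) U(1) sy.linear_functional_right[of c]] by blast
        then show False using nonrep sy_commute by metis
      qed
      then show thesis using that by (metis sy.zero_right)
    qed
    obtain k us W where k: "k \<in> {H2, G2, G4, G6, H6}" "realizes k us" "splits U us W"
      using less.hyps[OF _ U(1) U_ndg _ e] U(2) dimV
      by (metis add_leE less_add_same_cancel1 zero_less_numeral)
    note sub = splits_subsets[OF k(3)] and Uspan = splits_span[OF k(3)]
    have len: "length us = length (block_matrix k)" by (rule realizes_length[OF k(2)])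
    have dims: "dim U = length us + dim W" by (rule splits_dim[OF k(3) realizes_gram_regular[OF k(2)]])
    consider (G4) "k = G4" | (two) "k \<in> {H2, G2}" using k(1) len dims dimU by auto
    then show ?thesis
    proof cases
      case G4
      then obtain y1 y2 y3 y4 where us: "us = [y1, y2, y3, y4]" using len by (auto simp: length_Suc_conv)
      then have W0: "W \<subseteq> {0}" using dims dimU by simp
      have "sy c y1 \<noteq> 0"
      proof
        assume 0: "sy c y1 = 0"
        have F: "f y1 y1 = 0" "f y1 y2 = 0" "f y1 y3 = 0" "f y1 y4 = 1"
          "f y2 y1 = 0" "f y2 y2 = 0" "f y2 y3 = 1" "f y2 y4 = 1"
          "f y3 y1 = 0" "f y3 y2 = -1" "f y3 y3 = 1" "f y3 y4 = 0"
          "f y4 y1 = -1" "f y4 y2 = 1" "f y4 y3 = 0" "f y4 y4 = 0"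
          using k(2) G4 us by (auto simp: realizes_def)
        show False
        proof (rule rep_span[OF _ Uspan])
          show "sy c y2 \<odot> y4 + sy c y3 \<odot> y3 + sy c y4 \<odot> y2 \<in> U"
            using sub us U(1) by (auto intro!: subspace_add subspace_scale)
          fix x assume "x \<in> set us \<union> W"
          then have "x \<in> {y1, y2, y3, y4, 0}" using W0 us by auto
          then show "sy (sy c y2 \<odot> y4 + sy c y3 \<odot> y3 + sy c y4 \<odot> y2) x = sy c x"
            using 0 by (auto simp: sy_def[of y2] sy_def[of y3] sy_def[of y4] F)
        qed
      qed
      then show ?thesis
        using symp_full_G4[OF set_up, folded U_def, of y1 y2 y3 y4] k(2) G4 us sub dimV by auto
    next
      case two
      note case_two = two
      then obtain y1 y2 where us: "us = [y1, y2]" using len by (auto simp: length_Suc_conv)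
      note W = splits_subspace[OF k(3)]
      show ?thesis
      proof (cases "\<exists>w\<in>W. sy c w \<noteq> 0 \<and> (\<forall>v\<in>W. sy w v = 0)")
        case False
        then obtain w0 where w0: "w0 \<in> W" "\<And>w. w \<in> W \<Longrightarrow> sy w w0 = sy c w"
          using sy.representable[OF W W sy.linear_functional_right[of c]] by blast
        then have "sy w0 w = sy c w" if "w \<in> W" for w using that by (simp add: sy_commute[of w0])
        then show ?thesis
          using two_ext[OF case_two _ _ w0(1)] k(2,3) us by blast
      next
        case True
        then obtain w1 where w1: "w1 \<in> W" "w1 \<noteq> 0" "\<forall>v\<in>W. sy w1 v = 0" by (metis sy.zero_right)
        have W_ndg: "x = 0" if x: "x \<in> W" "\<forall>v\<in>W. sk x v = 0" for x
        proof (rule U_ndg)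
          show "x \<in> U" using x sub by blast
          have gen: "sk x u = 0" if "u \<in> set us \<union> W" for u
            using that x splits_orthogonal[OF k(3)] by (auto simp: orthogonal_def sk_def)
          have "sk x u = 0" if "u \<in> span (set us \<union> W)" for u
            using that by (induction rule: span_induct_alt) (use gen in auto)
          then show "\<forall>u\<in>U. sk x u = 0" using Uspan by blast
        qed
        have "dim W < dim V" "dim W \<le> 6" "dim W \<le> 2" using dims U(2) dimV us by auto
        then obtain l vs W2 where l: "l \<in> {H2, G2, G4, G6, H6}" "realizes l vs" "splits W vs W2"
          using less.hyps[OF _ W W_ndg _ w1] by blast
        have "length vs = length (block_matrix l)" by (rule realizes_length[OF l(2)])
        moreover have "dim W = length vs + dim W2"
          by (rule splits_dim[OF l(3) realizes_gram_regular[OF l(2)]])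
        ultimately have l2: "l \<in> {H2, G2}" "length vs = 2"
          using l(1) \<open>dim W \<le> 2\<close> by auto
        then obtain y3 y4 where vs: "vs = [y3, y4]" by (auto simp: length_Suc_conv numeral_2_eq_2)
        have yU: "{y1, y2, y3, y4} \<subseteq> U" and yW: "{y3, y4} \<subseteq> W"
          using sub us vs splits_subsets[OF l(3)] by auto
        have orth: "orthogonal {y1, y2} {y3, y4}"
          using splits_orthogonal[OF k(3)] us yW by (auto simp: orthogonal_def)
        then have orth': "orthogonal {y3, y4} {y1, y2}" by (simp add: orthogonal_sym)
        have yU': "{y3, y4, y1, y2} \<subseteq> U" using yU by auto
        have r: "realizes k [y1, y2]" "realizes l [y3, y4]" using k(2) l(2) us vs by auto
        have S: "sy y2 y1 = 0 \<and> sy y2 y2 = (if k = G2 then 1 else 0)"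
          "sy y4 y3 = 0 \<and> sy y4 y4 = (if l = G2 then 1 else 0)"
          using r case_two l2 by (auto simp: realizes_def sy_def)
        note T1 = two'[OF case_two l2(1) r orth yU] and T2 = two'[OF l2(1) case_two r(2,1) orth' yU']
        \<comment> \<open>In cases 1 and 2 a nonzero value on one block clears the other block; in
          3, 4 and 6 \<open>sy c\<close> is representable on one block; 5 becomes 1 after exchanging
          \<open>y1\<close> and \<open>y2\<close>. Two \<open>G2\<close> blocks with nonzero values
          remain.\<close>
        consider "l = H2" "sy c y1 \<noteq> 0" | "k = H2" "sy c y3 \<noteq> 0"
          | "l = G2" "sy c y3 = 0" | "k = G2" "sy c y1 = 0"
          | "k = H2" "l = H2" "sy c y1 = 0" "sy c y2 \<noteq> 0" | "k = H2" "l = H2" "sy c y1 = 0" "sy c y2 = 0"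
          | "k = G2" "l = G2" "sy c y1 \<noteq> 0" "sy c y3 \<noteq> 0"
          using case_two l2(1) by blast
        then show ?thesis
        proof cases
          case 1
          then show ?thesis using pair[OF case_two r(1) _ orth yU] r(2) by blast
        next
          case 2
          then show ?thesis using pair[OF l2(1) r(2) _ orth' yU'] r(1) by blast
        next
          case 3
          then show ?thesis using T1[of "sy c y4 \<odot> y4"] S by (auto intro: span_scale span_base)
        next
          case 4
          then show ?thesis using T2[of "sy c y2 \<odot> y2"] S by (auto intro: span_scale span_base)
        next
          case 5
          have "realizes H2 [y2, - y1]" using r(1) 5 by (auto simp: realizes_def)
          moreover have "orthogonal {y2, - y1} {y3, y4}" "{y2, - y1, y3, y4} \<subseteq> U"
            using orth yU U(1) by (auto simp: orthogonal_def subspace_neg)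
          ultimately show ?thesis using pair[of H2 y2 "- y1" y3 y4] r(2) 5 by blast
        next
          case 6
          then show ?thesis using T2[of 0] by (auto simp: span_zero)
        next
          case 7
          define a b where "a = sy c y1" and "b = sy c y3"
          have ab: "a \<noteq> 0" "b \<noteq> 0" using 7 by (auto simp: a_def b_def)
          show ?thesis
          proof (cases "a * a + b * b = 0")
            case True
            then show ?thesis
              using symp_full_H6[OF set_up, folded U_def, of y1 y2 y3 y4] r 7 orth yU dimV
              by (auto simp: a_def b_def)
          next
            case False
            \<comment> \<open>\<open>a / \<rho>\<close> and \<open>b / \<rho>\<close> are the
              entries of a complex rotation of both blocks at once, chosen so that
              \<open>sy c\<close> vanishes at \<open>z3\<close>.\<close>
            define \<rho> where "\<rho> = csqrt (a * a + b * b)"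
            have \<rho>: "\<rho> \<noteq> 0" "\<rho> * \<rho> = a * a + b * b"
              using False power2_csqrt[of "a * a + b * b"] by (auto simp: \<rho>_def power2_eq_square)
            define z1 where "z1 = (a / \<rho>) \<odot> y1 + (b / \<rho>) \<odot> y3"
            define z2 where "z2 = (a / \<rho>) \<odot> y2 + (b / \<rho>) \<odot> y4"
            define z3 where "z3 = (a / \<rho>) \<odot> y3 - (b / \<rho>) \<odot> y1"
            define z4 where "z4 = (a / \<rho>) \<odot> y4 - (b / \<rho>) \<odot> y2"
            have F: "f y1 y1 = 0" "f y1 y2 = 1" "f y2 y1 = -1" "f y2 y2 = 1"
              "f y3 y3 = 0" "f y3 y4 = 1" "f y4 y3 = -1" "f y4 y4 = 1"
              "f y1 y3 = 0" "f y1 y4 = 0" "f y2 y3 = 0" "f y2 y4 = 0"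
              "f y3 y1 = 0" "f y4 y1 = 0" "f y3 y2 = 0" "f y4 y2 = 0"
              using r orth 7 by (auto simp: realizes_def orthogonal_def)
            have one: "(a / \<rho>) * (a / \<rho>) + (b / \<rho>) * (b / \<rho>) = 1"
              using False by (simp add: \<rho>(2) flip: add_divide_distrib)
            have z: "realizes G2 [z1, z2]" "realizes G2 [z3, z4]" "orthogonal {z1, z2} {z3, z4}"
              using one by (simp_all add: realizes_def orthogonal_def z1_def z2_def z3_def z4_def F
                algebra_simps)
            have zU: "{z1, z2, z3, z4} \<subseteq> U"
              using yU U(1) by (auto simp: z1_def z2_def z3_def z4_def intro!: subspace_add subspace_diff
                subspace_scale)
            have z3: "sy c z3 = 0"
              by (simp add: z3_def a_def[symmetric] b_def[symmetric])
            have "sy z4 z3 = 0" "sy z4 z4 = 1"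
              using z(2) by (auto simp: realizes_def sy_def)
            then show ?thesis
              using two'[OF _ _ z zU, of "sy c z4 \<odot> z4"] z3 by (auto intro: span_scale span_base)
          qed
        qed
      qed
    qed
  qed
qed

section \<open>Block decomposition\<close>

text \<open>\<open>\<sigma>\<close> is the cosquare of \<open>f\<close>, given by
  \<open>f(y, \<sigma> x) = f(x, y)\<close>. It is chosen pointwise, so its eigenvector is taken
  from a single orbit. The eigenvalue is nonzero by nondegeneracy, and its inverse is the constant
  in the conclusion.\<close>

lemma cosquare_eigenvector:
  assumes V: "subspace V" "nondegenerate V" "v \<in> V" "v \<noteq> 0"
  obtains c w where "w \<in> V" "w \<noteq> 0" "\<And>y. y \<in> V \<Longrightarrow> f y w = c * f w y"
proof -
  have "\<exists>z\<in>V. \<forall>y\<in>V. f y z = f x y" if "x \<in> V" for x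
  proof -
    have "\<And>u. u \<in> V \<Longrightarrow> (\<forall>v\<in>V. f u v = 0) \<Longrightarrow> f x u = 0"
      using V(2) by (auto simp: nondegenerate_def)
    then show ?thesis using representable[OF V(1) V(1) linear_functional_right] by metis
  qed
  then obtain \<sigma> where \<sigma>: "\<And>x. x \<in> V \<Longrightarrow> \<sigma> x \<in> V" "\<And>x y. x \<in> V \<Longrightarrow> y \<in> V \<Longrightarrow> f y (\<sigma> x) = f x y"
    by metis
  define x where "x i = (\<sigma> ^^ i) v" for i
  have x: "x i \<in> V" for i by (induction i) (auto simp: x_def V \<sigma>)
  have x_Suc: "f y (x (Suc i)) = f (x i) y" if "y \<in> V" for y i
    using \<sigma>(2)[OF x that] by (simp add: x_def)
  have "x 0 \<noteq> 0" by (simp add: x_def V)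
  then obtain c k b where b: "(\<Sum>i<k. b i \<odot> x i) \<noteq> 0"
    "(\<Sum>i<k. b i \<odot> x (Suc i)) = c \<odot> (\<Sum>i<k. b i \<odot> x i)"
    by (rule cyclic_eigenvector)
  define w where "w = (\<Sum>i<k. b i \<odot> x i)"
  have w: "w \<in> V" using x V by (auto simp: w_def intro: subspace_sum subspace_scale)
  have fw: "f w y = c * f y w" if y: "y \<in> V" for y
  proof -
    have "f w y = f y (\<Sum>i<k. b i \<odot> x (Suc i))"
      using x_Suc[OF y] by (simp add: w_def sum_left sum_right)
    then show ?thesis by (simp add: b(2) w_def)
  qed
  have "c \<noteq> 0"
  proof
    assume "c = 0"
    then have "w = 0" using V(2) w fw by (simp add: nondegenerate_def)
    then show False using b(1) by (simp add: w_def)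
  qed
  show thesis
  proof
    show "f y w = 1 / c * f w y" if "y \<in> V" for y using fw[OF that] \<open>c \<noteq> 0\<close> by simp
  qed (use w b(1) in \<open>auto simp: w_def\<close>)
qed

text \<open>Scaling the vectors in odd positions by \<open>1 / a\<close> turns the links into 1 and
  \<open>c\<close>; listing odd positions before even ones gives the order of the block
  matrices.\<close>

lemma chain_block:
  assumes gram: "\<forall>i<length es. \<forall>j<length es. f (es ! i) (es ! j) =
      (if j = Suc i then a else if i = Suc j then a * c else 0)"
    and "a \<noteq> 0" "c \<noteq> 1" "c \<noteq> -1" "even (length es) \<or> c = 0" "length es \<in> {2..6}"
  shows "\<exists>k us. realizes k us \<and> length us = length es \<and> (\<forall>u\<in>set us. \<exists>e\<in>set es. \<exists>r. u = r \<odot> e)"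
proof -
  have s: "\<exists>e\<in>set es. \<exists>r. u = r \<odot> e" if "u \<in> set es \<union> (\<lambda>x. (1/a) \<odot> x) ` set es" for u
  proof -
    have "u = 1 \<odot> u" by simp
    then show ?thesis using that by blast
  qed
  have "length es = 2 \<or> length es = 3 \<or> length es = 4 \<or> length es = 5 \<or> length es = 6"
    using assms(6) by auto
  then consider e1 e2 where "es = [e1, e2]" | e1 e2 e3 where "es = [e1, e2, e3]"
    | e1 e2 e3 e4 where "es = [e1, e2, e3, e4]" | e1 e2 e3 e4 e5 where "es = [e1, e2, e3, e4, e5]"
    | e1 e2 e3 e4 e5 e6 where "es = [e1, e2, e3, e4, e5, e6]"
    by (auto simp: numeral_eq_Suc length_Suc_conv)
  then show ?thesis
  proof cases
    case 1
    then have "realizes (Ch2 c) [(1/a) \<odot> e1, e2]"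
      using assms(2-4) gram by (simp add: realizes_def All_less_Suc2)
    then show ?thesis using s 1 by (intro exI[of _ "Ch2 c"] exI[of _ "[(1/a) \<odot> e1, e2]"]) auto
  next
    case 2
    then have "realizes J3 [(1/a) \<odot> e1, (1/a) \<odot> e3, e2]"
      using assms(2-5) gram by (simp add: realizes_def All_less_Suc2)
    then show ?thesis using s 2 by (intro exI[of _ J3] exI[of _ "[(1/a) \<odot> e1, (1/a) \<odot> e3, e2]"]) auto
  next
    case 3
    then have "realizes (Ch4 c) [(1/a) \<odot> e1, (1/a) \<odot> e3, e4, e2]"
      using assms(2-4) gram by (simp add: realizes_def All_less_Suc2)
    then show ?thesis using s 3 by (intro exI[of _ "Ch4 c"] exI[of _ "[(1/a) \<odot> e1, (1/a) \<odot> e3, e4, e2]"])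
      auto
  next
    case 4
    then have "realizes J5 [(1/a) \<odot> e1, (1/a) \<odot> e3, (1/a) \<odot> e5, e2, e4]"
      using assms(2-5) gram by (simp add: realizes_def All_less_Suc2)
    then show ?thesis using s 4
      by (intro exI[of _ J5] exI[of _ "[(1/a) \<odot> e1, (1/a) \<odot> e3, (1/a) \<odot> e5, e2, e4]"]) auto
  next
    case 5
    then have "realizes (Ch6 c) [(1/a) \<odot> e1, (1/a) \<odot> e3, (1/a) \<odot> e5, e6, e4, e2]"
      using assms(2-4) gram by (simp add: realizes_def All_less_Suc2)
    then show ?thesis using s 5
      by (intro exI[of _ "Ch6 c"] exI[of _ "[(1/a) \<odot> e1, (1/a) \<odot> e3, (1/a) \<odot> e5, e6, e4, e2]"]) auto
  qed
qed

lemma chain_block_splits: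
  assumes "subspace V" "set es \<subseteq> V" "subspace W" "W \<subseteq> V" "orthogonal (set es) W"
    "dim V = length es + dim W"
    and "\<forall>i<length es. \<forall>j<length es. f (es ! i) (es ! j) =
      (if j = Suc i then a else if i = Suc j then a * c else 0)"
    and "a \<noteq> 0" "c \<noteq> 1" "c \<noteq> -1" "even (length es) \<or> c = 0" "length es \<in> {2..6}"
  shows "\<exists>k us W. realizes k us \<and> us \<noteq> [] \<and> splits V us W"
proof -
  obtain k us where us: "realizes k us" "length us = length es" "\<forall>u\<in>set us. \<exists>e\<in>set es. \<exists>r. u = r \<odot> e"
    using chain_block[OF assms(7-12)] by blast
  have "splits V us W"
  proof (rule splits_of_dim[OF assms(1,3) _ assms(4) us(1)])
    show "set us \<subseteq> V" using us(3) assms(1,2) by (auto dest!: bspec simp: subspace_scale subset_iff)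
    show "orthogonal (set us) W" using us(3) assms(5) by (fastforce simp: orthogonal_def)
  qed (use us assms in simp)
  moreover have "us \<noteq> []" using us(2) assms(12) by auto
  ultimately show ?thesis using us(1) by blast
qed

lemma degenerate_splits_block:
  assumes V: "subspace V" "no_radical V" "dim V \<le> 6" and r: "r \<in> V" "r \<noteq> 0" "\<And>y. y \<in> V \<Longrightarrow> f r y = 0"
  shows "\<exists>k us W. realizes k us \<and> us \<noteq> [] \<and> splits V us W"
proof -
  obtain es W where es: "2 \<le> length es" "chain es" "splits V es W"
    using degenerate_splits_chain[OF assms] by blast
  have dim: "dim V = length es + dim W"
    using splits_dim[OF es(3) chain_gram_regular] es by blast
  show ?thesis
    by (rule chain_block_splits[of V es W 1 0])
      (use es V dim splits_subsets[OF es(3)] splits_subspace[OF es(3)] splits_orthogonal[OF es(3)]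
        in \<open>auto simp: chain_nth\<close>)
qed

text \<open>With \<open>G(x, y) = f(y, x) - c f(x, y)\<close> one has \<open>(1 - c\<^sup>2) f(x, y) = G(y, x) + c G(x, y)\<close>, so
  \<open>f\<close> and \<open>G\<close> have the same orthogonal splittings.\<close>

lemma generic_splits_block:
  assumes V: "subspace V" "nondegenerate V" "dim V \<le> 6"
    and w: "w \<in> V" "w \<noteq> 0" "\<And>y. y \<in> V \<Longrightarrow> f y w = c * f w y" and c: "c \<noteq> 1" "c \<noteq> -1"
  shows "\<exists>k us W. realizes k us \<and> us \<noteq> [] \<and> splits V us W"
proof -
  define G where "G x y = f y x - c * f x y" for x y
  interpret G: complex_bilinear_form scale Basis G
    by unfold_locales (simp_all add: G_def algebra_simps)
  have c2: "1 - c * c \<noteq> 0"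
    using c by (metis (no_types) add_neg_numeral_special(7) eq_iff_diff_eq_0 power2_eq_1_iff
      power2_eq_square right_minus_eq)
  have f_G: "f x y = (G y x + c * G x y) / (1 - c * c)" for x y
    using c2 by (simp add: G_def field_simps)
  have orth_G: "orthogonal A B" if "G.orthogonal A B" for A B
    using that by (auto simp: orthogonal_def G.orthogonal_def f_G)
  have "G.no_radical V"
    unfolding G.no_radical_def
  proof (intro ballI impI)
    fix x assume "x \<in> V" "\<forall>y\<in>V. G x y = 0 \<and> G y x = 0"
    then show "x = 0" using V(2) by (auto simp: nondegenerate_def f_G)
  qed
  moreover have "G w y = 0" if "y \<in> V" for y using w(3)[OF that] by (simp add: G_def)
  ultimately obtain es W where es: "2 \<le> length es" "G.chain es" "G.splits V es W"
    using G.degenerate_splits_chain[OF V(1) _ V(3) w(1,2)] by blast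
  have dim: "dim V = length es + dim W"
    using G.splits_dim[OF es(3) G.chain_gram_regular] es by blast
  note sub = G.splits_subsets[OF es(3)]
  have orth: "orthogonal (set es) W" using orth_G G.splits_orthogonal[OF es(3)] by blast
  have gram: "f (es ! i) (es ! j) = (if j = Suc i then c / (1 - c * c) else if i =
    Suc j then 1 / (1 - c * c) else 0)"
    if "i < length es" "j < length es" for i j
    using that es(2) by (auto simp: f_G G.chain_nth)
  have left_rad: False if v: "v \<in> V" "e \<in> V" "f e v \<noteq> 0" "\<And>e. e \<in> set es \<Longrightarrow> f v e = 0"
    "\<And>w. w \<in> W \<Longrightarrow> f v w = 0" for v e
  proof -
    have "f v x = 0" if "x \<in> span (set es \<union> W)" for x
      using that by (induction rule: span_induct_alt) (use v in auto)
    then have "v = 0" using V(2) v(1) G.splits_span[OF es(3)] by (auto simp: nondegenerate_def)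
    then show False using v(3) by simp
  qed
  \<comment> \<open>A tridiagonal matrix of odd size with zero diagonal is singular: the vectors in
    odd positions with coefficients \<open>1, -c, c * c\<close> combine to a left radical vector of
    \<open>f\<close>, against nondegeneracy.\<close>
  have "even (length es)"
  proof (rule ccontr)
    assume "odd (length es)"
    moreover have "length es \<le> 6" using dim V(3) by simp
    ultimately have "length es = 3 \<or> length es = 5" using es(1) by presburger
    then consider e1 e2 e3 where "es = [e1, e2, e3]" | e1 e2 e3 e4 e5 where "es = [e1, e2, e3, e4, e5]"
      by (auto simp: numeral_eq_Suc length_Suc_conv)
    then show False
    proof cases
      case 1
      have g: "G e1 e1 = 0" "G e1 e2 = 1" "G e1 e3 = 0" "G e2 e1 = 0" "G e2 e3 = 1"
        "G e3 e1 = 0" "G e3 e2 = 0" "G e3 e3 = 0"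
        using es(2) by (auto simp: 1 G.chain_def All_less_Suc2)
      define v where "v = e1 - c \<odot> e3"
      have "f e2 v = 1" "\<And>e. e \<in> set es \<Longrightarrow> f v e = 0"
        using c2 by (auto simp: v_def f_G 1 g field_simps)
      moreover have "\<And>w. w \<in> W \<Longrightarrow> f v w = 0"
        using orth by (auto simp: v_def 1 orthogonal_def)
      moreover have "v \<in> V" "e2 \<in> V" using sub V(1) by (auto simp: v_def 1 subspace_diff subspace_scale)
      ultimately show False using left_rad[of v e2] by simp
    next
      case 2
      have g: "G e1 e1 = 0" "G e1 e2 = 1" "G e1 e3 = 0" "G e1 e4 = 0" "G e1 e5 = 0"
        "G e2 e1 = 0" "G e2 e3 = 1" "G e2 e5 = 0"
        "G e3 e1 = 0" "G e3 e2 = 0" "G e3 e3 = 0" "G e3 e4 = 1" "G e3 e5 = 0"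
        "G e4 e1 = 0" "G e4 e3 = 0" "G e4 e5 = 1"
        "G e5 e1 = 0" "G e5 e2 = 0" "G e5 e3 = 0" "G e5 e4 = 0" "G e5 e5 = 0"
        using es(2) by (auto simp: 2 G.chain_def All_less_Suc2)
      define v where "v = e1 - c \<odot> e3 + (c * c) \<odot> e5"
      have "f e2 v = 1" "\<And>e. e \<in> set es \<Longrightarrow> f v e = 0"
        using c2 by (auto simp: v_def f_G 2 g field_simps)
      moreover have "\<And>w. w \<in> W \<Longrightarrow> f v w = 0"
        using orth by (auto simp: v_def 2 orthogonal_def)
      moreover have "v \<in> V" "e2 \<in> V"
        using sub V(1) by (auto simp: v_def 2 intro!: subspace_add subspace_diff subspace_scale)
      ultimately show False using left_rad[of v e2] by simp
    qed
  qed
  \<comment> \<open>Along \<open>es\<close> the forward links of \<open>f\<close> are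
    \<open>c / (1 - c * c)\<close> and the backward ones \<open>1 / (1 - c * c)\<close>; reversal
    produces the shape \<open>a\<close>, \<open>a * c\<close> that \<open>chain_block\<close>
    expects.\<close>
  have "f (rev es ! i) (rev es ! j) =
      (if j = Suc i then 1 / (1 - c * c) else if i = Suc j then 1 / (1 - c * c) * c else 0)"
    if ij: "i < length (rev es)" "j < length (rev es)" for i j
  proof -
    have 1: "f (rev es ! i) (rev es ! j) = (if length es - Suc j = Suc (length es - Suc i) then c /
      (1 - c * c)
        else if length es - Suc i = Suc (length es - Suc j) then 1 / (1 - c * c) else 0)"
      using ij by (simp add: rev_nth gram del: One_nat_def)
    have 2: "length es - Suc j = Suc (length es - Suc i) \<longleftrightarrow> i = Suc j"
      "length es - Suc i = Suc (length es - Suc j) \<longleftrightarrow> j = Suc i"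
      using ij by auto
    show ?thesis unfolding 1 2 by auto
  qed
  then have gram_rev: "\<forall>i<length (rev es). \<forall>j<length (rev es). f (rev es ! i) (rev es ! j) =
      (if j = Suc i then 1 / (1 - c * c) else if i = Suc j then 1 / (1 - c * c) * c else 0)"
    by blast
  have "length (rev es) \<in> {2..6}" using es(1) dim V(3) by simp
  moreover have "set (rev es) \<subseteq> V" "orthogonal (set (rev es)) W" "dim V = length (rev es) + dim W"
    "even (length (rev es)) \<or> c = 0"
    using sub orth dim \<open>even (length es)\<close> by simp_all
  moreover have "1 / (1 - c * c) \<noteq> 0" using c2 by simp
  ultimately show ?thesis
    using chain_block_splits[OF V(1) _ G.splits_subspace[OF es(3)] _ _ _ gram_rev _ c] sub by blast
qed

theorem splits_block:
  assumes V: "subspace V" "no_radical V" "dim V \<le> 6" "V \<noteq> {0}"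
  shows "\<exists>k us W. realizes k us \<and> us \<noteq> [] \<and> splits V us W"
proof (cases "nondegenerate V")
  case False
  then obtain r where "r \<in> V" "r \<noteq> 0" "\<And>y. y \<in> V \<Longrightarrow> f r y = 0" by (auto simp: nondegenerate_def)
  then show ?thesis using degenerate_splits_block[OF V(1-3)] by blast
next
  case nd: True
  show ?thesis
  proof (cases "\<exists>z\<in>V. z \<noteq> 0 \<and> (\<forall>v\<in>V. sk z v = 0)")
    case True
    then show ?thesis using skew_degenerate_splits[OF V(1) nd V(3)] by blast
  next
    case skew: False
    show ?thesis
    proof (cases "\<exists>s\<in>V. s \<noteq> 0 \<and> (\<forall>v\<in>V. sy s v = 0)")
      case True
      then obtain s where s: "s \<in> V" "s \<noteq> 0" "\<forall>v\<in>V. sy s v = 0" by blast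
      have "x = 0" if "x \<in> V" "\<forall>v\<in>V. sk x v = 0" for x using skew that by blast
      from sym_degenerate_splits[OF V(1) this V(3) s]
      obtain k us W where us: "k \<in> {H2, G2, G4, G6, H6}" "realizes k us" "splits V us W"
        by blast
      then have "us \<noteq> []" by (auto simp: realizes_def)
      with us show ?thesis by blast
    next
      case sym: False
      obtain v where "v \<in> V" "v \<noteq> 0" using V(1,4) subspace_0 by blast
      then obtain c w where w: "w \<in> V" "w \<noteq> 0" "\<And>y. y \<in> V \<Longrightarrow> f y w = c * f w y"
        using cosquare_eigenvector[OF V(1) nd] by metis
      have "c \<noteq> 1" using skew w by (force simp: sk_def)
      moreover have "c \<noteq> -1" using sym w by (force simp: sy_def)
      ultimately show ?thesis using generic_splits_block[OF V(1) nd V(3) w] by blast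
    qed
  qed
qed

fun block_sum :: "(block \<times> 'a list) list \<Rightarrow> bool" where
  "block_sum [] \<longleftrightarrow> True"
| "block_sum ((k, us) # bs) \<longleftrightarrow> realizes k us \<and> block_sum bs \<and> orthogonal (set us)
  (set (concat (map snd bs)))"

theorem block_decomposition:
  assumes "subspace V" "no_radical V" "dim V \<le> 6"
  shows "\<exists>bs. block_sum bs \<and> span (set (concat (map snd bs))) = V \<and> length (concat (map snd bs)) = dim V"
  using assms
proof (induction "dim V" arbitrary: V rule: less_induct)
  case less
  show ?case
  proof (cases "V = {0}")
    case True
    then show ?thesis by (intro exI[of _ "[]"]) auto
  next
    case False
    then obtain k us W where us: "realizes k us" "us \<noteq> []" "splits V us W"
      using splits_block less.prems by blast
    have dim: "dim V = length us + dim W" by (rule splits_dim[OF us(3) realizes_gram_regular[OF us(1)]])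
    moreover have "no_radical W" by (rule splits_no_radical[OF us(3) less.prems(2)])
    ultimately obtain bs where bs: "block_sum bs" "span (set (concat (map snd bs))) = W"
      "length (concat (map snd bs)) = dim W"
      using less.hyps[of W] us(2) less.prems(3) splits_subspace[OF us(3)] by fastforce
    have "set (concat (map snd bs)) \<subseteq> W" using bs(2) span_superset by blast
    then have "block_sum ((k, us) # bs)"
      using bs(1) us(1) splits_orthogonal[OF us(3)] by (auto intro: orthogonal_mono)
    moreover have "span (set (concat (map snd ((k, us) # bs)))) = V"
      using splits_span[OF us(3)] bs(2) span_Un_span[of "set us" "set (concat (map snd bs))"] by simp
    ultimately show ?thesis using dim bs(3) by (intro exI[of _ "(k, us) # bs"]) simp
  qed
qed

end

section \<open>Multiplication tables of block sums\<close>

fun block_diag :: "block list \<Rightarrow> complex list list" where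
  "block_diag [] = []"
| "block_diag (k # ks) = map (\<lambda>r. r @ replicate (length (block_diag ks)) 0) (block_matrix k)
     @ map (\<lambda>r. replicate (length (block_matrix k)) 0 @ r) (block_diag ks)"

text \<open>The order in which the tables list the blocks of a sum.\<close>

fun block_rank :: "block \<Rightarrow> nat" where
  "block_rank (Ch6 c) = 0" | "block_rank G6 = 1" | "block_rank H6 = 2"
| "block_rank J5 = 3" | "block_rank G5 = 4"
| "block_rank (Ch4 c) = 5" | "block_rank H4 = 6" | "block_rank G4 = 7"
| "block_rank J3 = 8" | "block_rank G3 = 9"
| "block_rank H2 = 10" | "block_rank G2 = 11" | "block_rank (Ch2 c) = 12"
| "block_rank G1 = 13"

context complex_bilinear_form
begin

lemma block_sum_gram:
  "block_sum bs \<Longrightarrow> map (\<lambda>u. map (f u) (concat (map snd bs))) (concat (map snd bs)) =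
    block_diag (map fst bs)
    \<and> list_all valid_block (map fst bs)"
proof (induction bs)
  case (Cons b bs)
  obtain k us where b: "b = (k, us)" by (cases b)
  let ?vs = "concat (map snd bs)"
  have us: "realizes k us" "orthogonal (set us) (set ?vs)" and IH: "block_sum bs"
    using Cons.prems b by simp_all
  have gram: "map (\<lambda>u. map (f u) ?vs) ?vs = block_diag (map fst bs)" "list_all valid_block (map fst bs)"
    using Cons.IH IH by simp_all
  have len: "length (block_diag (map fst bs)) = length ?vs" by (metis gram(1) length_map)
  have "map (\<lambda>u. map (f u) us @ map (f u) ?vs) us = map (\<lambda>r. r @ replicate (length ?vs) 0)
    (map (\<lambda>u. map (f u) us) us)"
  proof -
    have "map (f u) ?vs = replicate (length ?vs) 0" if "u \<in> set us" for u
      using us(2) that by (intro replicate_eqI) (auto simp: orthogonal_def)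
    then show ?thesis by simp
  qed
  moreover have "map (\<lambda>u. map (f u) us @ map (f u) ?vs) ?vs = map (\<lambda>r. replicate (length us) 0 @ r)
    (map (\<lambda>u. map (f u) ?vs) ?vs)"
  proof -
    have "map (f u) us = replicate (length us) 0" if "u \<in> set ?vs" for u
      using us(2) that by (intro replicate_eqI) (auto simp: orthogonal_def)
    then show ?thesis by (simp only: map_map o_def cong: map_cong)
  qed
  ultimately show ?case
    using us(1) gram len realizes_length[OF us(1)] by (simp add: b realizes_def del: map_map map_concat)
qed simp

lemma set_concat_insort:
  "set (concat (map snd (insort_key g b bs))) = set (snd b) \<union> set (concat (map snd bs))"
  by (simp add: set_insort_key)

text \<open>Orthogonality is symmetric, so a block may be inserted anywhere. This is needed because
  blocks are split off in no particular order.\<close>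

lemma block_sum_insort: "block_sum (b # bs) \<Longrightarrow> block_sum (insort_key g b bs)"
proof (induction bs)
  case (Cons d bs)
  obtain k us l vs where bd: "b = (k, us)" "d = (l, vs)" by (cases b, cases d)
  have *: "block_sum (insort_key g b bs)"
    using Cons.prems by (intro Cons.IH) (auto simp: bd orthogonal_def)
  have "orthogonal (set vs) (set us)" "orthogonal (set vs) (set (concat (map snd bs)))"
    using Cons.prems by (auto simp: bd orthogonal_def)
  then have "orthogonal (set vs) (set (concat (map snd (insort_key g b bs))))"
    unfolding set_concat_insort by (auto simp: bd orthogonal_def)
  then show ?case using * Cons.prems by (simp add: bd)
qed (cases b; simp)

lemma block_sum_sort:
  "block_sum bs \<Longrightarrow> block_sum (sort_key g bs) \<and>
     set (concat (map snd (sort_key g bs))) = set (concat (map snd bs)) \<and>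
     length (concat (map snd (sort_key g bs))) = length (concat (map snd bs))"
proof (induction bs)
  case (Cons b bs)
  obtain k us where b: "b = (k, us)" by (cases b)
  have IH: "block_sum (sort_key g bs)" "set (concat (map snd (sort_key g bs))) =
    set (concat (map snd bs))"
    using Cons b by simp_all
  have "block_sum (b # sort_key g bs)"
    using Cons.prems IH b by simp
  then have "block_sum (sort_key g (b # bs))"
    using block_sum_insort by simp
  moreover have "length (concat (map snd (insort_key g b cs))) = length us + length (concat (map snd cs))"
    for cs
    by (induction cs) (auto simp: b)
  ultimately show ?case
    using Cons b by (simp add: set_insort_key)
qed simp

end

text \<open>Matrix indices start at 0 and table indices at 1. A parameter equal to 0 is listed as
  \<open>Some 0\<close>, which agrees with an absent entry.\<close>

definition tabulated :: "block list \<Rightarrow> bool" where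
  "tabulated ks \<longleftrightarrow> (\<exists>t. listed_table t \<and> (\<forall>i. t (i, 7) = None \<and> t (7, i) = None) \<and>
     (\<forall>i<6. \<forall>j<6. block_diag ks ! i ! j = (case t (Suc i, Suc j) of None \<Rightarrow> 0 | Some c \<Rightarrow> c)))"

lemma tabulatedI:
  assumes "listed_table t" "\<forall>i. t (i, 7) = None \<and> t (7, i) = None"
    "\<forall>i<6. \<forall>j<6. block_diag ks ! i ! j = (case t (Suc i, Suc j) of None \<Rightarrow> 0 | Some c \<Rightarrow> c)"
  shows "tabulated ks"
  using assms by (auto simp: tabulated_def)

section \<open>Enumeration of the sorted block lists of size six\<close>

lemma all_less_six: "(\<forall>i<6. P i) \<longleftrightarrow> P 0 \<and> P (Suc 0) \<and> P 2 \<and> P 3 \<and> P 4 \<and> P (5::nat)"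
  by (simp add: numeral_eq_Suc All_less_Suc2)

text \<open>\<open>n\<close> is the size still to be filled and \<open>r\<close> the rank of the
  preceding block.\<close>

fun ascending :: "nat \<Rightarrow> nat \<Rightarrow> block list \<Rightarrow> bool" where
  "ascending n r [] \<longleftrightarrow> n = 0"
| "ascending n r (k # ks) \<longleftrightarrow> r \<le> block_rank k \<and> length (block_matrix k) \<le> n \<and>
     ascending (n - length (block_matrix k)) (block_rank k) ks"

lemma ascendingI:
  assumes "sorted (map block_rank ks)" "length (block_diag ks) = n" "\<And>k. k \<in> set ks \<Longrightarrow> r \<le> block_rank k"
  shows "ascending n r ks"
  using assms
proof (induction ks arbitrary: n r)
  case (Cons k ks)
  then have "ascending (length (block_diag ks)) (block_rank k) ks"
    by (intro Cons.IH) auto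
  then show ?case using Cons.prems by (auto)
qed simp

lemma ex_block:
  "(\<exists>k. P k) \<longleftrightarrow> (\<exists>c. P (Ch2 c)) \<or> (\<exists>c. P (Ch4 c)) \<or> (\<exists>c. P (Ch6 c)) \<or> P J3 \<or> P J5 \<or> P G1 \<or> P G2
    \<or> P G3 \<or> P G4 \<or> P G5 \<or> P G6 \<or> P H2 \<or> P H4 \<or> P H6"
  (is "?L \<longleftrightarrow> ?R")
proof
  assume ?L
  then obtain k where "P k" ..
  then show ?R by (cases k) auto
qed auto

text \<open>Existential form, so that rewriting from size six lists all possibilities; it stops
  because no block matrix is empty.\<close>

lemma ascending_unfold:
  "ascending 0 r ks \<longleftrightarrow> ks = []"
  "ascending (Suc n) r ks \<longleftrightarrow> (\<exists>k. r \<le> block_rank k \<and> length (block_matrix k) \<le> Suc n \<and>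
     (\<exists>ks'. ascending (Suc n - length (block_matrix k)) (block_rank k) ks' \<and> ks = k # ks'))"
proof -
  have "block_matrix k \<noteq> []" for k by (cases k) simp_all
  then show "ascending 0 r ks \<longleftrightarrow> ks = []" by (cases ks) simp_all
  show "ascending (Suc n) r ks \<longleftrightarrow> (\<exists>k. r \<le> block_rank k \<and> length (block_matrix k) \<le> Suc n \<and>
     (\<exists>ks'. ascending (Suc n - length (block_matrix k)) (block_rank k) ks' \<and> ks = k # ks'))"
    by (cases ks) (simp, simp add: conj_ac)
qed

lemma tabulated_lists:
  fixes c d e :: complex
  shows
    "c \<notin> {1, -1} \<Longrightarrow> tabulated [Ch6 c]"
    "tabulated [G6]"
    "tabulated [H6]"
    "tabulated [J5, G1]"
    "tabulated [G5, G1]"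
    "c \<notin> {1, -1} \<Longrightarrow> tabulated [Ch4 c, H2]"
    "c \<notin> {1, -1} \<Longrightarrow> tabulated [Ch4 c, G2]"
    "c \<notin> {1, -1} \<Longrightarrow> d \<notin> {1, -1} \<Longrightarrow> tabulated [Ch4 c, Ch2 d]"
    "tabulated [H4, H2]"
    "tabulated [H4, G2]"
    "c \<notin> {1, -1} \<Longrightarrow> tabulated [H4, Ch2 c]"
    "tabulated [G4, H2]"
    "tabulated [G4, G2]"
    "c \<notin> {1, -1} \<Longrightarrow> tabulated [G4, Ch2 c]"
    "c \<notin> {1, -1} \<Longrightarrow> tabulated [Ch4 c, G1, G1]"
    "tabulated [H4, G1, G1]"
    "tabulated [G4, G1, G1]"
    "tabulated [J3, J3]"
    "tabulated [J3, G3]"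
    "tabulated [G3, G3]"
    "tabulated [J3, H2, G1]"
    "tabulated [J3, G2, G1]"
    "c \<notin> {1, -1} \<Longrightarrow> tabulated [J3, Ch2 c, G1]"
    "tabulated [G3, H2, G1]"
    "tabulated [G3, G2, G1]"
    "c \<notin> {1, -1} \<Longrightarrow> tabulated [G3, Ch2 c, G1]"
    "tabulated [J3, G1, G1, G1]"
    "tabulated [G3, G1, G1, G1]"
    "tabulated [H2, H2, G2]"
    "c \<notin> {1, -1} \<Longrightarrow> tabulated [H2, H2, Ch2 c]"
    "tabulated [H2, G2, G2]"
    "c \<notin> {1, -1} \<Longrightarrow> tabulated [H2, G2, Ch2 c]"
    "c \<notin> {1, -1} \<Longrightarrow> d \<notin> {1, -1} \<Longrightarrow> tabulated [H2, Ch2 c, Ch2 d]"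
    "tabulated [G2, G2, G2]"
    "c \<notin> {1, -1} \<Longrightarrow> tabulated [G2, G2, Ch2 c]"
    "c \<notin> {1, -1} \<Longrightarrow> d \<notin> {1, -1} \<Longrightarrow> tabulated [G2, Ch2 c, Ch2 d]"
    "c \<notin> {1, -1} \<Longrightarrow> d \<notin> {1, -1} \<Longrightarrow> e \<notin> {1, -1} \<Longrightarrow> tabulated [Ch2 c, Ch2 d, Ch2 e]"
    "tabulated [H2, H2, G1, G1]"
    "tabulated [H2, G2, G1, G1]"
    "c \<notin> {1, -1} \<Longrightarrow> tabulated [H2, Ch2 c, G1, G1]"
    "tabulated [G2, G2, G1, G1]"
    "c \<notin> {1, -1} \<Longrightarrow> tabulated [G2, Ch2 c, G1, G1]"
    "c \<notin> {1, -1} \<Longrightarrow> d \<notin> {1, -1} \<Longrightarrow> tabulated [Ch2 c, Ch2 d, G1, G1]"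
    "tabulated [H2, G1, G1, G1, G1]"
    "tabulated [G2, G1, G1, G1, G1]"
    "c \<notin> {1, -1} \<Longrightarrow> tabulated [Ch2 c, G1, G1, G1, G1]"
    "tabulated [G1, G1, G1, G1, G1, G1]"
  apply (rule tabulatedI, rule table_1, assumption, simp, simp add: all_less_six nth_append)
  apply (rule tabulatedI, rule table_2, simp, simp add: all_less_six nth_append)
  apply (rule tabulatedI, rule table_3, simp, simp add: all_less_six nth_append)
  apply (rule tabulatedI, rule table_4, simp, simp add: all_less_six nth_append)
  apply (rule tabulatedI, rule table_5, simp, simp add: all_less_six nth_append)
  apply (rule tabulatedI, rule table_6, assumption, simp, simp add: all_less_six nth_append)
  apply (rule tabulatedI, rule table_7, assumption, simp, simp add: all_less_six nth_append)
  apply (rule tabulatedI, rule table_8[of c d], assumption, assumption, simp, simp add: all_less_six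
    nth_append)
  apply (rule tabulatedI, rule table_9, simp, simp add: all_less_six nth_append)
  apply (rule tabulatedI, rule table_10, simp, simp add: all_less_six nth_append)
  apply (rule tabulatedI, rule table_11, assumption, simp, simp add: all_less_six nth_append)
  apply (rule tabulatedI, rule table_12, simp, simp add: all_less_six nth_append)
  apply (rule tabulatedI, rule table_13, simp, simp add: all_less_six nth_append)
  apply (rule tabulatedI, rule table_14, assumption, simp, simp add: all_less_six nth_append)
  apply (rule tabulatedI, rule table_15, assumption, simp, simp add: all_less_six nth_append)
  apply (rule tabulatedI, rule table_16, simp, simp add: all_less_six nth_append)
  apply (rule tabulatedI, rule table_17, simp, simp add: all_less_six nth_append)
  apply (rule tabulatedI, rule table_18, simp, simp add: all_less_six nth_append)
  apply (rule tabulatedI, rule table_19, simp, simp add: all_less_six nth_append)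
  apply (rule tabulatedI, rule table_20, simp, simp add: all_less_six nth_append)
  apply (rule tabulatedI, rule table_21, simp, simp add: all_less_six nth_append)
  apply (rule tabulatedI, rule table_22, simp, simp add: all_less_six nth_append)
  apply (rule tabulatedI, rule table_23, assumption, simp, simp add: all_less_six nth_append)
  apply (rule tabulatedI, rule table_24, simp, simp add: all_less_six nth_append)
  apply (rule tabulatedI, rule table_25, simp, simp add: all_less_six nth_append)
  apply (rule tabulatedI, rule table_26, assumption, simp, simp add: all_less_six nth_append)
  apply (rule tabulatedI, rule table_27, simp, simp add: all_less_six nth_append)
  apply (rule tabulatedI, rule table_28, simp, simp add: all_less_six nth_append)
  apply (rule tabulatedI, rule table_29, simp, simp add: all_less_six nth_append)
  apply (rule tabulatedI, rule table_30, assumption, simp, simp add: all_less_six nth_append)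
  apply (rule tabulatedI, rule table_31, simp, simp add: all_less_six nth_append)
  apply (rule tabulatedI, rule table_32, assumption, simp, simp add: all_less_six nth_append)
  apply (rule tabulatedI, rule table_33[of c d], assumption, assumption, simp, simp add: all_less_six
    nth_append)
  apply (rule tabulatedI, rule table_34, simp, simp add: all_less_six nth_append)
  apply (rule tabulatedI, rule table_35, assumption, simp, simp add: all_less_six nth_append)
  apply (rule tabulatedI, rule table_36[of c d], assumption, assumption, simp, simp add: all_less_six
    nth_append)
  apply (rule tabulatedI, rule table_37[of c d e], assumption, assumption, assumption, simp,
    simp add: all_less_six nth_append)
  apply (rule tabulatedI, rule table_38, simp, simp add: all_less_six nth_append)
  apply (rule tabulatedI, rule table_39, simp, simp add: all_less_six nth_append)
  apply (rule tabulatedI, rule table_40, assumption, simp, simp add: all_less_six nth_append)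
  apply (rule tabulatedI, rule table_41, simp, simp add: all_less_six nth_append)
  apply (rule tabulatedI, rule table_42, assumption, simp, simp add: all_less_six nth_append)
  apply (rule tabulatedI, rule table_43[of c d], assumption, assumption, simp, simp add: all_less_six
    nth_append)
  apply (rule tabulatedI, rule table_44, simp, simp add: all_less_six nth_append)
  apply (rule tabulatedI, rule table_45, simp, simp add: all_less_six nth_append)
  apply (rule tabulatedI, rule table_46, assumption, simp, simp add: all_less_six nth_append)
  apply (rule tabulatedI, rule table_47, simp, simp add: all_less_six nth_append)
  done

text \<open>Unfolding leaves 48 patterns; the one excluded by hypothesis is the alternating
  form.\<close>

lemma ascending_six_tabulated:
  assumes "ascending 6 0 ks" "list_all valid_block ks" "ks \<noteq> [H2, H2, H2]"
  shows "tabulated ks"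
  using assms(1)
  apply (simp add: numeral_eq_Suc ascending_unfold ex_block)
  apply (elim disjE exE conjE; use assms(2,3) in \<open>simp add: tabulated_lists\<close>)
  done

context complex_bilinear_form
begin

theorem tabulated_basis:
  assumes V: "subspace V" "no_radical V" "dim V = 6" and nonalt: "\<exists>v\<in>V. f v v \<noteq> 0"
  obtains t vs where "listed_table t" "\<And>i. t (i, 7) = None \<and> t (7, i) = None"
    "length vs = 6" "span (set vs) = V"
    "\<And>i j. i < 6 \<Longrightarrow> j < 6 \<Longrightarrow> f (vs ! i) (vs ! j) = (case t (Suc i, Suc j) of None \<Rightarrow> 0 | Some c \<Rightarrow> c)"
proof -
  obtain bs' where bs': "block_sum bs'" "span (set (concat (map snd bs'))) = V"
    "length (concat (map snd bs')) = 6"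
    using block_decomposition[OF V(1,2)] V(3) by auto
  define bs where "bs = sort_key (\<lambda>b. block_rank (fst b)) bs'"
  define vs where "vs = concat (map snd bs)"
  define ks where "ks = map fst bs"
  have bs: "block_sum bs" "span (set vs) = V" "length vs = 6"
    using block_sum_sort[OF bs'(1), of "\<lambda>b. block_rank (fst b)"] bs' by (auto simp: bs_def vs_def)
  have gram: "map (\<lambda>u. map (f u) vs) vs = block_diag ks" "list_all valid_block ks"
    using block_sum_gram[OF bs(1)] by (simp_all only: vs_def ks_def)
  have entry: "f (vs ! i) (vs ! j) = block_diag ks ! i ! j" if "i < 6" "j < 6" for i j
    using that bs(3) by (simp flip: gram(1))
  have "sorted (map block_rank ks)"
    unfolding ks_def bs_def map_map o_def by (rule sorted_sort_key)
  moreover have "length (block_diag ks) = 6" using bs(3) by (simp flip: gram(1))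
  ultimately have "ascending 6 0 ks" by (rule ascendingI) simp
  moreover have "ks \<noteq> [H2, H2, H2]"
  proof
    assume ks: "ks = [H2, H2, H2]"
    have "\<forall>i<6. \<forall>j<6. block_diag ks ! i ! j + block_diag ks ! j ! i = 0"
      by (simp add: ks all_less_six nth_append)
    then have skew: "f (vs ! i) (vs ! j) + f (vs ! j) (vs ! i) = 0" if "i < 6" "j < 6" for i j
      using entry that by simp
    have gen: "f x y + f y x = 0" if "x \<in> set vs" "y \<in> set vs" for x y
      using that skew bs(3) by (auto simp: in_set_conv_nth)
    \<comment> \<open>The symmetrised form is linear in each argument, so its vanishing on
      \<open>vs\<close> spreads to \<open>V\<close>, first in one argument and then in the
      other.\<close>
    have step: "f (a \<odot> x + x') y + f y (a \<odot> x + x') = 0"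
      if "f x y + f y x = 0" "f x' y + f y x' = 0" for a x x' y
    proof -
      have "f (a \<odot> x + x') y + f y (a \<odot> x + x') = a * (f x y + f y x) + (f x' y + f y x')"
        by (simp add: algebra_simps)
      then show ?thesis using that by simp
    qed
    have gen2: "f x y + f y x = 0" if "x \<in> V" "y \<in> set vs" for x y
      using that(1) unfolding bs(2)[symmetric]
      by (induction rule: span_induct_alt) (simp, rule step, use gen that(2) in auto)
    have alt: "f x y + f y x = 0" if "x \<in> V" "y \<in> V" for x y
    proof -
      have gen3: "f u x + f x u = 0" if "u \<in> set vs" for u
        using gen2[OF \<open>x \<in> V\<close> that] by (subst add.commute)
      from that(2) have "y \<in> span (set vs)" by (simp add: bs(2))
      then have "f y x + f x y = 0"
        by (induction rule: span_induct_alt) (simp, rule step, use gen3 in auto)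
      then show ?thesis by (simp add: add.commute)
    qed
    obtain v where v: "v \<in> V" "f v v \<noteq> 0" using nonalt by blast
    then show False using alt[OF v(1,1)] by (simp flip: mult_2)
  qed
  ultimately have "tabulated ks" using gram(2) by (intro ascending_six_tabulated)
  then obtain t where "listed_table t" "\<forall>i. t (i, 7) = None \<and> t (7, i) = None"
    "\<forall>i<6. \<forall>j<6. block_diag ks ! i ! j = (case t (Suc i, Suc j) of None \<Rightarrow> 0 | Some c \<Rightarrow> c)"
    unfolding tabulated_def by blast
  then show thesis using that[of t vs] bs(2,3) entry by simp
qed

end

section \<open>Leibniz algebras with one-dimensional square\<close>

context leibniz_algebra
begin

abbreviation square :: "'a set" where "square \<equiv> lower_series 2"

lemma square_eq: "square = span {br a b | a b. True}"
  by (simp add: numeral_2_eq_2 product_space_def)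

lemma br_in_square: "br a b \<in> square"
  unfolding square_eq by (rule span_base) blast

lemmas br_right = linear_br_right[unfolded Vector_Spaces.linear_iff]
  and br_left = linear_br_left[unfolded Vector_Spaces.linear_iff]

lemma br_add_right: "br a (b + c) = br a b + br a c"
  and br_scale_right: "br a (scale k b) = scale k (br a b)"
  and br_add_left: "br (b + c) a = br b a + br c a"
  and br_scale_left: "br (scale k b) a = scale k (br b a)"
  using br_right br_left by blast+

lemma br_zero: "br a 0 = 0" "br 0 a = 0"
  using br_add_right[of a 0 0] br_add_left[of 0 0 a] by auto

lemma square_spanned:
  assumes "dim square = 1"
  obtains z where "z \<noteq> 0" "square = span {z}"
proof -
  obtain B where B: "B \<subseteq> square" "independent B" "square \<subseteq> span B" "card B = dim square"
    by (rule basis_exists)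
  then obtain z where z: "B = {z}" using assms by (metis card_1_singletonE)
  have "span {z} \<subseteq> square"
    using B(1) z unfolding square_eq by (metis span_minimal subspace_span)
  then show thesis using that[of z] B z by auto
qed

text \<open>Left multiplication by \<open>a\<close> acts on the line of \<open>z\<close> by a
  scalar; a nonzero scalar would keep \<open>z\<close> in every term of the lower series.\<close>

lemma br_square_right:
  assumes z: "z \<noteq> 0" "square = span {z}" and nil: "nilpotent"
  shows "br a z = 0"
proof -
  have "br a z \<in> span {z}" using br_in_square z by blast
  then obtain k where k: "br a z = scale k z" by (auto simp: span_singleton)
  have "k = 0"
  proof (rule ccontr)
    assume "k \<noteq> 0"
    have "z \<in> lower_series m" for m
    proof (induction m rule: lower_series.induct)
      case (3 n)
      then have "br a z \<in> lower_series (Suc (Suc n))"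
        by (auto simp: product_space_def intro: span_base)
      then have "scale (1 / k) (br a z) \<in> lower_series (Suc (Suc n))"
        by (simp add: product_space_def span_scale)
      then show ?case using k \<open>k \<noteq> 0\<close> by simp
    qed simp_all
    then show False using nil z(1) unfolding nilpotent_def by (metis singletonD)
  qed
  then show ?thesis using k by simp
qed

text \<open>The Leibniz identity writes \<open>[[b, c], a]\<close> as
  \<open>[b, [c, a]] - [c, [b, a]]\<close>, and both terms have an element of the square as right
  factor.\<close>

lemma br_square_left:
  assumes z: "z \<noteq> 0" "square = span {z}" and nil: "nilpotent"
  shows "br z a = 0"
proof -
  note right = br_square_right[OF assms]
  have right': "br b y = 0" if "y \<in> square" for b y
    using that right br_scale_right unfolding z(2) by (auto simp: span_singleton)
  have gen: "br (br b c) a = 0" for b c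
    using left_leibniz[of b c a] right' br_in_square by simp
  have "z \<in> span {br a b | a b. True}" using z(2) by (metis singletonI span_base square_eq)
  then show ?thesis
    by (induction rule: span_induct_alt) (use gen in \<open>auto simp: br_zero br_add_left br_scale_left\<close>)
qed

text \<open>In a basis containing \<open>x\<close> and \<open>z\<close>, the vectors other than
  \<open>x\<close> span a space that contains the square and is therefore an ideal; the line of the
  central vector \<open>x\<close> is the other summand.\<close>

lemma central_splits:
  assumes z: "z \<noteq> 0" "square = span {z}" and nil: "nilpotent"
    and x: "\<And>a. br a x = 0" "\<And>a. br x a = 0" "x \<notin> span {z}"
  shows "is_split"
proof -
  have "independent {x, z}" using x(3) z(1) by (simp add: independent_insert)
  then obtain B where B: "{x, z} \<subseteq> B" "independent B" "UNIV \<subseteq> span B"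
    using maximal_independent_subset_extend[OF subset_UNIV] by metis
  have B': "insert x (B - {x}) = B" using B(1) by blast
  have xB: "x \<notin> span (B - {x})"
    using B(1,2) unfolding dependent_def by blast
  have "x \<noteq> z" using x(3) span_base by blast
  then have zJ: "z \<in> span (B - {x})" using B(1) by (intro span_base) auto
  have "two_sided_ideal (span {x})"
    unfolding two_sided_ideal_def
  proof (intro conjI allI ballI subspace_span)
    fix a y assume "y \<in> span {x}"
    then obtain k where "y = scale k x" by (auto simp: span_singleton)
    then show "br a y \<in> span {x}" "br y a \<in> span {x}"
      by (simp_all add: x br_scale_left br_scale_right span_zero)
  qed
  moreover have "two_sided_ideal (span (B - {x}))"
  proof -
    have "square \<subseteq> span (B - {x})" unfolding z(2) using zJ by (intro span_minimal) auto
    then show ?thesis using br_in_square by (auto simp: two_sided_ideal_def)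
  qed
  moreover have "span {x} \<noteq> {0}" "span (B - {x}) \<noteq> {0}"
    using x(3) span_base[of x "{x}"] span_zero zJ z(1) by (metis singletonI singletonD)+
  moreover have "span {x} \<inter> span (B - {x}) = {0}"
  proof -
    have "k = 0" if "scale k x \<in> span (B - {x})" for k
    proof (rule ccontr)
      assume "k \<noteq> 0"
      then have "x = scale (1 / k) (scale k x)" by simp
      then show False using that span_scale xB by metis
    qed
    then show ?thesis by (auto simp: span_singleton span_zero)
  qed
  moreover have "{u + v | u v. u \<in> span {x} \<and> v \<in> span (B - {x})} = UNIV"
    using span_Un[of "{x}" "B - {x}"] B(3) B' by auto
  ultimately show ?thesis unfolding is_split_def by blast
qed

text \<open>Any complement of the line of \<open>z\<close> may serve as \<open>V\<close>, because
  the central \<open>z\<close> does not affect \<open>f\<close>. Being non-split excludes a common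
  radical on \<open>V\<close>, and being non-Lie gives a vector with nonzero square.\<close>

theorem listed_basis_exists:
  assumes dims: "dim (UNIV :: 'a set) = 7" "dim square = 1"
    and nil: "nilpotent" and "\<not> is_split" and "\<not> is_Lie"
  obtains x t where "listed_table t" "basis_with_table x t"
proof -
  obtain B where B: "B \<subseteq> UNIV" "independent B" "UNIV \<subseteq> span B" "card B = dim (UNIV :: 'a set)"
    by (rule basis_exists)
  then have "finite B" using dims(1) by (intro card_ge_0_finite) simp
  obtain z where z: "z \<noteq> 0" "square = span {z}" using square_spanned[OF dims(2)] by blast
  note z_right = br_square_right[OF z nil] and z_left = br_square_left[OF z nil]
  \<comment> \<open>The scalar exists because the square is the line of \<open>z\<close>, and it is
    unique because \<open>z\<close> is nonzero.\<close>
  define f where "f a b = (SOME k. br a b = scale k z)" for a b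
  have br_f: "br a b = scale (f a b) z" for a b
  proof -
    have "\<exists>k. br a b = scale k z" using br_in_square[of a b] z(2) by (auto simp: span_singleton)
    then show ?thesis unfolding f_def by (rule someI_ex)
  qed
  have f_eqI: "f a b = k" if "br a b = scale k z" for a b k
    using that br_f[of a b] z(1) by simp
  interpret complex_bilinear_form scale B f
  proof unfold_locales
    show "finite B" "independent B" "span B = UNIV" using \<open>finite B\<close> B by auto
    show "f (x + y) w = f x w + f y w" "f w (x + y) = f w x + f w y"
      "f (scale a x) y = a * f x y" "f x (scale a y) = a * f x y" for x y w a
      by (rule f_eqI, simp only: br_add_left br_add_right br_scale_left br_scale_right,
          simp add: br_f scale_left_distrib)+
  qed
  have fz: "f a z = 0" "f z a = 0" for a by (rule f_eqI; simp add: z_left z_right)+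
  obtain B' where B': "{z} \<subseteq> B'" "independent B'" "UNIV \<subseteq> span B'"
    using maximal_independent_subset_extend[of "{z}" UNIV] z(1) by auto
  have card: "card B' = 7" using basis_card_eq_dim[OF subset_UNIV B'(3,2)] dims(1) by simp
  define V where "V = span (B' - {z})"
  have V: "subspace V" "dim V = 6"
    using dim_eq_card_independent[OF independent_mono[OF B'(2), of "B' - {z}"]] card B'(1)
    by (auto simp: V_def)
  have decomp: "\<exists>v\<in>V. \<exists>k. a = v + scale k z" for a
  proof -
    have "insert z (B' - {z}) = B'" using B'(1) by blast
    then have "a \<in> span (insert z (B' - {z}))" using B'(3) by auto
    then obtain k where "a - scale k z \<in> V" unfolding span_breakdown_eq V_def by blast
    then show ?thesis by (intro bexI[of _ "a - scale k z"] exI[of _ k]) auto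
  qed
  have zV: "z \<notin> V" using B'(1,2) unfolding V_def dependent_def by blast
  have "no_radical V"
    unfolding no_radical_def
  proof (intro ballI impI)
    fix x assume x: "x \<in> V" "\<forall>y\<in>V. f x y = 0 \<and> f y x = 0"
    have rad: "br a x = 0" "br x a = 0" for a
    proof -
      obtain v k where "v \<in> V" "a = v + scale k z" using decomp by blast
      then show "br a x = 0" "br x a = 0" using x by (simp_all add: br_f fz)
    qed
    show "x = 0"
    proof (rule ccontr)
      assume "x \<noteq> 0"
      have "x \<notin> span {z}"
      proof
        assume "x \<in> span {z}"
        then obtain k where k: "x = scale k z" by (auto simp: span_singleton)
        then have "scale (1 / k) x = z" using \<open>x \<noteq> 0\<close> by auto
        then show False using subspace_scale[OF V(1) x(1)] zV by metis
      qed
      then show False using central_splits[OF z nil rad] \<open>\<not> is_split\<close> by blast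
    qed
  qed
  moreover have "\<exists>v\<in>V. f v v \<noteq> 0"
  proof (rule ccontr)
    assume none: "\<not> ?thesis"
    have "br a a = 0" for a
    proof -
      obtain v k where "v \<in> V" "a = v + scale k z" using decomp by blast
      then show ?thesis using none by (simp add: br_f fz)
    qed
    then have "{br a a | a. True} = {0}" by auto
    then have "Leib = {0}" by (simp add: Leib_def)
    then show False using \<open>\<not> is_Lie\<close> by (simp add: is_Lie_def)
  qed
  ultimately obtain t vs where t: "listed_table t" "\<And>i. t (i, 7) = None \<and> t (7, i) = None"
    and vs: "length vs = 6" "span (set vs) = V"
      "\<And>i j. i < 6 \<Longrightarrow> j < 6 \<Longrightarrow> f (vs ! i) (vs ! j) = (case t (Suc i, Suc j) of None \<Rightarrow> 0 | Some c \<Rightarrow> c)"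
    using tabulated_basis[OF V(1) _ V(2)] by metis
  \<comment> \<open>Shift to indices from 1, so that \<open>x 7\<close> is \<open>z\<close>; the
    value at 0 is irrelevant.\<close>
  define x where "x i = (vs @ [z]) ! (i - 1)" for i
  have image: "x ` {1..7} = set (vs @ [z])"
  proof -
    have "x ` {1..7} = (\<lambda>i. (vs @ [z]) ! i) ` ((\<lambda>i. i - 1) ` {1..7})"
      unfolding image_image x_def ..
    also have "(\<lambda>i::nat. i - 1) ` {1..7} = {..<7}"
    proof -
      have "n \<in> (\<lambda>i. i - 1) ` {1..7}" if "n < 7" for n :: nat
        using that by (intro image_eqI[of _ _ "Suc n"]) auto
      then show ?thesis by auto
    qed
    finally show ?thesis using vs(1) by (simp add: set_conv_nth lessThan_def image_def del: set_append)
      blast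
  qed
  have spans: "span (x ` {1..7}) = UNIV"
  proof -
    have "a \<in> span (insert z (set vs))" for a
    proof -
      obtain v k where "v \<in> V" "a = v + scale k z" using decomp by blast
      then show ?thesis using vs(2) by (auto simp: span_breakdown_eq intro!: exI[of _ k])
    qed
    then show ?thesis unfolding image by auto
  qed
  have "7 \<le> card (x ` {1..7})" using dim_le_card[of UNIV "x ` {1..7}"] spans dims(1) by simp
  moreover have "card (x ` {1..7}) \<le> 7" using card_image_le[of "{1..7::nat}" x] by simp
  ultimately have card_x: "card (x ` {1..7}) = 7" by simp
  have "basis_with_table x t"
    unfolding basis_with_table_def
  proof (intro conjI ballI)
    show "inj_on x {1..7}" using card_x by (intro eq_card_imp_inj_on) auto
    show "independent (x ` {1..7})"
      using card_x dims(1) spans by (intro card_le_dim_spanning[of _ UNIV]) auto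
    show "span (x ` {1..7}) = UNIV" by (rule spans)
    fix i j :: nat assume ij: "i \<in> {1..7}" "j \<in> {1..7}"
    have x7: "x 7 = z" using vs(1) by (simp add: x_def nth_append)
    show "br (x i) (x j) = (case t (i, j) of None \<Rightarrow> 0 | Some c \<Rightarrow> scale c (x 7))"
    proof (cases "i = 7 \<or> j = 7")
      case True
      then show ?thesis using t(2) z_left z_right unfolding x7[symmetric] by auto
    next
      case False
      then obtain i' j' where i': "i = Suc i'" "j = Suc j'" "i' < 6" "j' < 6"
        using ij by (cases i; cases j) auto
      then have "br (x i) (x j) = scale (case t (i, j) of None \<Rightarrow> 0 | Some c \<Rightarrow> c) z"
        using vs(1,3) by (simp add: br_f x_def nth_append)
      then show ?thesis by (simp add: x7 split: option.splits)
    qed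
  qed
  then show thesis using that t(1) by blast
qed

end

text \<open>The given algebra itself has a listed basis. Bracket and basis are transported along a
  linear isomorphism to \<open>complex^7\<close>, which only provides a concrete carrier for the
  isomorphic copy.\<close>

theorem theorem2p6:
  fixes scale :: "complex \<Rightarrow> 'a::ab_group_add \<Rightarrow> 'a"
    and br :: "'a \<Rightarrow> 'a \<Rightarrow> 'a"
  assumes "leibniz_algebra scale br"
    and "\<not> leibniz_algebra.is_split scale br"
    and "\<not> leibniz_algebra.is_Lie scale br"
    and "leibniz_algebra.nilpotent scale br"
    and "vector_space.dim scale (UNIV :: 'a set) = 7"
    and "vector_space.dim scale (leibniz_algebra.lower_series scale br 2) = 1"
  shows "\<exists>(brB :: complex^7 \<Rightarrow> complex^7 \<Rightarrow> complex^7) x t.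
    leibniz_algebra (*s) brB \<and>
    leibniz_isomorphic scale br (*s) brB \<and>
    leibniz_algebra.basis_with_table (*s) brB x t \<and>
    listed_table t"
proof -
  interpret A: leibniz_algebra scale br by fact
  obtain x t where t: "listed_table t" and x: "A.basis_with_table x t"
    using A.listed_basis_exists assms(2-6) by blast
  note x = x[unfolded A.basis_with_table_def]
  have "card (x ` {1..7}) = 7" using x by (simp add: card_image)
  have fin: "finite_dimensional_vector_space scale (x ` {1..7})"
    using x by unfold_locales auto
  interpret P: finite_dimensional_vector_space_pair scale "x ` {1..7}"
    "(*s) :: complex \<Rightarrow> complex^7 \<Rightarrow> complex^7" cart_basis
    using fin vec.finite_dimensional_vector_space_axioms
    by (intro finite_dimensional_vector_space_pair.intro)
  have "A.dim (UNIV :: 'a set) = vec.dim (UNIV :: (complex^7) set)"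
    using assms(5) by (simp add: vec.dim_UNIV card_cart_basis)
  then obtain \<phi> where \<phi>: "Vector_Spaces.linear scale (*s) \<phi>" "\<phi> ` UNIV = (UNIV :: (complex^7) set)"
    "inj \<phi>"
    using P.subspace_isomorphism[of UNIV UNIV] A.subspace_UNIV vec.subspace_UNIV by metis
  interpret L: Vector_Spaces.linear scale "(*s) :: complex \<Rightarrow> complex^7 \<Rightarrow> complex^7" \<phi> by fact
  have bij: "bij \<phi>" using \<phi> by (simp add: bij_def)
  define \<psi> where "\<psi> = inv \<phi>"
  have inv [simp]: "\<psi> (\<phi> a) = a" "\<phi> (\<psi> u) = u" for a u
    using bij by (simp_all add: \<psi>_def bij_is_inj bij_is_surj surj_f_inv_f)
  have \<psi>: "\<psi> (u + v) = \<psi> u + \<psi> v" for u v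
    by (metis inv L.add)
  have \<psi>_scale: "\<psi> (k *s u) = scale k (\<psi> u)" for u k
    by (metis inv L.scale)
  define brB where "brB u v = \<phi> (br (\<psi> u) (\<psi> v))" for u v
  interpret C: leibniz_algebra "(*s) :: complex \<Rightarrow> complex^7 \<Rightarrow> complex^7" brB
  proof (intro leibniz_algebra.intro leibniz_algebra_axioms.intro vec.vector_space_axioms)
    show "Vector_Spaces.linear (*s) (*s) (brB a)" for a
      by (simp add: Vector_Spaces.linear_iff vec.vector_space_axioms brB_def \<psi> \<psi>_scale L.add L.scale
          A.br_add_right A.br_scale_right)
    show "Vector_Spaces.linear (*s) (*s) (\<lambda>a. brB a b)" for b
      by (simp add: Vector_Spaces.linear_iff vec.vector_space_axioms brB_def \<psi> \<psi>_scale L.add L.scale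
          A.br_add_left A.br_scale_left)
    show "brB a (brB b c) = brB (brB a b) c + brB b (brB a c)" for a b c
      using A.left_leibniz[of "\<psi> a" "\<psi> b" "\<psi> c"] by (simp add: brB_def L.add)
  qed
  have "leibniz_isomorphic scale br (*s) brB"
    unfolding leibniz_isomorphic_def using \<phi>(1) bij by (intro exI[of _ \<phi>]) (simp add: brB_def)
  moreover have "C.basis_with_table (\<phi> \<circ> x) t"
    unfolding C.basis_with_table_def
  proof (intro conjI ballI)
    show "inj_on (\<phi> \<circ> x) {1..7}"
      using x \<phi>(3) by (intro comp_inj_on) (auto intro: inj_on_subset)
    show "vec.independent ((\<phi> \<circ> x) ` {1..7})"
      using P.linear_independent_injective_image[OF \<phi>(1), of "x ` {1..7}"] x \<phi>(3)
      by (simp add: image_comp)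
    show "vec.span ((\<phi> \<circ> x) ` {1..7}) = UNIV"
      using P.linear_span_image[OF \<phi>(1), of "x ` {1..7}"] x \<phi>(2) by (simp add: image_comp)
    fix i j :: nat assume "i \<in> {1..7}" "j \<in> {1..7}"
    then have "br (x i) (x j) = (case t (i, j) of None \<Rightarrow> 0 | Some c \<Rightarrow> scale c (x 7))" using x by blast
    then show "brB ((\<phi> \<circ> x) i) ((\<phi> \<circ> x) j) = (case t (i, j) of None \<Rightarrow> 0 | Some c \<Rightarrow> c *s (\<phi> \<circ> x) 7)"
      by (simp add: brB_def L.zero L.scale split: option.splits)
  qed
  ultimately show ?thesis using C.leibniz_algebra_axioms t by blast
qed

end
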